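(* For $i=1,2$, let $B_i\subseteq M_i$ be irreducible unital inclusions of factors, with $M_i$ faithfully represented on a Hilbert space $H_i$. Let $B=B_1\,\overline{\otimes}\,B_2\subseteq M=M_1\,\overline{\otimes}\,M_2$, acting on $H_1\otimes H_2$, so that $M'=M_1'\,\overline{\otimes}\,M_2'$ and $B'=B_1'\,\overline{\otimes}\,B_2'$. Let $\theta\in\mathrm{Aut}_{M'}(B')$. Then there exist automorphisms $\theta_i\in\mathrm{Aut}_{M_i'}(B_i')$, $i=1,2$, such that $\theta=\theta_1\otimes\theta_2$.
   Context: An inclusion $B\subseteq M$ of factors is irreducible if $B'\cap M=\mathbb C1$. The commutants $B_i',M_i'$ are taken in $\mathbb B(H_i)$ and $B',M'$ in $\mathbb B(H_1\otimes H_2)$. For an inclusion $N\subseteq P$ of von Neumann algebras, $\mathrm{Aut}_N(P)$ is the group of automorphisms $\theta$ of $P$ with $\theta(n)=n$ for all $n\in N$. $\overline{\otimes}$ is the von Neumann algebra tensor product. All inclusions share the same unit. *)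

theory Defs
  imports "HOL-Analysis.Analysis"
begin

text \<open>
  A complex Hilbert space is presented on top of its underlying real Hilbert space
  (\<open>inner\<close> is the real part of \<open>cinner\<close>), so that norm, topology and completeness are the
  library's.  The complex inner product is linear in the first argument.  No separability
  is assumed.
\<close>

class complex_hilbert_space = real_inner + complete_space +
  fixes scaleC :: "complex \<Rightarrow> 'a \<Rightarrow> 'a"  (infixr \<open>*\<^sub>C\<close> 75)
    and cinner :: "'a \<Rightarrow> 'a \<Rightarrow> complex"
  assumes scaleC_add_right: "c *\<^sub>C (x + y) = c *\<^sub>C x + c *\<^sub>C y"
    and scaleC_add_left: "(c + d) *\<^sub>C x = c *\<^sub>C x + d *\<^sub>C x"
    and scaleC_scaleC: "c *\<^sub>C (d *\<^sub>C x) = (c * d) *\<^sub>C x"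
    and scaleR_scaleC: "r *\<^sub>R x = complex_of_real r *\<^sub>C x"
    and cinner_add_left: "cinner (x + y) z = cinner x z + cinner y z"
    and cinner_scaleC_left: "cinner (c *\<^sub>C x) y = c * cinner x y"
    and cinner_commute: "cinner x y = cnj (cinner y x)"
    and inner_eq_Re_cinner: "inner x y = Re (cinner x y)"

section \<open>Bounded operators\<close>

text \<open>The library type of bounded operators consists of the bounded real-linear maps;
  \<open>\<B>(H)\<close> is the set of complex-linear ones.\<close>

definition bounded_ops :: "('a::complex_hilbert_space \<Rightarrow>\<^sub>L 'a) set" where
  "bounded_ops = {T. \<forall>c x. blinfun_apply T (c *\<^sub>C x) = c *\<^sub>C blinfun_apply T x}"

definition scalar_op :: "complex \<Rightarrow> ('a::complex_hilbert_space \<Rightarrow>\<^sub>L 'a)" where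
  "scalar_op c = Blinfun (\<lambda>x. c *\<^sub>C x)"

definition adj :: "('a::complex_hilbert_space \<Rightarrow>\<^sub>L 'a) \<Rightarrow> ('a \<Rightarrow>\<^sub>L 'a)" where
  "adj T = (THE S. \<forall>x y. cinner (blinfun_apply T x) y = cinner x (blinfun_apply S y))"

definition op_le :: "('a::complex_hilbert_space \<Rightarrow>\<^sub>L 'a) \<Rightarrow> ('a \<Rightarrow>\<^sub>L 'a) \<Rightarrow> bool" where
  "op_le S T \<longleftrightarrow> (\<forall>x. cinner (blinfun_apply (T - S) x) x \<in> \<real> \<and>
                     0 \<le> Re (cinner (blinfun_apply (T - S) x) x))"

section \<open>Von Neumann algebras\<close>

definition commutant ::
    "('a::complex_hilbert_space \<Rightarrow>\<^sub>L 'a) set \<Rightarrow> ('a \<Rightarrow>\<^sub>L 'a) set" where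
  "commutant S = {T \<in> bounded_ops. \<forall>s\<in>S. T o\<^sub>L s = s o\<^sub>L T}"

text \<open>Von Neumann algebras are given in Dixmier's form: self-adjoint sets of operators that
  equal their bicommutant (which makes them unital algebras).\<close>

definition von_neumann_algebra :: "('a::complex_hilbert_space \<Rightarrow>\<^sub>L 'a) set \<Rightarrow> bool" where
  "von_neumann_algebra M \<longleftrightarrow>
     M \<subseteq> bounded_ops \<and> (\<forall>x\<in>M. adj x \<in> M) \<and> commutant (commutant M) = M"

definition factor :: "('a::complex_hilbert_space \<Rightarrow>\<^sub>L 'a) set \<Rightarrow> bool" where
  "factor M \<longleftrightarrow> von_neumann_algebra M \<and> M \<inter> commutant M = range scalar_op"

definition irreducible_inclusion ::
    "('a::complex_hilbert_space \<Rightarrow>\<^sub>L 'a) set \<Rightarrow> ('a \<Rightarrow>\<^sub>L 'a) set \<Rightarrow> bool" where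
  "irreducible_inclusion B M \<longleftrightarrow> B \<subseteq> M \<and> commutant B \<inter> M = range scalar_op"

section \<open>Automorphisms\<close>

text \<open>Maps on a von Neumann algebra are total functions on operators; only their values on
  the algebra matter.\<close>

definition star_automorphism ::
    "('a::complex_hilbert_space \<Rightarrow>\<^sub>L 'a) set \<Rightarrow> (('a \<Rightarrow>\<^sub>L 'a) \<Rightarrow> ('a \<Rightarrow>\<^sub>L 'a)) \<Rightarrow> bool" where
  "star_automorphism P \<theta> \<longleftrightarrow>
     bij_betw \<theta> P P \<and>
     (\<forall>x\<in>P. \<forall>y\<in>P. \<theta> (x + y) = \<theta> x + \<theta> y) \<and>
     (\<forall>c. \<forall>x\<in>P. \<theta> (scalar_op c o\<^sub>L x) = scalar_op c o\<^sub>L \<theta> x) \<and>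
     (\<forall>x\<in>P. \<forall>y\<in>P. \<theta> (x o\<^sub>L y) = \<theta> x o\<^sub>L \<theta> y) \<and>
     (\<forall>x\<in>P. \<theta> (adj x) = adj (\<theta> x))"

definition Aut_fixing ::
    "('a::complex_hilbert_space \<Rightarrow>\<^sub>L 'a) set \<Rightarrow> ('a \<Rightarrow>\<^sub>L 'a) set
      \<Rightarrow> (('a \<Rightarrow>\<^sub>L 'a) \<Rightarrow> ('a \<Rightarrow>\<^sub>L 'a)) set" where
  "Aut_fixing N P = {\<theta>. star_automorphism P \<theta> \<and> (\<forall>n\<in>N. \<theta> n = n)}"

text \<open>Normality: suprema of upward directed families of self-adjoint elements are preserved.
  Suprema are taken inside the algebra; for bounded directed families in a von Neumann
  algebra they agree with those in \<open>\<B>(H)\<close>.\<close>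

definition is_sup_in ::
    "('a::complex_hilbert_space \<Rightarrow>\<^sub>L 'a) set \<Rightarrow> ('a \<Rightarrow>\<^sub>L 'a) set \<Rightarrow> ('a \<Rightarrow>\<^sub>L 'a) \<Rightarrow> bool" where
  "is_sup_in P F s \<longleftrightarrow>
     s \<in> P \<and> (\<forall>f\<in>F. op_le f s) \<and> (\<forall>u\<in>P. (\<forall>f\<in>F. op_le f u) \<longrightarrow> op_le s u)"

definition normal_on ::
    "('a::complex_hilbert_space \<Rightarrow>\<^sub>L 'a) set \<Rightarrow> (('a \<Rightarrow>\<^sub>L 'a) \<Rightarrow> ('a \<Rightarrow>\<^sub>L 'a)) \<Rightarrow> bool" where
  "normal_on P \<theta> \<longleftrightarrow>
     (\<forall>F s. F \<noteq> {} \<and> F \<subseteq> {x \<in> P. adj x = x} \<and>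
        (\<forall>f\<in>F. \<forall>g\<in>F. \<exists>h\<in>F. op_le f h \<and> op_le g h) \<and> is_sup_in P F s
        \<longrightarrow> is_sup_in P (\<theta> ` F) (\<theta> s))"

section \<open>Tensor products\<close>

text \<open>\<open>t\<close> exhibits \<open>'c\<close> as the Hilbert space tensor product of \<open>'a\<close> and \<open>'b\<close>, with
  \<open>t x y\<close> the elementary tensor of \<open>x\<close> and \<open>y\<close>; this determines \<open>'c\<close> up to a unique unitary.
  The elementary tensors are stable under complex scalars, so their real span is their
  complex span.\<close>

definition hilbert_tensor ::
    "('a::complex_hilbert_space \<Rightarrow> 'b::complex_hilbert_space \<Rightarrow> 'c::complex_hilbert_space)
      \<Rightarrow> bool" where
  "hilbert_tensor t \<longleftrightarrow>
     (\<forall>x x' y. t (x + x') y = t x y + t x' y) \<and>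
     (\<forall>x y y'. t x (y + y') = t x y + t x y') \<and>
     (\<forall>c x y. t (c *\<^sub>C x) y = c *\<^sub>C t x y) \<and>
     (\<forall>c x y. t x (c *\<^sub>C y) = c *\<^sub>C t x y) \<and>
     (\<forall>x x' y y'. cinner (t x y) (t x' y') = cinner x x' * cinner y y') \<and>
     closure (span {t x y | x y. True}) = UNIV"

definition op_tensor ::
    "('a::complex_hilbert_space \<Rightarrow> 'b::complex_hilbert_space \<Rightarrow> 'c::complex_hilbert_space)
      \<Rightarrow> ('a \<Rightarrow>\<^sub>L 'a) \<Rightarrow> ('b \<Rightarrow>\<^sub>L 'b) \<Rightarrow> ('c \<Rightarrow>\<^sub>L 'c)" where
  "op_tensor t a b =
     (THE T. \<forall>x y. blinfun_apply T (t x y) = t (blinfun_apply a x) (blinfun_apply b y))"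

text \<open>The von Neumann algebra generated by the elementary tensors (a self-adjoint set).\<close>

definition vn_tensor ::
    "('a::complex_hilbert_space \<Rightarrow> 'b::complex_hilbert_space \<Rightarrow> 'c::complex_hilbert_space)
      \<Rightarrow> ('a \<Rightarrow>\<^sub>L 'a) set \<Rightarrow> ('b \<Rightarrow>\<^sub>L 'b) set \<Rightarrow> ('c \<Rightarrow>\<^sub>L 'c) set" where
  "vn_tensor t M1 M2 = commutant (commutant {op_tensor t a b | a b. a \<in> M1 \<and> b \<in> M2})"

text \<open>\<open>is_tensor_automorphism t N1 N2 \<theta>1 \<theta>2 \<theta>\<close> says that, on the von Neumann algebra tensor
  product of \<open>N1\<close> and \<open>N2\<close>, the map \<open>\<theta>\<close> is the tensor product of \<open>\<theta>1\<close> and \<open>\<theta>2\<close>, i.e. the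
  (unique) normal automorphism with the prescribed values on elementary tensors.\<close>

definition is_tensor_automorphism ::
    "('a::complex_hilbert_space \<Rightarrow> 'b::complex_hilbert_space \<Rightarrow> 'c::complex_hilbert_space)
      \<Rightarrow> ('a \<Rightarrow>\<^sub>L 'a) set \<Rightarrow> ('b \<Rightarrow>\<^sub>L 'b) set
      \<Rightarrow> (('a \<Rightarrow>\<^sub>L 'a) \<Rightarrow> ('a \<Rightarrow>\<^sub>L 'a)) \<Rightarrow> (('b \<Rightarrow>\<^sub>L 'b) \<Rightarrow> ('b \<Rightarrow>\<^sub>L 'b))
      \<Rightarrow> (('c \<Rightarrow>\<^sub>L 'c) \<Rightarrow> ('c \<Rightarrow>\<^sub>L 'c)) \<Rightarrow> bool" where
  "is_tensor_automorphism t N1 N2 \<theta>1 \<theta>2 \<theta> \<longleftrightarrow>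
     star_automorphism (vn_tensor t N1 N2) \<theta> \<and>
     normal_on (vn_tensor t N1 N2) \<theta> \<and>
     (\<forall>a\<in>N1. \<forall>b\<in>N2. \<theta> (op_tensor t a b) = op_tensor t (\<theta>1 a) (\<theta>2 b))"

end

theory Submission
  imports Defs
begin

text \<open>
  The commutation theorem \<open>(M\<^sub>1 \<otimes> M\<^sub>2)' = M\<^sub>1' \<otimes> M\<^sub>2'\<close> is proved after Rieffel and van Daele.  Let \<open>\<xi>\<close> be a
  vector and cut down by the projections onto the closures of \<open>M\<xi>\<close> and \<open>M'\<xi>\<close>, so that \<open>\<xi>\<close> becomes
  cyclic for \<open>M\<close> and \<open>M'\<close>.  Then the closed real subspaces \<open>K\<close> and \<open>\<i>L\<close>, where \<open>K\<close> and \<open>L\<close> are spanned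
  by the vectors \<open>a\<xi>\<close> with \<open>a\<close> self-adjoint in \<open>M\<close> and in \<open>M'\<close>, are orthogonal complements of each
  other for the real inner product, and this property passes to tensor products.  If \<open>S\<close>
  and \<open>T\<close> are self-adjoint and commute with \<open>M\<^sub>1 \<otimes> M\<^sub>2\<close> and with \<open>M\<^sub>1' \<otimes> M\<^sub>2'\<close>, then for
  \<open>\<xi> = \<xi>\<^sub>1 \<otimes> \<xi>\<^sub>2\<close> the compressions of \<open>S\<xi>\<close> and \<open>T\<xi>\<close> are orthogonal to \<open>\<i>K\<^sub>1 \<otimes> K\<^sub>2\<close> and \<open>\<i>L\<^sub>1 \<otimes> L\<^sub>2\<close>, so \<open>\<langle>S\<xi>, T\<xi>\<rangle>\<close> is
  real, and \<open>S T = T S\<close> by polarization.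

  The automorphism \<open>\<theta>\<close> fixes \<open>1 \<otimes> M\<^sub>2'\<close>, so it preserves the relative commutant of this algebra in
  \<open>B\<^sub>1' \<otimes> B\<^sub>2'\<close>, which is \<open>B\<^sub>1' \<otimes> 1\<close> because \<open>B\<^sub>2' \<inter> M\<^sub>2\<close> is trivial.  By symmetry it preserves
  \<open>1 \<otimes> B\<^sub>2'\<close> as well, and it is normal since it preserves squares of self-adjoint elements and hence
  the order.
\<close>


section \<open>Real Hilbert spaces\<close>

text \<open>\<open>K\<close> and \<open>L\<close> are only real subspaces, and the argument lives in
  the real inner product. Projections, representation of forms and square roots are therefore
  developed over the reals, and complex linearity is recovered as commutation with
  \<open>\<i>\<close>. A von Neumann algebra need not have a vector that is cyclic for it and for
  its commutant, so every vector brings its own pair of projections; the cut down is done by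
  compressing vectors, without changing the Hilbert space. In the tensor step, orthogonality of
  \<open>K1 \<otimes> K2\<close> and \<open>\<i>(L1 \<otimes> L2)\<close> is clear, because products
  of real numbers are real. The hard half is that only 0 is orthogonal to both; there the square
  root of a positive operator is used in place of its spectral decomposition. Elementary tensors
  suffice as test vectors because one may polarize in each factor separately. For the automorphism,
  slices decide whether an operator has the form \<open>a \<otimes> 1\<close>: if it commutes with
  \<open>1 \<otimes> Y\<close> for an irreducible set \<open>Y\<close>, its slices on the second
  factor are scalars.\<close>

class hilbert_space = real_inner + complete_space

subclass (in hilbert_space) banach ..

subclass (in complex_hilbert_space) hilbert_space ..

instance prod :: (hilbert_space, hilbert_space) hilbert_space ..

text \<open>The right-hand side is a quadratic polynomial in \<open>r\<close>; at
  \<open>inner z y / (norm y)\<^sup>2\<close> it lies below \<open>(norm z)\<^sup>2\<close> by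
  exactly \<open>(inner z y)\<^sup>2 / (norm y)\<^sup>2\<close>.\<close>

lemma inner_eq_zero_if_quadratic_nonneg:
  fixes z y :: "'a::real_inner"
  assumes "\<And>r::real. (norm z)\<^sup>2 \<le> (norm (z - r *\<^sub>R y))\<^sup>2"
  shows "inner z y = 0"
proof (cases "y = 0")
  case False
  define r where "r = inner z y / (norm y)\<^sup>2"
  have ny: "(norm y)\<^sup>2 > 0" using False by simp
  have e: "(norm (z - r *\<^sub>R y))\<^sup>2 = (norm z)\<^sup>2 - 2 * r * inner z y + r * r * (norm y)\<^sup>2"
    by (simp add: power2_norm_eq_inner inner_diff_left inner_diff_right inner_commute algebra_simps)
  have "r * r * (norm y)\<^sup>2 = r * inner z y"
    using ny by (simp add: r_def power2_eq_square)
  then have "r * inner z y \<le> 0" using assms[of r] e by linarith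
  then have "(inner z y)\<^sup>2 / (norm y)\<^sup>2 \<le> 0" by (simp add: r_def power2_eq_square)
  then have "(inner z y)\<^sup>2 \<le> 0" using ny by (simp add: divide_le_0_iff)
  then show ?thesis by simp
qed simp

section \<open>Orthogonal projections onto closed real subspaces\<close>

lemma ex_orth_proj:
  fixes S :: "'a::hilbert_space set"
  assumes S: "closed S" "subspace S"
  shows "\<exists>s\<in>S. \<forall>y\<in>S. inner (x - s) y = 0"
proof -
  define D where "D = (\<lambda>s. (norm (x - s))\<^sup>2) ` S"
  define d where "d = Inf D"
  have ne: "D \<noteq> {}" using subspace_0[OF S(2)] by (auto simp: D_def)
  have bdd: "bdd_below D" by (rule bdd_belowI[of _ 0]) (auto simp: D_def)
  have dle: "d \<le> (norm (x - s))\<^sup>2" if "s \<in> S" for s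
    unfolding d_def using bdd that by (intro cInf_lower) (auto simp: D_def)
  have "\<exists>s\<in>S. (norm (x - s))\<^sup>2 < d + inverse (real (Suc n))" for n
  proof -
    have "Inf D < d + inverse (real (Suc n))" by (simp add: d_def)
    then show ?thesis using cInf_lessD[OF ne] by (auto simp: D_def)
  qed
  then obtain s where s: "\<And>n. s n \<in> S" "\<And>n. (norm (x - s n))\<^sup>2 < d + inverse (real (Suc n))"
    by metis
  \<comment> \<open>Parallelogram law: the midpoint of two almost minimal points lies in
    \<open>S\<close>, hence at squared distance at least \<open>d\<close> from \<open>x\<close>, and
    this forces the two points together.\<close>
  have para: "(norm (s m - s n))\<^sup>2 \<le> 2 * inverse (real (Suc m)) + 2 * inverse (real (Suc n))" for m n
  proof -
    have "(1/2) *\<^sub>R (s m + s n) \<in> S" using s(1) S(2) by (simp add: subspace_add subspace_scale)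
    then have "d \<le> (norm (x - (1/2) *\<^sub>R (s m + s n)))\<^sup>2" by (rule dle)
    moreover have "(norm (s m - s n))\<^sup>2 = 2 * (norm (x - s m))\<^sup>2 + 2 * (norm (x - s n))\<^sup>2
        - 4 * (norm (x - (1/2) *\<^sub>R (s m + s n)))\<^sup>2"
      by (simp add: power2_norm_eq_inner inner_diff_left inner_diff_right inner_add_left
          inner_add_right inner_commute algebra_simps)
    ultimately show ?thesis using s(2)[of m] s(2)[of n] by linarith
  qed
  have "Cauchy s"
  proof (rule metric_CauchyI)
    fix e :: real assume e: "e > 0"
    then have "e\<^sup>2 / 4 > 0" by simp
    then obtain N where N: "inverse (real (Suc N)) < e\<^sup>2 / 4" using reals_Archimedean by blast
    have "dist (s m) (s n) < e" if "m \<ge> N" "n \<ge> N" for m n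
    proof -
      have "inverse (real (Suc m)) \<le> inverse (real (Suc N))" "inverse (real (Suc n)) \<le> inverse (real (Suc N))"
        using that by (auto intro!: le_imp_inverse_le)
      then have "(norm (s m - s n))\<^sup>2 < e\<^sup>2" using para[of m n] N by linarith
      then show ?thesis using e by (simp add: dist_norm power_less_imp_less_base)
    qed
    then show "\<exists>M. \<forall>m\<ge>M. \<forall>n\<ge>M. dist (s m) (s n) < e" by blast
  qed
  then obtain l where l: "s \<longlonglongrightarrow> l" using Cauchy_convergent convergent_def by blast
  have lS: "l \<in> S" using closed_sequentially[OF S(1)] s(1) l by blast
  have "(\<lambda>n. (norm (x - s n))\<^sup>2) \<longlonglongrightarrow> (norm (x - l))\<^sup>2"
    by (intro tendsto_intros l)
  moreover have "(\<lambda>n. d + inverse (real (Suc n))) \<longlonglongrightarrow> d + 0"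
    by (intro tendsto_add tendsto_const LIMSEQ_inverse_real_of_nat)
  ultimately have ld: "(norm (x - l))\<^sup>2 \<le> d"
    using LIMSEQ_le[of "\<lambda>n. (norm (x - s n))\<^sup>2" _ "\<lambda>n. d + inverse (real (Suc n))" "d + 0"]
      less_imp_le[OF s(2)] by simp
  have "inner (x - l) y = 0" if "y \<in> S" for y
  proof (rule inner_eq_zero_if_quadratic_nonneg)
    fix r :: real
    have "l + r *\<^sub>R y \<in> S" using lS that S(2) by (simp add: subspace_add subspace_scale)
    from dle[OF this] ld show "(norm (x - l))\<^sup>2 \<le> (norm (x - l - r *\<^sub>R y))\<^sup>2"
      by (simp only: diff_diff_eq)
  qed
  with lS show ?thesis by blast
qed

text \<open>Real-linear by design, since it is also applied to real subspaces such as
  \<open>K\<close>. For orbits of operator algebras, which are stable under \<open>\<i>\<close>,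
  complex linearity is proved separately.\<close>

definition orth_proj :: "'a::hilbert_space set \<Rightarrow> 'a \<Rightarrow>\<^sub>L 'a" where
  "orth_proj S = Blinfun (\<lambda>x. SOME s. s \<in> S \<and> (\<forall>y\<in>S. inner (x - s) y = 0))"

context
  fixes S :: "'a::hilbert_space set"
  assumes S: "closed S" "subspace S"
begin

lemma orth_proj_unique_aux:
  assumes "s \<in> S" "\<And>y. y \<in> S \<Longrightarrow> inner (x - s) y = 0"
    and "s' \<in> S" "\<And>y. y \<in> S \<Longrightarrow> inner (x - s') y = 0"
  shows "s = s'"
proof -
  have "s - s' \<in> S" using assms S by (simp add: subspace_diff)
  then have "inner (x - s') (s - s') - inner (x - s) (s - s') = 0" using assms by simp
  then have "inner (s - s') (s - s') = 0" by (simp add: inner_diff_left)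
  then show ?thesis by simp
qed

lemma orth_proj_works:
  "orth_proj S x \<in> S \<and> (\<forall>y\<in>S. inner (x - orth_proj S x) y = 0)"
proof -
  let ?f = "\<lambda>x. SOME s. s \<in> S \<and> (\<forall>y\<in>S. inner (x - s) y = 0)"
  have f: "?f x \<in> S \<and> (\<forall>y\<in>S. inner (x - ?f x) y = 0)" for x
    by (rule someI_ex) (use ex_orth_proj[OF S, of x] in blast)
  have "bounded_linear ?f"
  proof (rule bounded_linear_intro[where K = 1])
    show "?f (x + y) = ?f x + ?f y" for x y
    proof (rule orth_proj_unique_aux[where x = "x + y"])
      fix z assume "z \<in> S"
      then have "inner (x - ?f x) z = 0" "inner (y - ?f y) z = 0" using f by auto
      then show "inner (x + y - (?f x + ?f y)) z = 0" by (simp add: inner_diff_left inner_add_left)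
    qed (use f S in \<open>auto simp: subspace_add\<close>)
    show "?f (r *\<^sub>R x) = r *\<^sub>R ?f x" for r x
    proof (rule orth_proj_unique_aux[where x = "r *\<^sub>R x"])
      fix z assume "z \<in> S"
      then have "inner (x - ?f x) z = 0" using f by auto
      then show "inner (r *\<^sub>R x - r *\<^sub>R ?f x) z = 0" by (simp add: inner_diff_left)
    qed (use f S in \<open>auto simp: subspace_scale\<close>)
    show "norm (?f x) \<le> norm x * 1" for x
    proof -
      have "inner (x - ?f x) (?f x) = 0" using f by blast
      then have "(norm (?f x))\<^sup>2 = inner x (?f x)" by (simp add: inner_diff_left power2_norm_eq_inner)
      also have "\<dots> \<le> norm x * norm (?f x)" by (rule norm_cauchy_schwarz)
      finally have "norm (?f x) * norm (?f x) \<le> norm x * norm (?f x)" by (simp add: power2_eq_square)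
      then show ?thesis by (cases "?f x = 0") (auto simp: mult_le_cancel_right)
    qed
  qed
  then have "blinfun_apply (orth_proj S) = ?f" by (simp add: orth_proj_def bounded_linear_Blinfun_apply)
  then show ?thesis using f by simp
qed

lemma orth_proj_in: "orth_proj S x \<in> S"
  and orth_proj_perp: "y \<in> S \<Longrightarrow> inner (x - orth_proj S x) y = 0"
  using orth_proj_works by auto

lemma orth_proj_unique:
  assumes "s \<in> S" "\<And>y. y \<in> S \<Longrightarrow> inner (x - s) y = 0"
  shows "orth_proj S x = s"
  using orth_proj_unique_aux[OF orth_proj_in orth_proj_perp] assms by blast

lemma orth_proj_fixes: "x \<in> S \<Longrightarrow> orth_proj S x = x"
  by (rule orth_proj_unique) auto

lemma orth_proj_idem: "orth_proj S (orth_proj S x) = orth_proj S x"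
  by (rule orth_proj_fixes) (rule orth_proj_in)

lemma orth_proj_eq_0: "(\<And>y. y \<in> S \<Longrightarrow> inner x y = 0) \<Longrightarrow> orth_proj S x = 0"
  by (rule orth_proj_unique) (auto simp: subspace_0 S)

lemma orth_proj_sym: "inner (orth_proj S x) y = inner x (orth_proj S y)"
proof -
  have "inner (x - orth_proj S x) (orth_proj S y) = 0" by (intro orth_proj_perp orth_proj_in)
  moreover have "inner (y - orth_proj S y) (orth_proj S x) = 0" by (intro orth_proj_perp orth_proj_in)
  ultimately show ?thesis by (simp add: inner_diff_left inner_diff_right inner_commute)
qed

lemma inner_orth_proj_self: "inner (orth_proj S x) x = (norm (orth_proj S x))\<^sup>2"
  using orth_proj_sym[of x "orth_proj S x"] orth_proj_sym[of x x]
  by (simp add: orth_proj_idem power2_norm_eq_inner inner_commute)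

lemma norm_diff_orth_proj: "(norm (x - orth_proj S x))\<^sup>2 = (norm x)\<^sup>2 - (norm (orth_proj S x))\<^sup>2"
  using inner_orth_proj_self[of x]
  by (simp add: power2_norm_eq_inner inner_diff_left inner_diff_right inner_commute)

lemma orth_proj_commute:
  assumes "\<And>x y. inner (T x) y = inner x (T' y)"
    and "\<And>x. x \<in> S \<Longrightarrow> T x \<in> S" "\<And>x. x \<in> S \<Longrightarrow> T' x \<in> S"
  shows "orth_proj S (T x) = T (orth_proj S x)"
proof (rule orth_proj_unique)
  fix y assume "y \<in> S"
  then have "inner (x - orth_proj S x) (T' y) = 0" using assms(3) orth_proj_perp by blast
  then show "inner (T x - T (orth_proj S x)) y = 0"
    by (simp add: inner_diff_left assms(1))
qed (use assms(2) orth_proj_in in auto)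

text \<open>The vector \<open>x - orth_proj S x\<close> is an admissible \<open>y\<close>, so it is
  orthogonal to \<open>x\<close> as well as to \<open>orth_proj S x\<close>, hence to
  itself.\<close>

lemma in_closed_subspace_if_perp:
  assumes "\<And>y. (\<And>s. s \<in> S \<Longrightarrow> inner y s = 0) \<Longrightarrow> inner x y = 0"
  shows "x \<in> S"
proof -
  have "inner x (x - orth_proj S x) = 0" by (rule assms) (rule orth_proj_perp)
  moreover have "inner (orth_proj S x) (x - orth_proj S x) = 0"
    using orth_proj_perp[OF orth_proj_in] by (simp add: inner_commute)
  ultimately have "inner (x - orth_proj S x) (x - orth_proj S x) = 0" by (simp only: inner_diff_left)
  then show ?thesis using orth_proj_in[of x] by simp
qed

end

section \<open>Representation of functionals and forms, real adjoints\<close>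

lemma riesz_representation:
  fixes f :: "'a::hilbert_space \<Rightarrow> real"
  assumes "bounded_linear f"
  shows "\<exists>z. \<forall>x. f x = inner z x"
proof (cases "\<forall>x. f x = 0")
  case True
  then show ?thesis by (intro exI[of _ 0]) simp
next
  case False
  interpret f: bounded_linear f by fact
  define S where "S = {x. f x = 0}"
  have S: "subspace S" "closed S"
    unfolding S_def subspace_def
    by (auto simp: f.add f.scaleR intro!: closed_Collect_eq continuous_intros f.continuous_on)
  obtain x0 where x0: "f x0 \<noteq> 0" using False by blast
  define w where "w = x0 - orth_proj S x0"
  have "f (orth_proj S x0) = 0" using orth_proj_in[OF S(2,1)] by (auto simp: S_def)
  then have fw: "f w \<noteq> 0" using x0 by (simp add: w_def f.diff)
  then have w0: "w \<noteq> 0" by auto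
  have "f x = inner ((f w / inner w w) *\<^sub>R w) x" for x
  proof -
    have "x - (f x / f w) *\<^sub>R w \<in> S" using fw by (simp add: S_def f.diff f.scaleR)
    then have "inner w (x - (f x / f w) *\<^sub>R w) = 0"
      unfolding w_def by (rule orth_proj_perp[OF S(2,1)])
    then have "inner w x = (f x / f w) * inner w w" by (simp add: inner_diff_right)
    then show ?thesis using fw w0 by (simp add: field_simps)
  qed
  then show ?thesis by blast
qed

text \<open>Three constructions rest on this: real adjoints, slices of an operator on a tensor
  product, and the operator \<open>Z\<close> attached to a vector of the tensor product.\<close>

lemma bounded_bilinear_representation:
  fixes B :: "'a::real_normed_vector \<Rightarrow> 'b::hilbert_space \<Rightarrow> real"
  assumes "bounded_bilinear B"
  shows "\<exists>T :: 'a \<Rightarrow>\<^sub>L 'b. \<forall>x y. inner (T x) y = B x y"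
proof -
  interpret B: bounded_bilinear B by fact
  have "\<forall>x. \<exists>z. \<forall>y. B x y = inner z y"
    using riesz_representation[OF B.bounded_linear_right] by blast
  then obtain g where g: "\<And>x y. B x y = inner (g x) y" by metis
  have eq: "u = v" if "\<And>y. inner u y = inner v y" for u v :: 'b
    using that vector_eq_rdot by blast
  obtain K where K: "\<And>a b. norm (B a b) \<le> norm a * norm b * K" "K > 0" using B.pos_bounded by blast
  have "bounded_linear g"
  proof (rule bounded_linear_intro[where K = K])
    show "g (x + y) = g x + g y" for x y
      by (rule eq) (simp add: inner_add_left g[symmetric] B.add_left)
    show "g (r *\<^sub>R x) = r *\<^sub>R g x" for r x
      by (rule eq) (simp add: g[symmetric] B.scaleR_left)
    show "norm (g x) \<le> norm x * K" for x
    proof -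
      have "norm (g x) * norm (g x) = B x (g x)" by (simp add: g power2_norm_eq_inner flip: power2_eq_square)
      also have "\<dots> \<le> norm x * norm (g x) * K" using K(1)[of x "g x"] by (simp add: abs_le_iff)
      finally have "norm (g x) * norm (g x) \<le> (norm x * K) * norm (g x)" by (simp add: mult_ac)
      then show ?thesis using K(2) by (cases "g x = 0") (auto simp: mult_le_cancel_right)
    qed
  qed
  then have "\<forall>x y. inner (Blinfun g x) y = B x y" by (simp add: bounded_linear_Blinfun_apply g)
  then show ?thesis by blast
qed

lemma ex_real_adjoint:
  fixes T :: "'a::hilbert_space \<Rightarrow>\<^sub>L 'b::hilbert_space"
  shows "\<exists>T' :: 'b \<Rightarrow>\<^sub>L 'a. \<forall>x y. inner (T x) y = inner x (T' y)"
proof -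
  have "bounded_bilinear (\<lambda>y x. inner y (T x))"
    by (rule bounded_bilinear.comp[OF bounded_bilinear_inner bounded_linear_ident blinfun.bounded_linear_right])
  from bounded_bilinear_representation[OF this]
  obtain T' :: "'b \<Rightarrow>\<^sub>L 'a" where "\<And>y x. inner (T' y) x = inner y (T x)" by blast
  then have "\<forall>x y. inner (T x) y = inner x (T' y)" by (simp add: inner_commute[of x for x])
  then show ?thesis by blast
qed

section \<open>Positive square roots\<close>

definition sym_pos :: "('a::real_inner \<Rightarrow>\<^sub>L 'a) \<Rightarrow> bool" where
  "sym_pos A \<longleftrightarrow> (\<forall>x y. inner (A x) y = inner x (A y)) \<and> (\<forall>x. 0 \<le> inner (A x) x)"

text \<open>This is \<open>A\<^sup>2 \<le> c A\<close>, obtained by testing positivity of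
  \<open>A\<close> on the vector \<open>c x - A x\<close>.\<close>

lemma sym_pos_norm_le:
  assumes A: "sym_pos A" and c: "norm A \<le> c" "c > 0"
  shows "(norm (A x))\<^sup>2 \<le> c * inner (A x) x"
proof -
  have sym: "\<And>x y. inner (A x) y = inner x (A y)" and pos: "\<And>x. 0 \<le> inner (A x) x"
    using A by (auto simp: sym_pos_def)
  let ?y = "A x"
  have "norm (A ?y) \<le> c * norm ?y"
    using norm_blinfun[of A ?y] c by (meson mult_right_mono norm_ge_zero order_trans)
  then have "inner (A ?y) ?y \<le> c * norm ?y * norm ?y"
    using norm_cauchy_schwarz[of "A ?y" ?y] by (meson mult_right_mono norm_ge_zero order_trans)
  then have le: "inner (A ?y) ?y \<le> c * (norm ?y)\<^sup>2" by (simp add: power2_eq_square)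
  have "0 \<le> inner (A (c *\<^sub>R x - ?y)) (c *\<^sub>R x - ?y)" by (rule pos)
  also have "\<dots> = c * (c * inner (A x) x) - 2 * c * (norm ?y)\<^sup>2 + inner (A ?y) ?y"
    using sym[of ?y x]
    by (simp add: blinfun.diff_right blinfun.scaleR_right inner_diff_left inner_diff_right
        power2_norm_eq_inner inner_commute algebra_simps)
  also have "\<dots> \<le> c * (c * inner (A x) x) - c * (norm ?y)\<^sup>2" using le by simp
  finally have "c * (norm ?y)\<^sup>2 \<le> c * (c * inner (A x) x)" by simp
  then show ?thesis using c by simp
qed

lemma sym_pos_eq_0:
  assumes "sym_pos A" "inner (A x) x = 0"
  shows "A x = 0"
  using sym_pos_norm_le[OF assms(1), of "norm A + 1" x] assms(2) by (simp add: add_nonneg_pos)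

text \<open>The square root of \<open>1 - X\<close> is \<open>1 - Y\<close>, where \<open>Y\<close> solves \<open>Y = (X + Y\<^sup>2) / 2\<close>.  The
  fixed point iteration is dominated in norm by the same iteration for the real number \<open>1\<close> in
  place of \<open>X\<close>.\<close>

primrec sqrt_iter :: "('a::real_normed_vector \<Rightarrow>\<^sub>L 'a) \<Rightarrow> nat \<Rightarrow> ('a \<Rightarrow>\<^sub>L 'a)" where
  "sqrt_iter X 0 = 0"
| "sqrt_iter X (Suc n) = (1/2) *\<^sub>R (X + (sqrt_iter X n o\<^sub>L sqrt_iter X n))"

primrec sqrt_bound :: "nat \<Rightarrow> real" where
  "sqrt_bound 0 = 0"
| "sqrt_bound (Suc n) = (1 + sqrt_bound n * sqrt_bound n) / 2"

lemma sqrt_bound_range: "0 \<le> sqrt_bound n \<and> sqrt_bound n \<le> 1"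
proof (induction n)
  case (Suc n)
  then have "sqrt_bound n * sqrt_bound n \<le> 1" by (simp add: mult_le_one)
  then show ?case using Suc by simp
qed simp

lemma incseq_sqrt_bound: "incseq sqrt_bound"
proof (rule incseq_SucI)
  fix n
  have "0 \<le> (1 - sqrt_bound n)\<^sup>2" by simp
  also have "(1 - sqrt_bound n)\<^sup>2 = 2 * (sqrt_bound (Suc n) - sqrt_bound n)"
    by (simp add: power2_eq_square algebra_simps)
  finally show "sqrt_bound n \<le> sqrt_bound (Suc n)" by simp
qed

lemma norm_sqrt_iter:
  assumes "norm X \<le> 1"
  shows "norm (sqrt_iter X n) \<le> sqrt_bound n"
proof (induction n)
  case (Suc n)
  have "norm (X + (sqrt_iter X n o\<^sub>L sqrt_iter X n)) \<le> 1 + norm (sqrt_iter X n) * norm (sqrt_iter X n)"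
    using assms norm_triangle_ineq[of X "sqrt_iter X n o\<^sub>L sqrt_iter X n"]
      norm_blinfun_compose[of "sqrt_iter X n" "sqrt_iter X n"] by linarith
  also have "\<dots> \<le> 1 + sqrt_bound n * sqrt_bound n"
    using Suc sqrt_bound_range[of n] by (intro add_left_mono mult_mono) auto
  finally show ?case by simp
qed simp

text \<open>The identity \<open>a\<^sup>2 - b\<^sup>2 = a (a - b) + (a - b) b\<close> turns bounds
  on \<open>a\<close>, \<open>b\<close> and \<open>a - b\<close> into the same expression in the
  real sequence. That sequence is increasing and bounded by 1, so its increments, and with them
  those of the operators, are summable.\<close>

lemma norm_sqrt_iter_step:
  assumes X: "norm X \<le> 1"
  shows "norm (sqrt_iter X (Suc n) - sqrt_iter X n) \<le> sqrt_bound (Suc n) - sqrt_bound n"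
proof (induction n)
  case 0
  then show ?case using X by simp
next
  case (Suc n)
  let ?a = "sqrt_iter X (Suc n)" and ?b = "sqrt_iter X n"
  let ?r = "sqrt_bound (Suc n)" and ?s = "sqrt_bound n"
  have "sqrt_iter X (Suc (Suc n)) - ?a = (1/2) *\<^sub>R ((?a o\<^sub>L ?a) - (?b o\<^sub>L ?b))"
  proof -
    have "u - v = (1/2) *\<^sub>R (p - q)" if "u = (1/2) *\<^sub>R (X + p)" "v = (1/2) *\<^sub>R (X + q)" for u v p q :: "'a \<Rightarrow>\<^sub>L 'a"
      using that by (simp add: scaleR_add_right scaleR_diff_right)
    then show ?thesis using sqrt_iter.simps(2) by blast
  qed
  also have "(?a o\<^sub>L ?a) - (?b o\<^sub>L ?b) = (?a o\<^sub>L (?a - ?b)) + ((?a - ?b) o\<^sub>L ?b)"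
    by (intro blinfun_eqI) (simp only: blinfun.diff_left blinfun.add_left blinfun_apply_blinfun_compose
        blinfun.diff_right, simp)
  also have "norm ((1/2) *\<^sub>R ((?a o\<^sub>L (?a - ?b)) + ((?a - ?b) o\<^sub>L ?b)))
      \<le> (1/2) * (norm ?a * norm (?a - ?b) + norm (?a - ?b) * norm ?b)"
    using norm_triangle_ineq[of "?a o\<^sub>L (?a - ?b)" "(?a - ?b) o\<^sub>L ?b"]
      norm_blinfun_compose[of ?a "?a - ?b"] norm_blinfun_compose[of "?a - ?b" ?b]
    by (simp del: sqrt_iter.simps)
  also have "\<dots> \<le> (1/2) * (?r * (?r - ?s) + (?r - ?s) * ?s)"
    using Suc norm_sqrt_iter[OF X, of "Suc n"] norm_sqrt_iter[OF X, of n] sqrt_bound_range[of n]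
      sqrt_bound_range[of "Suc n"] incseq_SucD[OF incseq_sqrt_bound, of n]
    by (intro mult_left_mono add_mono mult_mono) (auto simp del: sqrt_iter.simps sqrt_bound.simps)
  also have "\<dots> = sqrt_bound (Suc (Suc n)) - ?r"
    by (simp only: sqrt_bound.simps(2)[of "Suc n"]) (simp add: field_simps)
  finally show ?case .
qed

lemma sqrt_iter_converges:
  fixes X :: "'a::banach \<Rightarrow>\<^sub>L 'a"
  assumes X: "norm X \<le> 1"
  shows "convergent (sqrt_iter X)"
proof -
  have step: "norm (sqrt_iter X (n + k) - sqrt_iter X n) \<le> sqrt_bound (n + k) - sqrt_bound n" for n k
  proof (induction k)
    case (Suc k)
    have "norm (sqrt_iter X (n + Suc k) - sqrt_iter X n)
        \<le> norm (sqrt_iter X (Suc (n + k)) - sqrt_iter X (n + k)) + norm (sqrt_iter X (n + k) - sqrt_iter X n)"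
      using norm_triangle_ineq[of "sqrt_iter X (Suc (n + k)) - sqrt_iter X (n + k)" "sqrt_iter X (n + k) - sqrt_iter X n"]
      by (simp del: sqrt_iter.simps)
    then show ?case using Suc norm_sqrt_iter_step[OF X, of "n + k"] by (simp del: sqrt_iter.simps sqrt_bound.simps)
  qed simp
  have "convergent sqrt_bound"
    using incseq_convergent[OF incseq_sqrt_bound, of 1] sqrt_bound_range
    by (metis convergent_def)
  then have C: "Cauchy sqrt_bound" by (rule convergent_Cauchy)
  have "Cauchy (sqrt_iter X)"
  proof (rule CauchyI')
    fix e :: real assume "e > 0"
    then obtain M where M: "\<And>m n. m \<ge> M \<Longrightarrow> n \<ge> M \<Longrightarrow> norm (sqrt_bound m - sqrt_bound n) < e"
      using CauchyD[OF C] by blast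
    have "norm (sqrt_iter X m - sqrt_iter X n) < e" if "m \<ge> M" "n > m" for m n
    proof -
      have "norm (sqrt_iter X n - sqrt_iter X m) \<le> sqrt_bound n - sqrt_bound m"
        using step[of m "n - m"] that by simp
      also have "\<dots> < e" using M[of n m] that by (simp add: abs_less_iff)
      finally show ?thesis by (simp add: norm_minus_commute)
    qed
    then show "\<exists>M. \<forall>m\<ge>M. \<forall>n>m. dist (sqrt_iter X m) (sqrt_iter X n) < e"
      unfolding dist_norm by blast
  qed
  then show ?thesis by (rule Cauchy_convergent)
qed

text \<open>Closure under squares rather than products, so that the self-adjoint operators form an
  admissible set.\<close>

definition square_closed :: "('a::real_normed_vector \<Rightarrow>\<^sub>L 'a) set \<Rightarrow> bool" where
  "square_closed \<C> \<longleftrightarrow> closed \<C> \<and> subspace \<C> \<and> id_blinfun \<in> \<C> \<and> (\<forall>T\<in>\<C>. T o\<^sub>L T \<in> \<C>)"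

lemma square_closed_symmetric:
  "square_closed {T. \<forall>x y. inner (blinfun_apply T x) y = inner x (blinfun_apply T y)}"
  (is "square_closed ?C")
proof -
  have "closed ?C"
    by (intro closed_Collect_all closed_Collect_eq continuous_intros)
  moreover have "subspace ?C"
    unfolding subspace_def by (simp add: blinfun.bilinear_simps inner_add_left inner_add_right)
  ultimately show ?thesis unfolding square_closed_def by simp
qed

lemma square_closed_commuting:
  "square_closed {T. T o\<^sub>L C = C o\<^sub>L T}"
proof -
  have "{T. T o\<^sub>L C = C o\<^sub>L T} = {T. \<forall>x. blinfun_apply T (C x) = C (T x)}"
    by (auto intro!: blinfun_eqI dest: arg_cong[of _ _ blinfun_apply] fun_cong)
       (metis blinfun_apply_blinfun_compose)
  moreover have "closed {T. \<forall>x. blinfun_apply T (C x) = C (T x)}"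
    by (intro closed_Collect_all closed_Collect_eq continuous_intros)
  moreover have "subspace {T. \<forall>x. blinfun_apply T (C x) = C (T x)}"
    unfolding subspace_def by (simp add: blinfun.bilinear_simps)
  ultimately show ?thesis unfolding square_closed_def by simp
qed

lemma square_closed_invariant:
  assumes K: "closed K" "subspace K"
  shows "square_closed {T. \<forall>k\<in>K. blinfun_apply T k \<in> K}"
proof -
  have "closed {T. blinfun_apply T k \<in> K}" for k
    using closed_vimage[OF K(1), of "\<lambda>T. blinfun_apply T k"]
    by (simp add: vimage_def continuous_intros)
  then have "closed (\<Inter>k\<in>K. {T. blinfun_apply T k \<in> K})" by blast
  moreover have "{T. \<forall>k\<in>K. blinfun_apply T k \<in> K} = (\<Inter>k\<in>K. {T. blinfun_apply T k \<in> K})" by auto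
  ultimately show ?thesis using K(2) unfolding square_closed_def
    by (auto simp: subspace_def blinfun.bilinear_simps)
qed

text \<open>The last conjunct stands in for functional calculus: the root inherits from
  \<open>A\<close> every property that cuts out a \<open>square_closed\<close> set, such as
  symmetry, commuting with a given operator, or leaving a closed real subspace invariant.\<close>

lemma ex_positive_sqrt:
  fixes A :: "'a::hilbert_space \<Rightarrow>\<^sub>L 'a"
  assumes A: "sym_pos A"
  shows "\<exists>S. sym_pos S \<and> S o\<^sub>L S = A \<and> (\<forall>\<C>. square_closed \<C> \<longrightarrow> A \<in> \<C> \<longrightarrow> S \<in> \<C>)"
proof -
  define c where "c = norm A + 1"
  have c: "c > 0" "norm A \<le> c" by (auto simp: c_def add_nonneg_pos)
  \<comment> \<open>As \<open>0 \<le> A \<le> c\<close>, this is a contraction; the estimate below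
    uses \<open>A\<^sup>2 \<le> c A\<close>.\<close>
  define X where "X = id_blinfun - (1/c) *\<^sub>R A"
  have X: "norm X \<le> 1"
  proof (rule norm_blinfun_bound)
    fix x
    have "(norm (x - r *\<^sub>R A x))\<^sup>2 = (norm x)\<^sup>2 - 2 * r * inner (A x) x + (r * r) * (norm (A x))\<^sup>2" for r
      by (simp add: power2_norm_eq_inner inner_diff_left inner_diff_right inner_commute algebra_simps)
    from this[of "1/c"]
    have "(norm (X x))\<^sup>2 = (norm x)\<^sup>2 - 2 * (1/c) * inner (A x) x + (1/c)\<^sup>2 * (norm (A x))\<^sup>2"
      by (simp add: X_def blinfun.bilinear_simps power2_eq_square)
    also have "(1/c)\<^sup>2 * (norm (A x))\<^sup>2 \<le> (1/c)\<^sup>2 * (c * inner (A x) x)"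
      using sym_pos_norm_le[OF A c(2,1)] by (rule mult_left_mono) simp
    also have "(1/c)\<^sup>2 * (c * inner (A x) x) = (1/c) * inner (A x) x"
      using c by (simp add: power2_eq_square)
    finally have "(norm (X x))\<^sup>2 \<le> (norm x)\<^sup>2 - (1/c) * inner (A x) x" by simp
    moreover have "0 \<le> (1/c) * inner (A x) x" using A c unfolding sym_pos_def
      by (intro mult_nonneg_nonneg) auto
    ultimately have "(norm (X x))\<^sup>2 \<le> (norm x)\<^sup>2" by linarith
    then show "norm (X x) \<le> 1 * norm x" using power2_le_imp_le[OF _ norm_ge_zero] by simp
  qed simp
  obtain Y where Y: "sqrt_iter X \<longlonglongrightarrow> Y" using sqrt_iter_converges[OF X] convergent_def by blast
  have "(\<lambda>n. sqrt_iter X (Suc n)) \<longlonglongrightarrow> (1/2) *\<^sub>R (X + (Y o\<^sub>L Y))"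
    unfolding sqrt_iter.simps
    by (intro tendsto_intros bounded_bilinear.tendsto[OF bounded_bilinear_blinfun_compose] Y)
  then have fix_eq: "Y = (1/2) *\<^sub>R (X + (Y o\<^sub>L Y))" using LIMSEQ_Suc[OF Y] LIMSEQ_unique by blast
  have nY: "norm Y \<le> 1"
    by (rule LIMSEQ_le_const2[OF tendsto_norm[OF Y]])
      (use norm_sqrt_iter[OF X] sqrt_bound_range order_trans in blast)
  \<comment> \<open>By the fixed point equation \<open>1 - Y\<close> squares to
    \<open>1 - X = A / c\<close>; it is positive because \<open>norm Y \<le> 1\<close>.\<close>
  define S where "S = sqrt c *\<^sub>R (id_blinfun - Y)"
  have mem: "S \<in> \<C>" if C: "square_closed \<C>" "A \<in> \<C>" for \<C>
  proof -
    have cl: "closed \<C>" and sub: "subspace \<C>" and one: "id_blinfun \<in> \<C>"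
      and sq: "\<And>T. T \<in> \<C> \<Longrightarrow> T o\<^sub>L T \<in> \<C>"
      using C(1) by (auto simp: square_closed_def)
    have XC: "X \<in> \<C>" using C(2) sub one by (simp add: X_def subspace_diff subspace_scale)
    have "sqrt_iter X n \<in> \<C>" for n
      by (induction n) (use XC sub sq in \<open>auto simp: subspace_0 subspace_add subspace_scale\<close>)
    then have "Y \<in> \<C>" using closed_sequentially[OF cl _ Y] by blast
    then show ?thesis using sub one by (simp add: S_def subspace_diff subspace_scale)
  qed
  have sym: "inner (S x) y = inner x (S y)" for x y
    using mem[OF square_closed_symmetric] A by (simp add: sym_pos_def)
  have pos: "0 \<le> inner (S x) x" for x
  proof -
    have "norm (Y x) \<le> norm x"
      using norm_blinfun[of Y x] nY mult_right_mono[of "norm Y" 1 "norm x"] by simp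
    then have "inner (Y x) x \<le> norm x * norm x"
      using norm_cauchy_schwarz[of "Y x" x] mult_right_mono[of "norm (Y x)" "norm x" "norm x"] by simp
    then show ?thesis using c
      by (simp add: S_def blinfun.bilinear_simps inner_diff_left power2_norm_eq_inner[symmetric] power2_eq_square)
  qed
  have YY: "Y (Y x) = 2 *\<^sub>R Y x - X x" for x
  proof -
    have "2 *\<^sub>R Y x = 2 *\<^sub>R ((1/2) *\<^sub>R (X + (Y o\<^sub>L Y))) x" using fix_eq by metis
    then show ?thesis by (simp add: blinfun.bilinear_simps)
  qed
  have "S o\<^sub>L S = A"
  proof (rule blinfun_eqI)
    fix x
    have "(S o\<^sub>L S) x = (sqrt c * sqrt c) *\<^sub>R (x - Y x - (Y x - Y (Y x)))"
      by (simp add: S_def blinfun.bilinear_simps scaleR_diff_right)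
    also have "\<dots> = c *\<^sub>R (x - X x)" using c by (simp add: YY scaleR_2)
    also have "\<dots> = A x" using c by (simp add: X_def blinfun.bilinear_simps)
    finally show "(S o\<^sub>L S) x = A x" .
  qed
  moreover have "sym_pos S" unfolding sym_pos_def using sym pos by blast
  ultimately show ?thesis using mem by blast
qed

text \<open>For \<open>w = S v - C v\<close>, commutation gives
  \<open>(S + C) w = (S\<^sup>2 - C\<^sup>2) v = 0\<close>. Two positive terms with sum 0 vanish, so
  \<open>S w = C w = 0\<close>, and the squared norm of \<open>w\<close> is
  \<open>\<langle>v, (S - C) w\<rangle> = 0\<close>.\<close>

lemma positive_sqrt_unique:
  fixes C S :: "'a::real_inner \<Rightarrow>\<^sub>L 'a"
  assumes C: "sym_pos C" and S: "sym_pos S"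
    and eq: "S o\<^sub>L S = C o\<^sub>L C" and com: "S o\<^sub>L C = C o\<^sub>L S"
  shows "S = C"
proof (rule blinfun_eqI)
  fix v
  have eq': "S (S x) = C (C x)" and com': "S (C x) = C (S x)" for x
    using eq com by (metis blinfun_apply_blinfun_compose)+
  define w where "w = S v - C v"
  have "S w + C w = 0" by (simp add: w_def blinfun.diff_right eq' com')
  then have "inner (S w) w + inner (C w) w = 0" by (metis inner_add_left inner_zero_left)
  moreover have "0 \<le> inner (S w) w" "0 \<le> inner (C w) w" using C S by (auto simp: sym_pos_def)
  ultimately have "inner (S w) w = 0" "inner (C w) w = 0" by linarith+
  then have "S w = 0" "C w = 0" using C S sym_pos_eq_0 by blast+
  moreover have "inner w w = inner v (S w) - inner v (C w)"
    using C S by (simp add: w_def inner_diff_left sym_pos_def)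
  ultimately show "S v = C v" by (simp add: w_def)
qed

text \<open>The root of \<open>C\<^sup>2\<close> built by iteration is a limit of polynomials in
  \<open>C\<^sup>2\<close>, so it preserves \<open>K\<close> and commutes with \<open>C\<close>; by
  uniqueness it is \<open>C\<close> itself.\<close>

lemma sym_pos_invariant_if_square_invariant:
  fixes C :: "'a::hilbert_space \<Rightarrow>\<^sub>L 'a"
  assumes C: "sym_pos C" and K: "closed K" "subspace K"
    and inv: "\<And>k. k \<in> K \<Longrightarrow> C (C k) \<in> K" and k: "k \<in> K"
  shows "C k \<in> K"
proof -
  have "sym_pos (C o\<^sub>L C)" using C unfolding sym_pos_def by (simp, metis inner_ge_zero)
  then obtain S where S: "sym_pos S" "S o\<^sub>L S = C o\<^sub>L C"
    "\<And>\<C>. square_closed \<C> \<Longrightarrow> C o\<^sub>L C \<in> \<C> \<Longrightarrow> S \<in> \<C>"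
    using ex_positive_sqrt by blast
  have "S o\<^sub>L C = C o\<^sub>L S"
    using S(3)[OF square_closed_commuting[of C]] 
    by (metis (mono_tags, lifting) blinfun_apply_blinfun_compose blinfun_eqI mem_Collect_eq)
  then have "S = C" by (rule positive_sqrt_unique[OF C S(1,2)])
  moreover have "\<forall>k\<in>K. S k \<in> K" using S(3)[OF square_closed_invariant[OF K]] inv by simp
  ultimately show ?thesis using k by simp
qed


section \<open>Complex Hilbert spaces and operator algebras\<close>

lemma scaleC_one [simp]: "1 *\<^sub>C (x::'a::complex_hilbert_space) = x"
  using scaleR_scaleC[of 1 x] by simp

lemma scaleC_zero_left [simp]: "0 *\<^sub>C (x::'a::complex_hilbert_space) = 0"
  using scaleR_scaleC[of 0 x] by simp

lemma scaleC_minus_left [simp]: "(- c) *\<^sub>C (x::'a::complex_hilbert_space) = - (c *\<^sub>C x)"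
  using scaleC_add_left[of "- c" c x] by (simp add: eq_neg_iff_add_eq_0)

lemma scaleC_zero_right [simp]: "c *\<^sub>C (0::'a::complex_hilbert_space) = 0"
  using scaleC_scaleC[of c 0 "0::'a"] by simp

lemma scaleC_minus_right [simp]: "c *\<^sub>C (- x) = - (c *\<^sub>C (x::'a::complex_hilbert_space))"
  using scaleC_add_right[of c "- x" x] by (simp add: eq_neg_iff_add_eq_0)

lemma scaleC_diff_right: "c *\<^sub>C (x - y) = c *\<^sub>C x - c *\<^sub>C (y::'a::complex_hilbert_space)"
  using scaleC_add_right[of c x "- y"] by simp

lemma ii_ii [simp]: "\<i> *\<^sub>C \<i> *\<^sub>C x = - (x::'a::complex_hilbert_space)"
  by (simp add: scaleC_scaleC)

lemma scaleC_scaleR_commute: "c *\<^sub>C (r *\<^sub>R x) = r *\<^sub>R (c *\<^sub>C (x::'a::complex_hilbert_space))"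
  by (simp add: scaleR_scaleC scaleC_scaleC mult.commute)

lemma scaleC_Re_Im: "c *\<^sub>C (x::'a::complex_hilbert_space) = Re c *\<^sub>R x + Im c *\<^sub>R (\<i> *\<^sub>C x)"
  by (subst complex_eq[of c]) (simp add: scaleR_scaleC scaleC_scaleC scaleC_add_left mult.commute)

lemma cinner_add_right: "cinner x (y + z) = cinner x y + cinner x z"
  by (subst (1 2 3) cinner_commute) (simp add: cinner_add_left)

lemma cinner_scaleC_right: "cinner x (c *\<^sub>C y) = cnj c * cinner x y"
  by (subst (1 2) cinner_commute) (simp add: cinner_scaleC_left)

lemma cinner_zero_left [simp]: "cinner 0 y = 0"
  using cinner_scaleC_left[of 0 0 y] by simp

lemma cinner_zero_right [simp]: "cinner x 0 = 0"
  by (subst cinner_commute) simp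

lemma cinner_minus_left [simp]: "cinner (- x) y = - cinner x y"
  using cinner_add_left[of "- x" x y] by (simp add: eq_neg_iff_add_eq_0)

lemma cinner_minus_right [simp]: "cinner x (- y) = - cinner x y"
  using cinner_add_right[of x "- y" y] by (simp add: eq_neg_iff_add_eq_0)

lemma cinner_diff_left: "cinner (x - y) z = cinner x z - cinner y z"
  using cinner_add_left[of x "- y" z] by simp

lemma cinner_diff_right: "cinner x (y - z) = cinner x y - cinner x z"
  using cinner_add_right[of x y "- z"] by simp

lemma cinner_sum_left: "cinner (\<Sum>i\<in>I. f i) y = (\<Sum>i\<in>I. cinner (f i) y)"
  by (induction I rule: infinite_finite_induct) (auto simp: cinner_add_left)

lemma cinner_sum_right: "cinner x (\<Sum>i\<in>I. f i) = (\<Sum>i\<in>I. cinner x (f i))"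
  by (induction I rule: infinite_finite_induct) (auto simp: cinner_add_right)

lemma inner_ii_right: "inner x (\<i> *\<^sub>C y) = Im (cinner x y)"
  by (simp add: inner_eq_Re_cinner cinner_scaleC_right)

lemma inner_ii_left: "inner (\<i> *\<^sub>C x) y = - inner x (\<i> *\<^sub>C y)"
  by (simp add: inner_eq_Re_cinner cinner_scaleC_right cinner_scaleC_left)

lemma inner_ii_ii [simp]: "inner (\<i> *\<^sub>C x) (\<i> *\<^sub>C y) = inner x y"
  by (simp add: inner_ii_left)

lemma cinner_eq_Complex: "cinner x y = Complex (inner x y) (inner x (\<i> *\<^sub>C y))"
  by (simp add: complex_eq_iff inner_eq_Re_cinner cinner_scaleC_right)

lemma cinner_self: "cinner x x = of_real ((norm x)\<^sup>2)"
proof -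
  have "Im (cinner x x) = - Im (cinner x x)" by (subst cinner_commute) simp
  then show ?thesis by (simp add: complex_eq_iff inner_eq_Re_cinner[symmetric] power2_norm_eq_inner)
qed

lemma norm_scaleC: "norm (c *\<^sub>C (x::'a::complex_hilbert_space)) = cmod c * norm x"
proof -
  have "cinner (c *\<^sub>C x) (c *\<^sub>C x) = (c * cnj c) * cinner x x"
    by (simp add: cinner_scaleC_left cinner_scaleC_right)
  then have "complex_of_real ((norm (c *\<^sub>C x))\<^sup>2) = complex_of_real ((cmod c * norm x)\<^sup>2)"
    unfolding cinner_self complex_norm_square[symmetric] of_real_mult[symmetric] power_mult_distrib .
  then have "(norm (c *\<^sub>C x))\<^sup>2 = (cmod c * norm x)\<^sup>2" using of_real_eq_iff by blast
  then show ?thesis by (simp add: power2_eq_iff_nonneg)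
qed

lemma bounded_linear_scaleC: "bounded_linear (\<lambda>x::'a::complex_hilbert_space. c *\<^sub>C x)"
  by (rule bounded_linear_intro[where K = "cmod c"])
    (auto simp: scaleC_add_right scaleC_scaleR_commute norm_scaleC mult.commute)

lemmas continuous_on_scaleC [continuous_intros] = bounded_linear.continuous_on[OF bounded_linear_scaleC]

lemma cinner_eq_0_all: "(\<And>y. cinner x y = 0) \<Longrightarrow> x = 0"
  using cinner_self[of x] by simp

lemma cinner_polarization:
  fixes f :: "'a::complex_hilbert_space \<Rightarrow> 'a \<Rightarrow> complex"
  assumes add: "\<And>x y z. f (x + y) z = f x z + f y z" "\<And>x y z. f x (y + z) = f x y + f x z"
    and scale: "\<And>c x y. f (c *\<^sub>C x) y = c * f x y" "\<And>c x y. f x (c *\<^sub>C y) = cnj c * f x y"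
    and diag: "\<And>x. f x x = 0"
  shows "f x y = 0"
proof -
  have "f (x + y) (x + y) = f x y + f y x" by (simp only: add) (simp add: diag)
  then have 1: "f x y + f y x = 0" using diag by simp
  have "f (x + \<i> *\<^sub>C y) (x + \<i> *\<^sub>C y) = \<i> * (f y x - f x y)"
    by (simp only: add scale) (simp add: diag algebra_simps)
  then have "f y x = f x y" using diag by simp
  with 1 show ?thesis by simp
qed

section \<open>Complex-linear operators, adjoints and order\<close>

lemma bounded_ops_iff: "T \<in> bounded_ops \<longleftrightarrow> (\<forall>x. T (\<i> *\<^sub>C x) = \<i> *\<^sub>C T x)"
proof
  assume T: "\<forall>x. T (\<i> *\<^sub>C x) = \<i> *\<^sub>C T x"
  show "T \<in> bounded_ops"
    unfolding bounded_ops_def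
  proof (intro CollectI allI)
    fix c x show "T (c *\<^sub>C x) = c *\<^sub>C T x"
      by (subst (1 2) scaleC_Re_Im) (simp add: blinfun.bilinear_simps T)
  qed
qed (simp add: bounded_ops_def)

lemma bounded_opsD: "T \<in> bounded_ops \<Longrightarrow> T (c *\<^sub>C x) = c *\<^sub>C T x"
  by (simp add: bounded_ops_def)

lemma scalar_op_apply [simp]: "scalar_op c x = c *\<^sub>C x"
  by (simp add: scalar_op_def bounded_linear_Blinfun_apply bounded_linear_scaleC)

lemma scalar_op_bounded_ops: "scalar_op c \<in> bounded_ops"
  by (simp add: bounded_ops_def scaleC_scaleC mult.commute)

lemma scalar_op_one: "scalar_op 1 = id_blinfun"
  by (rule blinfun_eqI) simp

lemma bounded_ops_closed:
  "id_blinfun \<in> bounded_ops"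
  "S \<in> bounded_ops \<Longrightarrow> T \<in> bounded_ops \<Longrightarrow> S + T \<in> bounded_ops"
  "S \<in> bounded_ops \<Longrightarrow> T \<in> bounded_ops \<Longrightarrow> S o\<^sub>L T \<in> bounded_ops"
  by (auto simp: bounded_ops_def blinfun.bilinear_simps scaleC_add_right)

text \<open>The real adjoint does it. Multiplication by \<open>\<i>\<close> is skew-adjoint for
  \<open>inner\<close>, so the real adjoint of a complex-linear map is complex linear, and the
  imaginary part of \<open>cinner\<close> is again a value of \<open>inner\<close>.\<close>

lemma ex_adj:
  assumes T: "T \<in> bounded_ops"
  shows "\<exists>S :: 'a::complex_hilbert_space \<Rightarrow>\<^sub>L 'a. \<forall>x y. cinner (T x) y = cinner x (S y)"
proof -
  obtain S :: "'a \<Rightarrow>\<^sub>L 'a" where S: "\<And>x y. inner (T x) y = inner x (S y)" using ex_real_adjoint[of T] by blast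
  have "inner x (S (\<i> *\<^sub>C y)) = inner x (\<i> *\<^sub>C S y)" for x y
  proof -
    have "inner x (S (\<i> *\<^sub>C y)) = inner (T x) (\<i> *\<^sub>C y)" by (simp only: S)
    also have "\<dots> = - inner (T (\<i> *\<^sub>C x)) y" by (simp add: bounded_opsD[OF T] inner_ii_left)
    also have "\<dots> = inner x (\<i> *\<^sub>C S y)" by (simp add: S inner_ii_left)
    finally show ?thesis .
  qed
  then have "S (\<i> *\<^sub>C y) = \<i> *\<^sub>C S y" for y using vector_eq_ldot by blast
  then have "\<forall>x y. cinner (T x) y = cinner x (S y)"
    by (simp add: cinner_eq_Complex S)
  then show ?thesis by blast
qed

lemma adj_unique:
  fixes T S :: "'a::complex_hilbert_space \<Rightarrow>\<^sub>L 'a"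
  assumes "\<And>x y. inner (T x) y = inner x (S y)" "T \<in> bounded_ops"
  shows "adj T = S"
proof -
  obtain S' :: "'a \<Rightarrow>\<^sub>L 'a" where S': "\<forall>x y. cinner (T x) y = cinner x (S' y)" using ex_adj[OF assms(2)] by blast
  have eq: "R = S" if "\<forall>x y. cinner (T x) y = cinner x (blinfun_apply R y)" for R
  proof (rule blinfun_eqI)
    fix y
    have "inner x (R y) = inner x (S y)" for x
      using that assms(1) by (metis inner_eq_Re_cinner)
    then show "R y = S y" using vector_eq_ldot by blast
  qed
  then show ?thesis unfolding adj_def by (intro the_equality) (use S' eq in auto)
qed

lemma cinner_adj:
  fixes T :: "'a::complex_hilbert_space \<Rightarrow>\<^sub>L 'a"
  assumes T: "T \<in> bounded_ops"
  shows "cinner (T x) y = cinner x (adj T y)"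
proof -
  obtain S :: "'a \<Rightarrow>\<^sub>L 'a" where S: "\<forall>x y. cinner (T x) y = cinner x (S y)" using ex_adj[OF T] by blast
  then have "adj T = S" by (intro adj_unique T) (simp add: inner_eq_Re_cinner)
  then show ?thesis using S by simp
qed

lemma inner_adj: "T \<in> bounded_ops \<Longrightarrow> inner (T x) y = inner x (adj T y)"
  by (simp add: cinner_adj inner_eq_Re_cinner)

lemma adj_bounded_ops:
  assumes "T \<in> bounded_ops" shows "adj T \<in> bounded_ops"
  unfolding bounded_ops_iff
proof
  fix y
  have "inner x (adj T (\<i> *\<^sub>C y)) = inner x (\<i> *\<^sub>C adj T y)" for x
    by (simp add: inner_eq_Re_cinner cinner_adj[OF assms, symmetric] cinner_scaleC_right)
  then show "adj T (\<i> *\<^sub>C y) = \<i> *\<^sub>C adj T y" using vector_eq_ldot by blast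
qed

lemma adj_adj: "T \<in> bounded_ops \<Longrightarrow> adj (adj T) = T"
  by (rule adj_unique) (simp_all add: adj_bounded_ops inner_commute[of "adj T x" for x] inner_adj[symmetric] inner_commute[of "T x" for x])

lemma adj_add: "S \<in> bounded_ops \<Longrightarrow> T \<in> bounded_ops \<Longrightarrow> adj (S + T) = adj S + adj T"
  by (rule adj_unique) (auto simp: inner_adj bounded_ops_closed blinfun.bilinear_simps inner_add_left inner_add_right)

lemma adj_scalar_op: "adj (scalar_op c) = scalar_op (cnj c)"
  by (rule adj_unique) (auto simp: scalar_op_bounded_ops inner_eq_Re_cinner cinner_scaleC_left cinner_scaleC_right)

lemma sym_posD_adj: "sym_pos T \<Longrightarrow> T \<in> bounded_ops \<Longrightarrow> adj T = T"
  by (rule adj_unique) (auto simp: sym_pos_def)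

lemma cinner_self_adjoint:
  "T \<in> bounded_ops \<Longrightarrow> adj T = T \<Longrightarrow> cinner (T x) y = cinner x (T y)"
  using cinner_adj by metis

text \<open>Polarization shows that a form with real diagonal is Hermitian. Conversely, a symmetric
  complex-linear operator has a real diagonal, because \<open>\<i>\<close> is skew-adjoint.\<close>

lemma op_le_iff_sym_pos:
  assumes "S \<in> bounded_ops" "T \<in> bounded_ops"
  shows "op_le S T \<longleftrightarrow> sym_pos (T - S)"
proof
  let ?D = "T - S"
  have D: "?D \<in> bounded_ops"
    using assms by (simp add: bounded_ops_def blinfun.bilinear_simps scaleC_diff_right)
  assume le: "op_le S T"
  have "cinner (?D x) y - cinner x (?D y) = 0" for x y
  proof (rule cinner_polarization[where f = "\<lambda>x y. cinner (?D x) y - cinner x (?D y)"])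
    fix x
    have "cinner (?D x) x \<in> \<real>" using le by (simp add: op_le_def)
    then show "cinner (?D x) x - cinner x (?D x) = 0"
      using cinner_commute[of x "?D x"] by (simp add: Reals_cnj_iff)
  qed (simp_all add: blinfun.add_right bounded_opsD[OF D] cinner_add_left cinner_add_right
      cinner_scaleC_left cinner_scaleC_right algebra_simps)
  then show "sym_pos ?D" using le by (simp add: sym_pos_def op_le_def inner_eq_Re_cinner)
next
  assume D: "sym_pos (T - S)"
  have "Im (cinner ((T - S) x) x) = 0" for x
  proof -
    have "(T - S) (\<i> *\<^sub>C x) = \<i> *\<^sub>C (T - S) x"
      using assms by (simp add: bounded_ops_def blinfun.bilinear_simps scaleC_diff_right)
    moreover have "inner ((T - S) x) (\<i> *\<^sub>C x) = inner x ((T - S) (\<i> *\<^sub>C x))"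
      using D by (simp add: sym_pos_def)
    ultimately have "inner ((T - S) x) (\<i> *\<^sub>C x) = - inner (\<i> *\<^sub>C x) ((T - S) x)"
      by (simp add: inner_ii_left)
    then show ?thesis by (simp add: inner_ii_right[symmetric] inner_commute)
  qed
  then show "op_le S T"
    using D unfolding sym_pos_def op_le_def complex_is_Real_iff inner_eq_Re_cinner by blast
qed

text \<open>Unital self-adjoint algebras without any closure condition. A von Neumann algebra and
  its commutant are both of this kind, so each lemma about orbits serves the two sides.\<close>

definition star_algebra :: "('a::complex_hilbert_space \<Rightarrow>\<^sub>L 'a) set \<Rightarrow> bool" where
  "star_algebra P \<longleftrightarrow> P \<subseteq> bounded_ops \<and> range scalar_op \<subseteq> P \<and> (\<forall>x\<in>P. adj x \<in> P) \<and>
     (\<forall>x\<in>P. \<forall>y\<in>P. x + y \<in> P \<and> x o\<^sub>L y \<in> P)"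

lemma star_algebraD:
  assumes "star_algebra P"
  shows "x \<in> P \<Longrightarrow> x \<in> bounded_ops" "scalar_op c \<in> P" "x \<in> P \<Longrightarrow> adj x \<in> P"
    "x \<in> P \<Longrightarrow> y \<in> P \<Longrightarrow> x + y \<in> P" "x \<in> P \<Longrightarrow> y \<in> P \<Longrightarrow> x o\<^sub>L y \<in> P"
    "id_blinfun \<in> P"
  using assms unfolding star_algebra_def by (auto simp: scalar_op_one[symmetric])

lemma scaleR_eq_scalar_op: "r *\<^sub>R T = scalar_op (of_real r) o\<^sub>L T"
  by (rule blinfun_eqI) (simp add: blinfun.scaleR_left scaleR_scaleC)

lemma star_algebra_scaleR: "star_algebra P \<Longrightarrow> x \<in> P \<Longrightarrow> r *\<^sub>R x \<in> P"
  by (simp add: scaleR_eq_scalar_op star_algebraD)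

lemma star_algebra_diff: "star_algebra P \<Longrightarrow> x \<in> P \<Longrightarrow> y \<in> P \<Longrightarrow> x - y \<in> P"
  using star_algebraD(4)[of P x "(-1) *\<^sub>R y"] star_algebra_scaleR[of P y "-1"] by simp

lemma star_algebra_decompose:
  assumes P: "star_algebra P" "T \<in> P"
  obtains A B where "A \<in> P" "B \<in> P" "adj A = A" "adj B = B" "T = A + (scalar_op \<i> o\<^sub>L B)"
proof -
  have T: "T \<in> bounded_ops" "adj T \<in> bounded_ops" using P star_algebraD(1,3) by blast+
  define A where "A = (1/2) *\<^sub>R (T + adj T)"
  define B where "B = scalar_op (- \<i> / 2) o\<^sub>L (T - adj T)"
  have AB: "A \<in> P" "B \<in> P"
    unfolding A_def B_def using P
    by (auto intro!: star_algebra_scaleR star_algebra_diff star_algebraD(2-5))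
  have T': "inner (T x) y = inner x (adj T y)" "inner (adj T x) y = inner x (T y)" for x y
    using inner_adj[OF T(1)] inner_adj[OF T(2)] adj_adj[OF T(1)] by auto
  have "adj A = A"
    using AB star_algebraD(1)[OF P(1)]
    by (intro adj_unique) (auto simp: A_def blinfun.bilinear_simps inner_add_left inner_add_right T')
  moreover have "adj B = B"
  proof (rule adj_unique)
    fix x y
    have "cinner (B x) y = cinner x (B y)"
      using cinner_adj[OF T(1), of x y] cinner_adj[OF T(2), of x y] adj_adj[OF T(1)]
      by (simp add: B_def cinner_scaleC_left cinner_scaleC_right blinfun.diff_left cinner_diff_left
          cinner_diff_right algebra_simps)
    then show "inner (B x) y = inner x (B y)" by (simp add: inner_eq_Re_cinner)
  qed (use AB star_algebraD(1)[OF P(1)] in auto)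
  moreover have "T = A + (scalar_op \<i> o\<^sub>L B)"
    by (rule blinfun_eqI)
      (simp add: A_def B_def blinfun.bilinear_simps scaleR_scaleC scaleC_scaleC scaleC_add_right scaleC_diff_right
        flip: scaleC_add_left)
  ultimately show ?thesis using that AB by blast
qed

section \<open>Commutants and von Neumann algebras\<close>

lemma commutantI:
  fixes S :: "('a::complex_hilbert_space \<Rightarrow>\<^sub>L 'a) set" and T :: "'a \<Rightarrow>\<^sub>L 'a"
  shows "T \<in> bounded_ops \<Longrightarrow> (\<And>s x. s \<in> S \<Longrightarrow> T (s x) = s (T x)) \<Longrightarrow> T \<in> commutant S"
  by (auto simp: commutant_def intro!: blinfun_eqI)

lemma commutantD:
  fixes S :: "('a::complex_hilbert_space \<Rightarrow>\<^sub>L 'a) set" and T :: "'a \<Rightarrow>\<^sub>L 'a"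
  shows "T \<in> commutant S \<Longrightarrow> s \<in> S \<Longrightarrow> T (s x) = s (T x)"
  unfolding commutant_def by (metis (mono_tags, lifting) blinfun_apply_blinfun_compose mem_Collect_eq)

lemma commutant_bounded_ops: "commutant S \<subseteq> bounded_ops"
  by (auto simp: commutant_def)

lemma commutant_antimono: "S \<subseteq> S' \<Longrightarrow> commutant S' \<subseteq> commutant S"
  by (auto simp: commutant_def)

lemma subset_bicommutant: "S \<subseteq> bounded_ops \<Longrightarrow> S \<subseteq> commutant (commutant S)"
  by (auto intro!: commutantI simp: commutantD)

lemma commutant_triple: "S \<subseteq> bounded_ops \<Longrightarrow> commutant (commutant (commutant S)) = commutant S"
  by (intro subset_antisym commutant_antimono subset_bicommutant commutant_bounded_ops)

lemma star_algebra_commutant: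
  assumes S: "S \<subseteq> bounded_ops" "\<And>s. s \<in> S \<Longrightarrow> adj s \<in> S"
  shows "star_algebra (commutant S)"
  unfolding star_algebra_def
proof (intro conjI ballI)
  show "range scalar_op \<subseteq> commutant S"
    using S(1) by (auto intro!: commutantI scalar_op_bounded_ops simp: bounded_opsD subset_iff)
next
  fix T assume T: "T \<in> commutant S"
  then have Tb: "T \<in> bounded_ops" using commutant_bounded_ops by blast
  show "adj T \<in> commutant S"
  proof (rule commutantI)
    fix s x assume s: "s \<in> S"
    have sb: "s \<in> bounded_ops" "adj s \<in> bounded_ops" using s S by auto
    have "inner z (adj T (s x)) = inner z (s (adj T x))" for z
    proof -
      have "inner z (adj T (s x)) = inner (T z) (s x)" by (simp add: inner_adj Tb)
      also have "\<dots> = inner (adj s (T z)) x" by (simp add: inner_adj sb adj_adj)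
      also have "\<dots> = inner (T (adj s z)) x" using commutantD[OF T S(2)[OF s]] by simp
      also have "\<dots> = inner z (s (adj T x))" by (simp add: inner_adj Tb sb adj_adj)
      finally show ?thesis .
    qed
    then show "adj T (s x) = s (adj T x)" using vector_eq_ldot by blast
  qed (rule adj_bounded_ops[OF Tb])
next
  fix T R assume TR: "T \<in> commutant S" "R \<in> commutant S"
  then have b: "T \<in> bounded_ops" "R \<in> bounded_ops" using commutant_bounded_ops by blast+
  show "T + R \<in> commutant S" "T o\<^sub>L R \<in> commutant S"
    using TR by (auto intro!: commutantI simp: bounded_ops_closed b commutantD blinfun.bilinear_simps)
qed (rule commutant_bounded_ops)

lemma von_neumann_algebra_star: "von_neumann_algebra M \<Longrightarrow> star_algebra M"
proof -
  assume M: "von_neumann_algebra M"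
  then have "star_algebra (commutant M)" by (intro star_algebra_commutant) (auto simp: von_neumann_algebra_def)
  then have "star_algebra (commutant (commutant M))"
    by (intro star_algebra_commutant) (auto simp: star_algebra_def)
  then show "star_algebra M" using M by (simp add: von_neumann_algebra_def)
qed

lemma von_neumann_algebra_commutant:
  assumes M: "von_neumann_algebra M"
  shows "von_neumann_algebra (commutant M)"
proof -
  have "star_algebra (commutant M)" using M by (intro star_algebra_commutant) (auto simp: von_neumann_algebra_def)
  then show ?thesis using M unfolding von_neumann_algebra_def star_algebra_def by auto
qed

text \<open>The root commutes with every real-linear operator that commutes with \<open>A\<close>.
  Applied to the elements of \<open>S\<close> this gives the commutation relations, applied to
  multiplication by \<open>\<i>\<close> it gives complex linearity.\<close>

lemma ex_sqrt_in_commutant: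
  assumes A: "A \<in> commutant S" "sym_pos A"
  shows "\<exists>s\<in>commutant S. sym_pos s \<and> s o\<^sub>L s = A"
proof -
  obtain s where s: "sym_pos s" "s o\<^sub>L s = A" "\<And>\<C>. square_closed \<C> \<Longrightarrow> A \<in> \<C> \<Longrightarrow> s \<in> \<C>"
    using ex_positive_sqrt[OF A(2)] by blast
  have comm: "s (C x) = C (s x)" if "\<And>x. A (C x) = C (A x)" for C :: "'a \<Rightarrow>\<^sub>L 'a" and x
  proof -
    have "A o\<^sub>L C = C o\<^sub>L A" by (rule blinfun_eqI) (simp add: that)
    then have "s o\<^sub>L C = C o\<^sub>L s" using s(3)[OF square_closed_commuting[of C]] by simp
    then show ?thesis by (metis blinfun_apply_blinfun_compose)
  qed
  have "s \<in> commutant S"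
  proof (rule commutantI)
    show "s \<in> bounded_ops"
    proof -
      have "A \<in> bounded_ops" using A(1) commutant_bounded_ops by blast
      then show ?thesis using comm[of "scalar_op \<i>"] by (simp add: bounded_ops_iff)
    qed
    show "s (t x) = t (s x)" if "t \<in> S" for t x
      using comm[of t] commutantD[OF A(1) that] by blast
  qed
  then show ?thesis using s by blast
qed

lemma commutant_Un: "commutant (S \<union> T) = commutant S \<inter> commutant T"
  by (auto simp: commutant_def)


section \<open>Tensor products of operators\<close>

lemma subspace_closure:
  fixes S :: "'a::real_normed_vector set"
  assumes S: "subspace S"
  shows "subspace (closure S)"
  unfolding subspace_def
proof (intro conjI ballI allI)
  show "0 \<in> closure S" using subspace_0[OF S] closure_subset by blast
next
  fix x y assume "x \<in> closure S" "y \<in> closure S"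
  then obtain f g where f: "\<And>n::nat. f n \<in> S" "f \<longlonglongrightarrow> x" and g: "\<And>n::nat. g n \<in> S" "g \<longlonglongrightarrow> y"
    unfolding closure_sequential by blast
  have "\<And>n. f n + g n \<in> S" using subspace_add[OF S] f(1) g(1) by blast
  moreover have "(\<lambda>n. f n + g n) \<longlonglongrightarrow> x + y" by (intro tendsto_add f g)
  ultimately show "x + y \<in> closure S"
    unfolding closure_sequential by (intro exI[of _ "\<lambda>n. f n + g n"]) simp
next
  fix x and r :: real assume "x \<in> closure S"
  then obtain f where f: "\<And>n::nat. f n \<in> S" "f \<longlonglongrightarrow> x"
    unfolding closure_sequential by blast
  have "\<And>n. r *\<^sub>R f n \<in> S" using subspace_scale[OF S] f(1) by blast
  moreover have "(\<lambda>n. r *\<^sub>R f n) \<longlonglongrightarrow> r *\<^sub>R x" by (intro tendsto_scaleR tendsto_const f)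
  ultimately show "r *\<^sub>R x \<in> closure S"
    unfolding closure_sequential by (intro exI[of _ "\<lambda>n. r *\<^sub>R f n"]) simp
qed

text \<open>Starting from a linear relation avoids a separate proof that a prescription on sums of
  elementary tensors is well defined: the norm bound makes \<open>G\<close> single valued, and the
  bound survives in the closure of \<open>G\<close>, which is the graph of the extension.\<close>

lemma blinfun_extension_from_graph:
  fixes G :: "('a::real_normed_vector \<times> 'b::banach) set"
  assumes G: "subspace G" "\<And>v w. (v, w) \<in> G \<Longrightarrow> norm w \<le> c * norm v"
    and dense: "closure (fst ` G) = UNIV"
  shows "\<exists>T :: 'a \<Rightarrow>\<^sub>L 'b. \<forall>(v, w)\<in>G. T v = w"
proof -
  let ?H = "closure G"
  have H: "subspace ?H" using G(1) by (rule subspace_closure)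
  have bnd: "norm w \<le> c * norm v" if "(v, w) \<in> ?H" for v w
  proof -
    have "closed {p :: 'a \<times> 'b. norm (snd p) \<le> c * norm (fst p)}"
      by (intro closed_Collect_le continuous_intros)
    moreover have "G \<subseteq> {p. norm (snd p) \<le> c * norm (fst p)}" using G(2) by auto
    ultimately have "?H \<subseteq> {p. norm (snd p) \<le> c * norm (fst p)}" by (rule closure_minimal[rotated])
    then show ?thesis using that by auto
  qed
  have uniq: "w = w'" if "(v, w) \<in> ?H" "(v, w') \<in> ?H" for v w w'
  proof -
    have "(v, w) - (v, w') \<in> ?H" using H that by (rule subspace_diff)
    then have "norm (w - w') \<le> c * norm (v - v)" by (intro bnd) simp
    then show ?thesis by simp
  qed
  have ex: "\<exists>w. (v, w) \<in> ?H" for v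
  proof -
    have "v \<in> closure (fst ` G)" using dense by simp
    then obtain u where u: "\<And>n::nat. u n \<in> fst ` G" "u \<longlonglongrightarrow> v"
      unfolding closure_sequential by blast
    then have "\<forall>n. \<exists>w. (u n, w) \<in> G" by force
    then obtain w where w: "\<And>n. (u n, w n) \<in> G" by metis
    have "Cauchy u" using u(2) by (rule LIMSEQ_imp_Cauchy)
    have "Cauchy w"
    proof (rule metric_CauchyI)
      fix e :: real assume e: "e > 0"
      let ?c = "\<bar>c\<bar> + 1"
      obtain M where M: "\<And>m n. m \<ge> M \<Longrightarrow> n \<ge> M \<Longrightarrow> dist (u m) (u n) < e / ?c"
        using metric_CauchyD[OF \<open>Cauchy u\<close>, of "e / ?c"] e by auto
      have "dist (w m) (w n) < e" if mn: "m \<ge> M" "n \<ge> M" for m n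
      proof -
        have "(u m, w m) - (u n, w n) \<in> G" using G(1) w w by (rule subspace_diff)
        then have "norm (w m - w n) \<le> c * norm (u m - u n)" using G(2) by simp
        also have "\<dots> \<le> ?c * norm (u m - u n)" by (intro mult_right_mono) auto
        also have "\<dots> < ?c * (e / ?c)" using M[OF mn] by (intro mult_strict_left_mono) (auto simp: dist_norm)
        finally show ?thesis by (simp add: dist_norm)
      qed
      then show "\<exists>M. \<forall>m\<ge>M. \<forall>n\<ge>M. dist (w m) (w n) < e" by blast
    qed
    then obtain l where l: "w \<longlonglongrightarrow> l" using Cauchy_convergent convergent_def by blast
    have "(\<lambda>n. (u n, w n)) \<longlonglongrightarrow> (v, l)" using u(2) l by (rule tendsto_Pair)
    then have "(v, l) \<in> ?H"
      unfolding closure_sequential using w by (intro exI[of _ "\<lambda>n. (u n, w n)"]) simp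
    then show ?thesis by blast
  qed
  then obtain f where f: "\<And>v. (v, f v) \<in> ?H" by metis
  have "bounded_linear f"
  proof (rule bounded_linear_intro[where K = c])
    show "f (x + y) = f x + f y" for x y
      using uniq[OF f[of "x + y"]] subspace_add[OF H f f, of x y] by simp
    show "f (r *\<^sub>R x) = r *\<^sub>R f x" for r x
      using uniq[OF f[of "r *\<^sub>R x"]] subspace_scale[OF H f, of r x] by simp
    show "norm (f x) \<le> norm x * c" for x
      using bnd[OF f, of x] by (simp add: mult.commute)
  qed
  moreover have "f v = w" if "(v, w) \<in> G" for v w
    using uniq[OF f] that closure_subset by blast
  ultimately have "\<forall>(v, w)\<in>G. Blinfun f v = w" by (auto simp: bounded_linear_Blinfun_apply)
  then show ?thesis by blast
qed

definition elem_tensors ::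
    "('a::complex_hilbert_space \<Rightarrow> 'b::complex_hilbert_space \<Rightarrow> 'c::complex_hilbert_space)
      \<Rightarrow> ('a \<Rightarrow>\<^sub>L 'a) set \<Rightarrow> ('b \<Rightarrow>\<^sub>L 'b) set \<Rightarrow> ('c \<Rightarrow>\<^sub>L 'c) set" where
  "elem_tensors t M1 M2 = {op_tensor t a b | a b. a \<in> M1 \<and> b \<in> M2}"

lemma vn_tensor_elem_tensors: "vn_tensor t M1 M2 = commutant (commutant (elem_tensors t M1 M2))"
  by (simp add: vn_tensor_def elem_tensors_def)

lemma op_tensor_swap:
  fixes t :: "'b::complex_hilbert_space \<Rightarrow> 'a::complex_hilbert_space \<Rightarrow> 'c::complex_hilbert_space"
  shows "op_tensor (\<lambda>y x. t x y) b a = op_tensor t a b"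
proof -
  have "(\<forall>y x. P x y) \<longleftrightarrow> (\<forall>x y. P x y)" for P :: "'b \<Rightarrow> 'a \<Rightarrow> bool" by blast
  then show ?thesis unfolding op_tensor_def by metis
qed

lemma elem_tensors_swap: "elem_tensors (\<lambda>y x. t x y) M2 M1 = elem_tensors t M1 M2"
  unfolding elem_tensors_def op_tensor_swap[of t] by blast

lemma hilbert_tensor_swap:
  assumes "hilbert_tensor t"
  shows "hilbert_tensor (\<lambda>y x. t x y)"
proof -
  have "{t x y | y x. True} = {t x y | x y. True}" by blast
  then show ?thesis using assms unfolding hilbert_tensor_def by (simp add: mult.commute)
qed

context
  fixes t :: "'a::complex_hilbert_space \<Rightarrow> 'b::complex_hilbert_space \<Rightarrow> 'c::complex_hilbert_space"
  assumes t: "hilbert_tensor t"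
begin

lemma tensor_add_left: "t (x + x') y = t x y + t x' y"
  and tensor_add_right: "t x (y + y') = t x y + t x y'"
  and tensor_scaleC_left: "t (c *\<^sub>C x) y = c *\<^sub>C t x y"
  and tensor_scaleC_right: "t x (c *\<^sub>C y) = c *\<^sub>C t x y"
  and cinner_tensor: "cinner (t x y) (t x' y') = cinner x x' * cinner y y'"
  and tensor_dense: "closure (span {t x y | x y. True}) = UNIV"
  using t unfolding hilbert_tensor_def by auto

lemma norm_tensor: "norm (t x y) = norm x * norm y"
proof -
  have "complex_of_real ((norm (t x y))\<^sup>2) = complex_of_real ((norm x * norm y)\<^sup>2)"
    using cinner_tensor[of x y x y] by (simp only: cinner_self of_real_mult[symmetric] power_mult_distrib)
  then have "(norm (t x y))\<^sup>2 = (norm x * norm y)\<^sup>2" using of_real_eq_iff by blast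
  then show ?thesis by (simp add: power2_eq_iff_nonneg)
qed

lemma bounded_bilinear_tensor: "bounded_bilinear t"
proof
  show "\<exists>K. \<forall>a b. norm (t a b) \<le> norm a * norm b * K"
    by (intro exI[of _ 1]) (simp add: norm_tensor)
qed (auto simp: tensor_add_left tensor_add_right tensor_scaleC_left tensor_scaleC_right scaleR_scaleC)

lemmas tensor_diff_left = bounded_bilinear.diff_left[OF bounded_bilinear_tensor]
lemmas tensor_scaleR_left = bounded_bilinear.scaleR_left[OF bounded_bilinear_tensor]

lemma inner_tensor_ii:
  "inner (t x y) (\<i> *\<^sub>C t x' y') = Im (cinner x x' * cinner y y')"
  by (simp add: inner_ii_right cinner_tensor)

lemma tensor_induct:
  assumes "closed V" "subspace V" "\<And>x y. t x y \<in> V"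
  shows "z \<in> V"
proof -
  have "span {t x y | x y. True} \<subseteq> V" using assms(2,3) by (intro span_minimal) auto
  then have "closure (span {t x y | x y. True}) \<subseteq> V" using assms(1) by (rule closure_minimal)
  then show ?thesis using tensor_dense by blast
qed

lemma tensor_blinfun_eqI:
  fixes S T :: "'c \<Rightarrow>\<^sub>L 'd::real_normed_vector"
  assumes "\<And>x y. S (t x y) = T (t x y)"
  shows "S = T"
proof (rule blinfun_eqI)
  fix z
  have "z \<in> {z. S z = T z}"
  proof (rule tensor_induct)
    show "closed {z. S z = T z}" by (intro closed_Collect_eq continuous_intros)
    show "subspace {z. S z = T z}" by (auto simp: subspace_def blinfun.bilinear_simps)
  qed (use assms in auto)
  then show "S z = T z" by simp
qed

lemma tensor_perp_eq_0:
  assumes "\<And>x y. inner z (t x y) = 0"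
  shows "z = 0"
proof -
  have "z \<in> {w. inner z w = 0}"
  proof (rule tensor_induct)
    show "closed {w. inner z w = 0}" by (intro closed_Collect_eq continuous_intros)
    show "subspace {w. inner z w = 0}" by (auto simp: subspace_def inner_add_right)
  qed (use assms in auto)
  then show ?thesis by simp
qed

text \<open>With \<open>s\<close> the positive square root of \<open>\<parallel>a\<parallel>\<^sup>2 - a\<^sup>* a\<close>, the difference of the squares of
  both sides is \<open>\<parallel>\<Sum> s x\<^sub>p \<otimes> y\<^sub>p\<parallel>\<^sup>2\<close>.\<close>

lemma norm_sum_tensor_le:
  fixes a :: "'a \<Rightarrow>\<^sub>L 'a"
  assumes a: "a \<in> bounded_ops"
  shows "norm (\<Sum>p\<in>F. t (a (x p)) (y p)) \<le> norm a * norm (\<Sum>p\<in>F. t (x p) (y p))"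
proof -
  define D where "D = (norm a)\<^sup>2 *\<^sub>R id_blinfun - (adj a o\<^sub>L a)"
  have Dx: "D x = (norm a)\<^sup>2 *\<^sub>R x - adj a (a x)" for x
    by (simp add: D_def blinfun.bilinear_simps)
  have aa: "cinner (adj a u) v = cinner u (a v)" for u v
    using cinner_adj[OF adj_bounded_ops[OF a]] adj_adj[OF a] by simp
  have cD: "cinner (D u) v = complex_of_real ((norm a)\<^sup>2) * cinner u v - cinner (a u) (a v)" for u v
    by (simp add: Dx cinner_diff_left aa scaleR_scaleC cinner_scaleC_left)
  have "sym_pos D"
    unfolding sym_pos_def
  proof (intro conjI allI)
    fix u v
    show "inner (D u) v = inner u (D v)"
      unfolding inner_commute[of u "D v"] by (simp add: inner_eq_Re_cinner cD)
        (simp add: inner_eq_Re_cinner[symmetric] inner_commute)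
    have "(norm (a u))\<^sup>2 \<le> (norm a * norm u)\<^sup>2"
      using norm_blinfun[of a u] by (rule power_mono) simp
    then show "0 \<le> inner (D u) u"
      by (simp add: inner_eq_Re_cinner cD cinner_self power_mult_distrib flip: of_real_power)
  qed
  \<comment> \<open>The commutant of the empty set is \<open>bounded_ops\<close>; membership is used
    to make the root \<open>s\<close> complex linear.\<close>
  moreover have "D \<in> commutant {}"
    using a bounded_opsD[OF adj_bounded_ops[OF a]]
    by (auto intro!: commutantI simp: bounded_ops_iff Dx bounded_opsD[OF a] scaleC_diff_right scaleC_scaleR_commute)
  ultimately obtain s where s: "sym_pos s" "s o\<^sub>L s = D" "s \<in> commutant {}"
    using ex_sqrt_in_commutant by blast
  then have sb: "s \<in> bounded_ops" "adj s = s" using commutant_bounded_ops sym_posD_adj by blast+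
  have ss: "cinner (s u) (s v) = complex_of_real ((norm a)\<^sup>2) * cinner u v - cinner (a u) (a v)" for u v
  proof -
    have "cinner (s u) (s v) = cinner ((s o\<^sub>L s) u) v"
      using cinner_self_adjoint[OF sb, of "s u" v] by simp
    then show ?thesis by (simp add: s(2) cD)
  qed
  have sq: "complex_of_real ((norm (\<Sum>p\<in>F. t (f p) (y p)))\<^sup>2)
      = (\<Sum>p\<in>F. \<Sum>q\<in>F. cinner (f p) (f q) * cinner (y p) (y q))" for f
    by (simp only: cinner_self[symmetric] cinner_sum_left cinner_sum_right cinner_tensor) (rule sum.swap)
  have "complex_of_real ((norm (\<Sum>p\<in>F. t (s (x p)) (y p)))\<^sup>2)
      = complex_of_real ((norm a)\<^sup>2) * complex_of_real ((norm (\<Sum>p\<in>F. t (x p) (y p)))\<^sup>2)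
        - complex_of_real ((norm (\<Sum>p\<in>F. t (a (x p)) (y p)))\<^sup>2)"
    unfolding sq by (simp add: ss algebra_simps sum_subtractf sum_distrib_left)
  then have "complex_of_real ((norm (\<Sum>p\<in>F. t (s (x p)) (y p)))\<^sup>2)
      = complex_of_real ((norm a)\<^sup>2 * (norm (\<Sum>p\<in>F. t (x p) (y p)))\<^sup>2
        - (norm (\<Sum>p\<in>F. t (a (x p)) (y p)))\<^sup>2)"
    by simp
  then have "(norm (\<Sum>p\<in>F. t (s (x p)) (y p)))\<^sup>2
      = (norm a)\<^sup>2 * (norm (\<Sum>p\<in>F. t (x p) (y p)))\<^sup>2 - (norm (\<Sum>p\<in>F. t (a (x p)) (y p)))\<^sup>2"
    using of_real_eq_iff by blast
  moreover have "0 \<le> (norm (\<Sum>p\<in>F. t (s (x p)) (y p)))\<^sup>2" by simp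
  ultimately have "(norm (\<Sum>p\<in>F. t (a (x p)) (y p)))\<^sup>2 \<le> (norm a * norm (\<Sum>p\<in>F. t (x p) (y p)))\<^sup>2"
    by (simp add: power_mult_distrib)
  then show ?thesis by (rule power2_le_imp_le) simp
qed

lemma ex_tensor_left:
  fixes a :: "'a \<Rightarrow>\<^sub>L 'a"
  assumes a: "a \<in> bounded_ops"
  shows "\<exists>T :: 'c \<Rightarrow>\<^sub>L 'c. \<forall>x y. T (t x y) = t (a x) y"
proof -
  define S where "S = (\<lambda>(x, y). (t x y, t (a x) y)) ` UNIV"
  have "\<exists>T :: 'c \<Rightarrow>\<^sub>L 'c. \<forall>(v, w)\<in>span S. T v = w"
  proof (rule blinfun_extension_from_graph)
    show "subspace (span S)" by (rule subspace_span)
    have "linear (fst :: 'c \<times> 'c \<Rightarrow> 'c)" by (intro bounded_linear.linear bounded_linear_fst)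
    then have "fst ` span S = span (fst ` S)" by (simp add: linear_span_image)
    moreover have "fst ` S = {t x y | x y. True}" by (force simp: S_def image_iff)
    ultimately show "closure (fst ` span S) = UNIV" by (simp only: tensor_dense)
  next
    fix v w assume "(v, w) \<in> span S"
    then obtain F r where F: "finite F" "F \<subseteq> S" "(v, w) = (\<Sum>p\<in>F. r p *\<^sub>R p)"
      unfolding span_explicit by blast
    have "\<forall>p\<in>F. \<exists>x y. p = (t x y, t (a x) y)" using F(2) by (force simp: S_def)
    then obtain X Y where XY: "\<And>p. p \<in> F \<Longrightarrow> p = (t (X p) (Y p), t (a (X p)) (Y p))" by metis
    \<comment> \<open>The real coefficients are absorbed into the left factor, which gives the sums
      the shape treated in \<open>norm_sum_tensor_le\<close>.\<close>
    have v: "v = (\<Sum>p\<in>F. t (r p *\<^sub>R X p) (Y p))"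
    proof -
      have "v = (\<Sum>p\<in>F. r p *\<^sub>R fst p)" using arg_cong[OF F(3), of fst] by (simp add: fst_sum)
      moreover have "fst p = t (X p) (Y p)" if "p \<in> F" for p using XY[OF that] by (metis fst_conv)
      ultimately have "v = (\<Sum>p\<in>F. t (r p *\<^sub>R X p) (Y p))" by (simp add: tensor_scaleR_left)
      then show ?thesis .
    qed
    have w: "w = (\<Sum>p\<in>F. t (a (r p *\<^sub>R X p)) (Y p))"
    proof -
      have "w = (\<Sum>p\<in>F. r p *\<^sub>R snd p)" using arg_cong[OF F(3), of snd] by (simp add: snd_sum)
      moreover have "snd p = t (a (X p)) (Y p)" if "p \<in> F" for p using XY[OF that] by (metis snd_conv)
      ultimately have "w = (\<Sum>p\<in>F. t (a (r p *\<^sub>R X p)) (Y p))"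
        by (simp add: tensor_scaleR_left blinfun.scaleR_right)
      then show ?thesis .
    qed
    show "norm w \<le> norm a * norm v" unfolding v w by (rule norm_sum_tensor_le[OF a])
  qed
  then obtain T :: "'c \<Rightarrow>\<^sub>L 'c" where T: "\<forall>(v, w)\<in>span S. T v = w" by blast
  have "(t x y, t (a x) y) \<in> span S" for x y by (rule span_base) (auto simp: S_def)
  then have "T (t x y) = t (a x) y" for x y using T by fast
  then show ?thesis by blast
qed

end

context
  fixes t :: "'a::complex_hilbert_space \<Rightarrow> 'b::complex_hilbert_space \<Rightarrow> 'c::complex_hilbert_space"
  assumes t: "hilbert_tensor t"
begin

lemma op_tensor_eqI:
  fixes a :: "'a \<Rightarrow>\<^sub>L 'a" and b :: "'b \<Rightarrow>\<^sub>L 'b" and T :: "'c \<Rightarrow>\<^sub>L 'c"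
  assumes "\<And>x y. T (t x y) = t (a x) (b y)"
  shows "op_tensor t a b = T"
  unfolding op_tensor_def
  by (rule the_equality) (use assms in \<open>auto intro: tensor_blinfun_eqI[OF t]\<close>)

text \<open>The operator described by \<open>op_tensor\<close> exists as the product of
  \<open>a \<otimes> 1\<close> and \<open>1 \<otimes> b\<close>, the second factor coming from the
  tensor product with its legs exchanged.\<close>

lemma op_tensor_apply:
  fixes a :: "'a \<Rightarrow>\<^sub>L 'a" and b :: "'b \<Rightarrow>\<^sub>L 'b"
  assumes "a \<in> bounded_ops" "b \<in> bounded_ops"
  shows "op_tensor t a b (t x y) = t (a x) (b y)"
proof -
  obtain A :: "'c \<Rightarrow>\<^sub>L 'c" where A: "\<And>x y. A (t x y) = t (a x) y"
    using ex_tensor_left[OF t assms(1)] by blast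
  obtain C :: "'c \<Rightarrow>\<^sub>L 'c" where C: "\<And>x y. C (t x y) = t x (b y)"
    using ex_tensor_left[OF hilbert_tensor_swap[OF t] assms(2)] by blast
  have "op_tensor t a b = A o\<^sub>L C" by (rule op_tensor_eqI) (simp add: A C)
  then show ?thesis by (simp add: A C)
qed

lemma op_tensor_bounded_ops:
  assumes "a \<in> bounded_ops" "b \<in> bounded_ops"
  shows "op_tensor t a b \<in> bounded_ops"
proof -
  let ?T = "op_tensor t a b"
  have "?T o\<^sub>L scalar_op \<i> = scalar_op \<i> o\<^sub>L ?T"
    by (rule tensor_blinfun_eqI[OF t])
      (simp add: op_tensor_apply[OF assms] tensor_scaleC_left[OF t, symmetric] bounded_opsD[OF assms(1), symmetric])
  then have "?T (\<i> *\<^sub>C z) = \<i> *\<^sub>C ?T z" for z by (metis blinfun_apply_blinfun_compose scalar_op_apply)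
  then show ?thesis by (simp add: bounded_ops_iff)
qed

lemma adj_op_tensor:
  assumes ab: "a \<in> bounded_ops" "b \<in> bounded_ops"
  shows "adj (op_tensor t a b) = op_tensor t (adj a) (adj b)"
proof -
  note ab' = adj_bounded_ops[OF ab(1)] adj_bounded_ops[OF ab(2)]
  have "op_tensor t (adj a) (adj b) = adj (op_tensor t a b)"
  proof (rule tensor_blinfun_eqI[OF t])
    fix x y
    have "inner (op_tensor t (adj a) (adj b) (t x y) - adj (op_tensor t a b) (t x y)) (t x' y') = 0" for x' y'
    proof -
      have "inner (adj (op_tensor t a b) (t x y)) (t x' y') = inner (op_tensor t a b (t x' y')) (t x y)"
        using inner_adj[OF op_tensor_bounded_ops[OF ab], of "t x' y'" "t x y"] by (simp add: inner_commute)
      also have "\<dots> = Re (cinner x' (adj a x) * cinner y' (adj b y))"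
        by (simp add: op_tensor_apply[OF ab] inner_eq_Re_cinner cinner_tensor[OF t] cinner_adj ab)
      also have "\<dots> = inner (t x' y') (t (adj a x) (adj b y))"
        by (simp only: inner_eq_Re_cinner cinner_tensor[OF t])
      also have "\<dots> = inner (op_tensor t (adj a) (adj b) (t x y)) (t x' y')"
        by (simp add: op_tensor_apply[OF ab'] inner_commute)
      finally show ?thesis by (simp add: inner_diff_left)
    qed
    then show "op_tensor t (adj a) (adj b) (t x y) = adj (op_tensor t a b) (t x y)"
      using tensor_perp_eq_0[OF t] by fastforce
  qed
  then show ?thesis by simp
qed

lemma op_tensor_compose:
  assumes "a \<in> bounded_ops" "b \<in> bounded_ops" "a' \<in> bounded_ops" "b' \<in> bounded_ops"
  shows "op_tensor t a b o\<^sub>L op_tensor t a' b' = op_tensor t (a o\<^sub>L a') (b o\<^sub>L b')"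
  by (rule op_tensor_eqI[symmetric]) (simp add: op_tensor_apply assms)

lemma op_tensor_add_left:
  assumes "a \<in> bounded_ops" "b \<in> bounded_ops" "a' \<in> bounded_ops"
  shows "op_tensor t (a + a') b = op_tensor t a b + op_tensor t a' b"
  by (rule op_tensor_eqI) (simp add: op_tensor_apply assms blinfun.bilinear_simps tensor_add_left[OF t])

lemma op_tensor_scalar_left:
  assumes "a \<in> bounded_ops" "b \<in> bounded_ops"
  shows "op_tensor t (scalar_op c o\<^sub>L a) b = scalar_op c o\<^sub>L op_tensor t a b"
  by (rule op_tensor_eqI) (simp add: op_tensor_apply assms tensor_scaleC_left[OF t])

lemma op_tensor_id_inject:
  assumes "a \<in> bounded_ops" "a' \<in> bounded_ops" "op_tensor t a id_blinfun = op_tensor t a' id_blinfun"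
    and y: "(y::'b) \<noteq> 0"
  shows "a = a'"
proof (rule blinfun_eqI)
  fix x
  have "t (a x) y = t (a' x) y"
    using op_tensor_apply[OF assms(1), of id_blinfun x y] op_tensor_apply[OF assms(2), of id_blinfun x y]
    by (simp add: assms(3) bounded_ops_closed)
  then have "norm (t (a x - a' x) y) = 0" by (simp add: tensor_diff_left[OF t])
  then show "a x = a' x" using y by (simp add: norm_tensor[OF t])
qed

lemma elem_tensors_bounded_ops:
  "M1 \<subseteq> bounded_ops \<Longrightarrow> M2 \<subseteq> bounded_ops \<Longrightarrow> elem_tensors t M1 M2 \<subseteq> bounded_ops"
  unfolding elem_tensors_def using op_tensor_bounded_ops by blast

lemma star_algebra_commutant_elem_tensors:
  assumes "star_algebra M1" "star_algebra M2"
  shows "star_algebra (commutant (elem_tensors t M1 M2))"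
proof (rule star_algebra_commutant)
  show "elem_tensors t M1 M2 \<subseteq> bounded_ops"
    using assms by (intro elem_tensors_bounded_ops) (auto simp: star_algebra_def)
next
  fix s assume "s \<in> elem_tensors t M1 M2"
  then obtain a b where s: "s = op_tensor t a b" "a \<in> M1" "b \<in> M2" by (auto simp: elem_tensors_def)
  then have "adj s = op_tensor t (adj a) (adj b)"
    using assms by (simp add: adj_op_tensor star_algebraD(1))
  then show "adj s \<in> elem_tensors t M1 M2"
    using s assms unfolding elem_tensors_def by (auto intro: star_algebraD(3))
qed

text \<open>The operator \<open>w\<close> is the image of \<open>W\<close> under the slice map that
  applies the vector functional of \<open>y\<close>, \<open>y'\<close> to the second leg.\<close>

lemma ex_slice:
  fixes W :: "'c \<Rightarrow>\<^sub>L 'c"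
  assumes W: "W \<in> bounded_ops"
  shows "\<exists>w\<in>bounded_ops. \<forall>x x'. cinner (blinfun_apply w x) x' = cinner (W (t x y)) (t x' y')"
proof -
  have bl: "bounded_linear (\<lambda>x. t x z)" for z
    by (rule bounded_bilinear.bounded_linear_left[OF bounded_bilinear_tensor[OF t]])
  have "bounded_bilinear (\<lambda>x x'. inner (W (t x y)) (t x' y'))"
    by (intro bounded_bilinear.comp[OF bounded_bilinear_inner] bl bounded_linear_compose[OF blinfun.bounded_linear_right bl])
  then obtain w :: "'a \<Rightarrow>\<^sub>L 'a" where w: "\<And>x x'. inner (w x) x' = inner (W (t x y)) (t x' y')"
    using bounded_bilinear_representation by blast
  have "inner (w (\<i> *\<^sub>C x)) x' = inner (\<i> *\<^sub>C w x) x'" for x x'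
  proof -
    have "inner (w (\<i> *\<^sub>C x)) x' = inner (\<i> *\<^sub>C W (t x y)) (t x' y')"
      by (simp add: w tensor_scaleC_left[OF t] bounded_opsD[OF W])
    also have "\<dots> = - inner (w x) (\<i> *\<^sub>C x')" by (simp add: w tensor_scaleC_left[OF t] inner_ii_left)
    finally show ?thesis by (simp add: inner_ii_left)
  qed
  then have "w (\<i> *\<^sub>C x) = \<i> *\<^sub>C w x" for x using vector_eq_rdot by blast
  then have "w \<in> bounded_ops" by (simp add: bounded_ops_iff)
  moreover have "cinner (w x) x' = cinner (W (t x y)) (t x' y')" for x x'
    by (simp add: cinner_eq_Complex w tensor_scaleC_left[OF t])
  ultimately show ?thesis by blast
qed

end

lemma ex_slice_right:
  fixes t :: "'a::complex_hilbert_space \<Rightarrow> 'b::complex_hilbert_space \<Rightarrow> 'c::complex_hilbert_space"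
    and W :: "'c \<Rightarrow>\<^sub>L 'c"
  assumes t: "hilbert_tensor t" and W: "W \<in> bounded_ops"
  shows "\<exists>w\<in>bounded_ops. \<forall>y y'. cinner (blinfun_apply w y) y' = cinner (W (t x y)) (t x' y')"
  using ex_slice[OF hilbert_tensor_swap[OF t] W] .

text \<open>For fixed \<open>x\<close>, \<open>x'\<close> the slice of \<open>W\<close> on the
  second factor commutes with \<open>Y\<close>, so it is a scalar \<open>c x x'\<close>. The slice
  on the first factor at a unit vector \<open>y1\<close> has matrix coefficients
  \<open>c x x'\<close>, and it is the required \<open>w\<close>.\<close>

lemma commuting_with_irreducible_right_leg:
  fixes t :: "'a::complex_hilbert_space \<Rightarrow> 'b::complex_hilbert_space \<Rightarrow> 'c::complex_hilbert_space"
    and W :: "'c \<Rightarrow>\<^sub>L 'c"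
  assumes t: "hilbert_tensor t" and W: "W \<in> bounded_ops"
    and Y: "Y \<subseteq> bounded_ops" "commutant Y \<subseteq> range scalar_op"
    and comm: "\<And>b z. b \<in> Y \<Longrightarrow> W (op_tensor t id_blinfun b z) = op_tensor t id_blinfun b (W z)"
    and y0: "(y0::'b) \<noteq> 0"
  shows "\<exists>w\<in>bounded_ops. W = op_tensor t w id_blinfun"
proof -
  note id = bounded_ops_closed(1)
  have "\<exists>c. \<forall>y y'. cinner (W (t x y)) (t x' y') = c * cinner y y'" for x x'
  proof -
    obtain R where R: "R \<in> bounded_ops" "\<And>y y'. cinner (blinfun_apply R y) y' = cinner (W (t x y)) (t x' y')"
      using ex_slice_right[OF t W] by blast
    have "R \<in> commutant Y"
    proof (rule commutantI[OF R(1)])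
      fix b y assume b: "b \<in> Y"
      then have bb: "b \<in> bounded_ops" using Y by blast
      have "cinner (R (b y)) y' = cinner (b (R y)) y'" for y'
      proof -
        have "cinner (R (b y)) y' = cinner (W (op_tensor t id_blinfun b (t x y))) (t x' y')"
          by (simp add: R op_tensor_apply[OF t id bb])
        also have "\<dots> = cinner (W (t x y)) (adj (op_tensor t id_blinfun b) (t x' y'))"
          by (simp add: comm[OF b] cinner_adj op_tensor_bounded_ops[OF t id bb])
        also have "adj (op_tensor t id_blinfun b) = op_tensor t id_blinfun (adj b)"
          using adj_op_tensor[OF t id bb] adj_scalar_op[of 1, where 'a = 'a] by (simp add: scalar_op_one)
        also have "op_tensor t id_blinfun (adj b) (t x' y') = t x' (adj b y')"
          by (simp add: op_tensor_apply[OF t id adj_bounded_ops[OF bb]])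
        finally show ?thesis by (simp add: R(2)[symmetric] cinner_adj[OF bb])
      qed
      then have "cinner (R (b y) - b (R y)) y' = 0" for y' by (simp add: cinner_diff_left)
      from cinner_eq_0_all[OF this] show "R (b y) = b (R y)" by simp
    qed
    then obtain c where "R = scalar_op c" using Y by blast
    then have "\<forall>y y'. cinner (W (t x y)) (t x' y') = c * cinner y y'"
      by (simp add: R(2)[symmetric] cinner_scaleC_left)
    then show ?thesis by blast
  qed
  then obtain c where c: "\<And>x x' y y'. cinner (W (t x y)) (t x' y') = c x x' * cinner y y'" by metis
  define y1 where "y1 = (1 / norm y0) *\<^sub>R y0"
  have y1: "cinner y1 y1 = 1" using y0 by (simp add: cinner_self y1_def)
  obtain w where w: "w \<in> bounded_ops" "\<And>x x'. cinner (blinfun_apply w x) x' = cinner (W (t x y1)) (t x' y1)"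
    using ex_slice[OF t W] by blast
  have "W = op_tensor t w id_blinfun"
  proof (rule tensor_blinfun_eqI[OF t])
    fix x y
    have "inner (W (t x y) - t (w x) y) (t x' y') = 0" for x' y'
      using w(2)[of x x'] c[of x y1 x' y1] y1
      by (simp add: inner_eq_Re_cinner cinner_diff_left cinner_tensor[OF t] c)
    then have "W (t x y) - t (w x) y = 0" by (rule tensor_perp_eq_0[OF t])
    then show "W (t x y) = op_tensor t w id_blinfun (t x y)"
      by (simp add: op_tensor_apply[OF t w(1) id])
  qed
  with w(1) show ?thesis by blast
qed


section \<open>The commutation theorem for tensor products\<close>

definition orbit :: "('a::complex_hilbert_space \<Rightarrow>\<^sub>L 'a) set \<Rightarrow> 'a \<Rightarrow> 'a set" where
  "orbit P \<xi> = closure ((\<lambda>a. blinfun_apply a \<xi>) ` P)"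

lemma closed_orbit: "closed (orbit P \<xi>)"
  by (simp add: orbit_def)

lemma orbitI: "a \<in> P \<Longrightarrow> blinfun_apply a \<xi> \<in> orbit P \<xi>"
  unfolding orbit_def by (rule subsetD[OF closure_subset]) (rule imageI)

lemma blinfun_closure_mapsto:
  fixes T :: "'a::real_normed_vector \<Rightarrow>\<^sub>L 'b::real_normed_vector"
  assumes "x \<in> closure S" "\<And>s. s \<in> S \<Longrightarrow> T s \<in> V" "closed V"
  shows "T x \<in> V"
proof -
  have "T ` closure S \<subseteq> V"
    by (rule image_closure_subset) (use assms in \<open>auto intro!: continuous_intros\<close>)
  then show ?thesis using assms(1) by blast
qed

lemma inner_closure_eq_0:
  assumes "y \<in> closure S" "\<And>s. s \<in> S \<Longrightarrow> inner x s = 0"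
  shows "inner x y = 0"
proof -
  have "closure S \<subseteq> {y. inner x y = 0}"
    by (rule closure_minimal) (use assms(2) in \<open>auto intro!: closed_Collect_eq continuous_intros\<close>)
  then show ?thesis using assms(1) by blast
qed

lemma orbit_invariant:
  assumes P: "star_algebra P" "a \<in> P" and x: "x \<in> orbit P \<xi>"
  shows "a x \<in> orbit P \<xi>"
  using x unfolding orbit_def
proof (rule blinfun_closure_mapsto)
  fix s assume "s \<in> (\<lambda>a. blinfun_apply a \<xi>) ` P"
  then obtain b where b: "b \<in> P" "s = b \<xi>" by blast
  have "blinfun_apply (a o\<^sub>L b) \<xi> \<in> orbit P \<xi>" by (rule orbitI[OF star_algebraD(5)[OF P b(1)]])
  then show "a s \<in> closure ((\<lambda>a. blinfun_apply a \<xi>) ` P)" by (simp add: orbit_def b(2))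
qed simp

lemma subspace_orbit:
  assumes P: "star_algebra P"
  shows "subspace (orbit P \<xi>)"
  unfolding orbit_def
proof (rule subspace_closure)
  show "subspace ((\<lambda>a. blinfun_apply a \<xi>) ` P)"
    unfolding subspace_def
  proof (intro conjI ballI allI)
    have "scalar_op 0 \<xi> \<in> (\<lambda>a. blinfun_apply a \<xi>) ` P" using star_algebraD(2)[OF P] by blast
    then show "0 \<in> (\<lambda>a. blinfun_apply a \<xi>) ` P" by simp
  next
    fix x y assume "x \<in> (\<lambda>a. blinfun_apply a \<xi>) ` P" "y \<in> (\<lambda>a. blinfun_apply a \<xi>) ` P"
    then obtain a b where "a \<in> P" "x = a \<xi>" "b \<in> P" "y = b \<xi>" by blast
    then show "x + y \<in> (\<lambda>a. blinfun_apply a \<xi>) ` P"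
      using star_algebraD(4)[OF P] by (intro image_eqI[of _ _ "a + b"]) (auto simp: blinfun.add_left)
  next
    fix x and r :: real assume "x \<in> (\<lambda>a. blinfun_apply a \<xi>) ` P"
    then obtain a where "a \<in> P" "x = a \<xi>" by blast
    then show "r *\<^sub>R x \<in> (\<lambda>a. blinfun_apply a \<xi>) ` P"
      using star_algebra_scaleR[OF P] by (intro image_eqI[of _ _ "r *\<^sub>R a"]) (auto simp: blinfun.scaleR_left)
  qed
qed

lemma orbit_ii:
  assumes "star_algebra P" "x \<in> orbit P \<xi>"
  shows "\<i> *\<^sub>C x \<in> orbit P \<xi>"
  using orbit_invariant[OF assms(1) star_algebraD(2)[OF assms(1)] assms(2), of \<i>] by simp

lemma orbit_base: "star_algebra P \<Longrightarrow> \<xi> \<in> orbit P \<xi>"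
  using orbitI[of id_blinfun P \<xi>] star_algebraD(6) by auto

text \<open>The orbit is invariant under each \<open>a\<close> in \<open>P\<close> and under its
  adjoint, so the projection commutes with \<open>a\<close>; taking for \<open>a\<close> the scalar
  \<open>\<i>\<close> gives complex linearity.\<close>

lemma orth_proj_orbit_commutant:
  assumes P: "star_algebra P"
  shows "orth_proj (orbit P \<xi>) \<in> commutant P"
proof -
  note S = closed_orbit subspace_orbit[OF P]
  have comm: "orth_proj (orbit P \<xi>) (a x) = a (orth_proj (orbit P \<xi>) x)" if a: "a \<in> P" for a x
    by (rule orth_proj_commute[OF S inner_adj[OF star_algebraD(1)[OF P a]]])
      (use a P in \<open>auto intro: orbit_invariant star_algebraD(3)\<close>)
  then have "orth_proj (orbit P \<xi>) (\<i> *\<^sub>C x) = \<i> *\<^sub>C orth_proj (orbit P \<xi>) x" for x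
    using star_algebraD(2)[OF P, of \<i>] by fastforce
  then show ?thesis using comm by (intro commutantI) (auto simp: bounded_ops_iff)
qed

text \<open>The operator matrix \<open>Q\<close> of the projection onto the closure of \<open>{(a\<xi>, a\<eta>)}\<close> has entries
  in the commutant of \<open>P\<close>.  The hypotheses say \<open>Q (\<eta>, \<xi>) = 0\<close> and
  \<open>\<langle>q \<xi>, \<eta>\<rangle> = \<langle>q \<eta>, \<xi>\<rangle>\<close> for \<open>q\<close> in the commutant, whence
  \<open>\<langle>Q\<^sub>1\<^sub>1 \<eta>, \<eta>\<rangle> = - \<langle>Q\<^sub>1\<^sub>2 \<xi>, \<eta>\<rangle> = - \<langle>Q\<^sub>1\<^sub>2 \<eta>, \<xi>\<rangle> = - \<langle>(1 - Q\<^sub>1\<^sub>1) \<xi>, \<xi>\<rangle>\<close> and both ends vanish.\<close>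

lemma self_adjoint_orbits_dense:
  fixes \<xi> \<eta> :: "'a::complex_hilbert_space"
  assumes P: "star_algebra P" and \<eta>: "\<eta> \<in> orbit P \<xi>"
    and a: "\<And>a. a \<in> P \<Longrightarrow> adj a = a \<Longrightarrow> inner \<eta> (a \<xi>) = 0"
    and b: "\<And>b. b \<in> commutant P \<Longrightarrow> adj b = b \<Longrightarrow> inner \<eta> (\<i> *\<^sub>C b \<xi>) = 0"
  shows "\<eta> = 0"
proof -
  define G0 where "G0 = (\<lambda>a. (blinfun_apply a \<xi>, blinfun_apply a \<eta>)) ` P"
  define G where "G = closure G0"
  have "subspace G0"
    unfolding subspace_def
  proof (intro conjI ballI allI)
    have "(scalar_op 0 \<xi>, scalar_op 0 \<eta>) \<in> G0" unfolding G0_def using star_algebraD(2)[OF P] by blast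
    then show "0 \<in> G0" by (simp add: zero_prod_def)
  next
    fix x y assume "x \<in> G0" "y \<in> G0"
    then obtain a b where "a \<in> P" "x = (a \<xi>, a \<eta>)" "b \<in> P" "y = (b \<xi>, b \<eta>)" unfolding G0_def by blast
    then show "x + y \<in> G0" unfolding G0_def
      using star_algebraD(4)[OF P] by (intro image_eqI[of _ _ "a + b"]) (auto simp: blinfun.add_left)
  next
    fix x and r :: real assume "x \<in> G0"
    then obtain a where "a \<in> P" "x = (a \<xi>, a \<eta>)" unfolding G0_def by blast
    then show "r *\<^sub>R x \<in> G0" unfolding G0_def
      using star_algebra_scaleR[OF P] by (intro image_eqI[of _ _ "r *\<^sub>R a"]) (auto simp: blinfun.scaleR_left)
  qed
  then have G: "closed G" "subspace G" by (auto simp: G_def intro: subspace_closure)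
  define Q where "Q = orth_proj G"
  have inv: "(c (fst p), c (snd p)) \<in> G" if c: "c \<in> P" and p: "p \<in> G" for c p
  proof -
    have "(\<lambda>p. (blinfun_apply c (fst p), blinfun_apply c (snd p))) ` closure G0 \<subseteq> G"
    proof (rule image_closure_subset)
      show "(\<lambda>p. (blinfun_apply c (fst p), blinfun_apply c (snd p))) ` G0 \<subseteq> G"
      proof clarsimp
        fix x y assume "(x, y) \<in> G0"
        then obtain d where "d \<in> P" "x = d \<xi>" "y = d \<eta>" unfolding G0_def by blast
        then have "(c x, c y) \<in> G0" unfolding G0_def
          using star_algebraD(5)[OF P c] by (intro image_eqI[of _ _ "c o\<^sub>L d"]) auto
        then show "(c x, c y) \<in> G" unfolding G_def by (rule subsetD[OF closure_subset])
      qed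
    qed (auto intro!: continuous_intros simp: G)
    then show ?thesis using p unfolding G_def by blast
  qed
  have Qc: "Q (c x, c y) = (c (fst (Q (x, y))), c (snd (Q (x, y))))" if c: "c \<in> P" for c x y
  proof -
    have "inner (c (fst p), c (snd p)) q = inner p (adj c (fst q), adj c (snd q))" for p q
      using inner_adj[OF star_algebraD(1)[OF P c]] by (cases p; cases q) simp
    from orth_proj_commute[OF G this inv[OF c] inv[OF star_algebraD(3)[OF P c]], of "(x, y)"]
    show ?thesis by (simp add: Q_def)
  qed
  have "(id_blinfun \<xi>, id_blinfun \<eta>) \<in> G0" unfolding G0_def using star_algebraD(6)[OF P] by blast
  then have "(\<xi>, \<eta>) \<in> G" unfolding G_def using subsetD[OF closure_subset[of G0]] by simp
  then have Q1: "Q (\<xi>, \<eta>) = (\<xi>, \<eta>)" unfolding Q_def by (rule orth_proj_fixes[OF G])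
  \<comment> \<open>Write \<open>c = A + \<i> B\<close> with self-adjoint \<open>A\<close>,
    \<open>B\<close>. Against \<open>(\<eta>, \<xi>)\<close> the two \<open>A\<close> terms agree
    and vanish by the first orthogonality hypothesis, while the two \<open>B\<close> terms
    cancel.\<close>
  have Q2: "Q (\<eta>, \<xi>) = 0"
    unfolding Q_def
  proof (rule orth_proj_eq_0[OF G])
    fix g assume "g \<in> G"
    then show "inner (\<eta>, \<xi>) g = 0"
      unfolding G_def
    proof (rule inner_closure_eq_0)
      fix g assume "g \<in> G0"
      then obtain c where c: "c \<in> P" "g = (c \<xi>, c \<eta>)" unfolding G0_def by blast
      obtain A B where AB: "A \<in> P" "B \<in> P" "adj A = A" "adj B = B" "c = A + (scalar_op \<i> o\<^sub>L B)"
        using star_algebra_decompose[OF P c(1)] .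
      have bo: "A \<in> bounded_ops" "B \<in> bounded_ops" using AB star_algebraD(1)[OF P] by auto
      have "inner \<xi> (A \<eta>) = inner \<eta> (A \<xi>)"
        using inner_adj[OF bo(1), of \<xi> \<eta>] AB(3) by (simp add: inner_commute)
      moreover have "inner \<xi> (\<i> *\<^sub>C B \<eta>) = - inner \<eta> (\<i> *\<^sub>C B \<xi>)"
      proof -
        have "inner \<xi> (\<i> *\<^sub>C B \<eta>) = - inner (\<i> *\<^sub>C \<xi>) (B \<eta>)" by (simp add: inner_ii_left)
        also have "\<dots> = - inner (B (\<i> *\<^sub>C \<xi>)) \<eta>" using inner_adj[OF bo(2), of "\<i> *\<^sub>C \<xi>" \<eta>] AB(4) by simp
        finally show ?thesis by (simp add: bounded_opsD[OF bo(2)] inner_commute)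
      qed
      ultimately show "inner (\<eta>, \<xi>) g = 0"
        using a[OF AB(1,3)] by (simp add: c(2) AB(5) blinfun.add_left inner_add_right)
    qed
  qed
  \<comment> \<open>This is the matrix entry \<open>Q\<^sub>1\<^sub>2\<close>.\<close>
  define q where "q = Blinfun (\<lambda>x. fst (Q (0, x)))"
  have "bounded_linear (\<lambda>x. fst (Q (0, x)))"
    by (intro bounded_linear_fst_comp bounded_linear_compose[OF blinfun.bounded_linear_right]
        bounded_linear_Pair bounded_linear_zero bounded_linear_ident)
  then have q: "q x = fst (Q (0, x))" for x by (simp add: q_def bounded_linear_Blinfun_apply)
  have qc: "q (c x) = c (q x)" if "c \<in> P" for c x
    using Qc[OF that, of 0 x] by (simp add: q)
  have "q (\<i> *\<^sub>C x) = \<i> *\<^sub>C q x" for x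
    using qc[OF star_algebraD(2)[OF P], of \<i> x] by simp
  then have qP: "q \<in> commutant P" using qc by (intro commutantI) (auto simp: bounded_ops_iff)
  have P': "star_algebra (commutant P)"
    by (rule star_algebra_commutant) (use P in \<open>auto intro: star_algebraD\<close>)
  have qsym: "inner (q \<xi>) \<eta> = inner (q \<eta>) \<xi>"
  proof -
    obtain A B where AB: "A \<in> commutant P" "B \<in> commutant P" "adj A = A" "adj B = B" "q = A + (scalar_op \<i> o\<^sub>L B)"
      using star_algebra_decompose[OF P' qP] .
    have bo: "A \<in> bounded_ops" "B \<in> bounded_ops" using AB star_algebraD(1)[OF P'] by auto
    have "inner (A \<xi>) \<eta> = inner (A \<eta>) \<xi>"
      using inner_adj[OF bo(1), of \<xi> \<eta>] AB(3) by (simp add: inner_commute)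
    moreover have "inner (\<i> *\<^sub>C B \<xi>) \<eta> = 0" using b[OF AB(2,4)] by (simp add: inner_commute)
    moreover have "inner (\<i> *\<^sub>C B \<eta>) \<xi> = - inner \<eta> (\<i> *\<^sub>C B \<xi>)"
      using inner_adj[OF bo(2), of \<eta> "\<i> *\<^sub>C \<xi>"] AB(4) by (simp add: inner_ii_left bounded_opsD[OF bo(2)])
    ultimately show ?thesis using b[OF AB(2,4)] by (simp add: AB(5) blinfun.add_left inner_add_left)
  qed
  have split: "fst (Q (x, y)) = fst (Q (x, 0)) + q y" for x y
    using blinfun.add_right[of Q "(x, 0)" "(0, y)"] by (simp add: q)
  have n: "inner (fst (Q (x, 0))) x = (norm (Q (x, 0)))\<^sup>2" for x
    using inner_orth_proj_self[OF G, of "(x, 0)"] by (simp add: Q_def inner_prod_def)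
  have "(norm (Q (\<eta>, 0)))\<^sup>2 = - inner (q \<xi>) \<eta>"
  proof -
    have "fst (Q (\<eta>, 0)) + q \<xi> = 0" using split[of \<eta> \<xi>] Q2 by simp
    then have "inner (fst (Q (\<eta>, 0))) \<eta> + inner (q \<xi>) \<eta> = 0" by (metis inner_add_left inner_zero_left)
    then show ?thesis by (simp add: n)
  qed
  also have "\<dots> = - inner (\<xi> - fst (Q (\<xi>, 0))) \<xi>"
  proof -
    have "q \<eta> = \<xi> - fst (Q (\<xi>, 0))" using split[of \<xi> \<eta>] Q1 by (metis add_diff_cancel_left' fst_conv)
    then show ?thesis using qsym by simp
  qed
  also have "\<dots> = - (norm ((\<xi>, 0) - Q (\<xi>, 0)))\<^sup>2"
    using norm_diff_orth_proj[OF G, of "(\<xi>, 0)"] n[of \<xi>]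
    by (simp add: Q_def[symmetric] inner_diff_left power2_norm_eq_inner norm_Pair)
  finally have sum0: "(norm (Q (\<eta>, 0)))\<^sup>2 + (norm ((\<xi>, 0) - Q (\<xi>, 0)))\<^sup>2 = 0" by simp
  then have Q\<eta>: "Q (\<eta>, 0) = 0" and Q\<xi>: "Q (\<xi>, 0) = (\<xi>, 0)"
    using sum_power2_eq_zero_iff[of "norm (Q (\<eta>, 0))" "norm ((\<xi>, 0) - Q (\<xi>, 0))"] by auto
  \<comment> \<open>\<open>Q\<close> fixes \<open>(\<xi>, 0)\<close> and commutes with the diagonal
    action of \<open>P\<close>, so it fixes \<open>(z, 0)\<close> for all \<open>z\<close> in the
    orbit. For \<open>z = \<eta>\<close> this meets \<open>Q (\<eta>, 0) = 0\<close>.\<close>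
  have "orbit P \<xi> \<subseteq> {z. Q (z, 0) = (z, 0)}"
    unfolding orbit_def
  proof (rule closure_minimal)
    show "closed {z. Q (z, 0) = (z, 0)}" by (intro closed_Collect_eq continuous_intros)
    show "(\<lambda>a. blinfun_apply a \<xi>) ` P \<subseteq> {z. Q (z, 0) = (z, 0)}"
      using Qc[of _ \<xi> 0] by (auto simp: Q\<xi>)
  qed
  then show ?thesis using \<eta> Q\<eta> by (auto simp: zero_prod_def)
qed

text \<open>Inside the complex space \<open>N\<close>, the real subspaces \<open>K\<close> and \<open>\<i>L\<close> are orthogonal complements
  of each other, and both \<open>K\<close> and \<open>L\<close> span \<open>N\<close>.\<close>

definition standard_pair :: "'a::complex_hilbert_space set \<Rightarrow> 'a set \<Rightarrow> 'a set \<Rightarrow> bool" where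
  "standard_pair N K L \<longleftrightarrow> closed N \<and> subspace N \<and> (\<forall>n\<in>N. \<i> *\<^sub>C n \<in> N)
     \<and> closed K \<and> subspace K \<and> K \<subseteq> N \<and> closed L \<and> subspace L \<and> L \<subseteq> N
     \<and> (\<forall>k\<in>K. \<forall>l\<in>L. inner k (\<i> *\<^sub>C l) = 0)
     \<and> (\<forall>\<eta>\<in>N. (\<forall>k\<in>K. inner \<eta> k = 0) \<longrightarrow> (\<forall>l\<in>L. inner \<eta> (\<i> *\<^sub>C l) = 0) \<longrightarrow> \<eta> = 0)
     \<and> (\<forall>\<eta>\<in>N. (\<forall>k\<in>K. inner \<eta> k = 0 \<and> inner \<eta> (\<i> *\<^sub>C k) = 0) \<longrightarrow> \<eta> = 0)
     \<and> (\<forall>\<eta>\<in>N. (\<forall>l\<in>L. inner \<eta> l = 0 \<and> inner \<eta> (\<i> *\<^sub>C l) = 0) \<longrightarrow> \<eta> = 0)"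

context
  fixes N K L :: "'a::complex_hilbert_space set"
  assumes pair: "standard_pair N K L"
begin

lemma standard_pairD:
  "closed N" "subspace N" "n \<in> N \<Longrightarrow> \<i> *\<^sub>C n \<in> N"
  "closed K" "subspace K" "K \<subseteq> N" "closed L" "subspace L" "L \<subseteq> N"
  "k \<in> K \<Longrightarrow> l \<in> L \<Longrightarrow> inner k (\<i> *\<^sub>C l) = 0"
  "\<eta> \<in> N \<Longrightarrow> (\<And>k. k \<in> K \<Longrightarrow> inner \<eta> k = 0) \<Longrightarrow> (\<And>l. l \<in> L \<Longrightarrow> inner \<eta> (\<i> *\<^sub>C l) = 0) \<Longrightarrow> \<eta> = 0"
  "\<eta> \<in> N \<Longrightarrow> (\<And>k. k \<in> K \<Longrightarrow> inner \<eta> k = 0) \<Longrightarrow> (\<And>k. k \<in> K \<Longrightarrow> inner \<eta> (\<i> *\<^sub>C k) = 0) \<Longrightarrow> \<eta> = 0"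
  "\<eta> \<in> N \<Longrightarrow> (\<And>l. l \<in> L \<Longrightarrow> inner \<eta> l = 0) \<Longrightarrow> (\<And>l. l \<in> L \<Longrightarrow> inner \<eta> (\<i> *\<^sub>C l) = 0) \<Longrightarrow> \<eta> = 0"
  using pair unfolding standard_pair_def by simp_all

lemma standard_pair_perp_K:
  assumes \<eta>: "\<eta> \<in> N" "\<And>k. k \<in> K \<Longrightarrow> inner \<eta> k = 0"
  shows "\<exists>l\<in>L. \<eta> = \<i> *\<^sub>C l"
proof -
  \<comment> \<open>This is \<open>\<i>L\<close>, since \<open>L\<close> is closed under negation;
    as a preimage it is visibly closed.\<close>
  define V where "V = {x. \<i> *\<^sub>C x \<in> L}"
  have VL: "\<exists>l\<in>L. v = \<i> *\<^sub>C l" if "v \<in> V" for v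
    using that subspace_neg[OF standard_pairD(8)] unfolding V_def
    by (intro bexI[of _ "- (\<i> *\<^sub>C v)"]) auto
  have LV: "\<i> *\<^sub>C l \<in> V" if "l \<in> L" for l
    using that subspace_neg[OF standard_pairD(8)] by (simp add: V_def)
  have V: "closed V" "subspace V"
    using closed_vimage[OF standard_pairD(7), of "\<lambda>x. \<i> *\<^sub>C x"] standard_pairD(8)
    by (auto simp: V_def vimage_def subspace_def scaleC_add_right scaleC_scaleR_commute continuous_intros)
  define p where "p = orth_proj V \<eta>"
  have p: "p \<in> V" unfolding p_def by (rule orth_proj_in[OF V])
  then obtain l where l: "l \<in> L" "p = \<i> *\<^sub>C l" using VL by blast
  have "\<eta> - p = 0"
  proof (rule standard_pairD(11))
    show "\<eta> - p \<in> N" using \<eta>(1) l standard_pairD(2,3,9) by (auto intro!: subspace_diff)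
    show "inner (\<eta> - p) k = 0" if "k \<in> K" for k
      using \<eta>(2)[OF that] standard_pairD(10)[OF that l(1)]
      by (simp add: l(2) inner_diff_left inner_diff_right inner_commute[of _ k])
    show "inner (\<eta> - p) (\<i> *\<^sub>C l') = 0" if "l' \<in> L" for l'
      unfolding p_def by (rule orth_proj_perp[OF V LV[OF that]])
  qed
  then show ?thesis using l by auto
qed

lemma standard_pair_perp_iL:
  assumes \<eta>: "\<eta> \<in> N" "\<And>l. l \<in> L \<Longrightarrow> inner \<eta> (\<i> *\<^sub>C l) = 0"
  shows "\<eta> \<in> K"
proof -
  note K = standard_pairD(4,5)
  define p where "p = orth_proj K \<eta>"
  have p: "p \<in> K" unfolding p_def by (rule orth_proj_in[OF K])
  have "\<eta> - p = 0"
  proof (rule standard_pairD(11))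
    show "\<eta> - p \<in> N" using \<eta>(1) p standard_pairD(2,6) by (auto intro!: subspace_diff)
    show "inner (\<eta> - p) k = 0" if "k \<in> K" for k
      unfolding p_def by (rule orth_proj_perp[OF K that])
    show "inner (\<eta> - p) (\<i> *\<^sub>C l) = 0" if "l \<in> L" for l
      using \<eta>(2)[OF that] standard_pairD(10)[OF p that] by (simp add: inner_diff_left)
  qed
  then show ?thesis using p by simp
qed

text \<open>A vector in both \<open>K\<close> and \<open>\<i>K\<close> is orthogonal to
  \<open>\<i>L\<close> and to \<open>L\<close>, and \<open>L\<close> is total in
  \<open>N\<close>.\<close>

lemma standard_pair_totally_real:
  assumes k: "k \<in> K" "k' \<in> K" "k = \<i> *\<^sub>C k'"
  shows "k = 0"
proof (rule standard_pairD(13))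
  show "k \<in> N" using k standard_pairD(6) by blast
  show "inner k (\<i> *\<^sub>C l) = 0" if "l \<in> L" for l by (rule standard_pairD(10)[OF k(1) that])
  show "inner k l = 0" if "l \<in> L" for l
    using standard_pairD(10)[OF k(2) that] by (simp add: k(3) inner_ii_left)
qed

end

text \<open>Let \<open>f\<close> be the projection onto the orbit of the commutant. Since
  \<open>f \<xi> = \<xi>\<close>, these are the vectors \<open>x \<xi>\<close> with \<open>x\<close>
  self-adjoint in the corner \<open>f M f\<close>. Asking \<open>a \<xi>\<close> to lie in both
  orbits expresses the cut down without passing to a smaller Hilbert space.\<close>

definition corner_vectors ::
    "('a::complex_hilbert_space \<Rightarrow>\<^sub>L 'a) set \<Rightarrow> 'a \<Rightarrow> 'a set" where
  "corner_vectors M \<xi> =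
     {blinfun_apply a \<xi> | a. a \<in> M \<and> adj a = a \<and> blinfun_apply a \<xi> \<in> orbit M \<xi> \<inter> orbit (commutant M) \<xi>}"

lemma subspace_corner_vectors:
  assumes M: "star_algebra M"
  shows "subspace (corner_vectors M \<xi>)"
proof -
  have M': "star_algebra (commutant M)"
    by (rule star_algebra_commutant) (use M in \<open>auto intro: star_algebraD\<close>)
  define N where "N = orbit M \<xi> \<inter> orbit (commutant M) \<xi>"
  have N: "subspace N" unfolding N_def by (intro subspace_inter subspace_orbit M M')
  have mem: "x \<in> corner_vectors M \<xi> \<longleftrightarrow> (\<exists>a\<in>M. adj a = a \<and> x = a \<xi> \<and> x \<in> N)" for x
    unfolding corner_vectors_def N_def by blast
  show ?thesis
    unfolding subspace_def
  proof (intro conjI ballI allI)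
    show "0 \<in> corner_vectors M \<xi>" unfolding mem
      using star_algebraD(2)[OF M] subspace_0[OF N] by (intro bexI[of _ "scalar_op 0"]) (auto simp: adj_scalar_op)
  next
    fix x y assume "x \<in> corner_vectors M \<xi>" "y \<in> corner_vectors M \<xi>"
    then obtain a b where "a \<in> M" "adj a = a" "x = a \<xi>" "x \<in> N" "b \<in> M" "adj b = b" "y = b \<xi>" "y \<in> N"
      unfolding mem by blast
    then show "x + y \<in> corner_vectors M \<xi>" unfolding mem
      using star_algebraD(1,4)[OF M] subspace_add[OF N]
      by (intro bexI[of _ "a + b"]) (auto simp: blinfun.add_left adj_add)
  next
    fix x and r :: real assume "x \<in> corner_vectors M \<xi>"
    then obtain a where a: "a \<in> M" "adj a = a" "x = a \<xi>" "x \<in> N"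
      unfolding mem by blast
    have "adj (r *\<^sub>R a) = r *\<^sub>R a"
    proof (rule adj_unique)
      show "r *\<^sub>R a \<in> bounded_ops" using star_algebra_scaleR[OF M a(1)] star_algebraD(1)[OF M] by blast
      show "inner ((r *\<^sub>R a) u) v = inner u ((r *\<^sub>R a) v)" for u v
        using inner_adj[OF star_algebraD(1)[OF M a(1)], of u v] a(2) by (simp add: blinfun.scaleR_left)
    qed
    then show "r *\<^sub>R x \<in> corner_vectors M \<xi>" unfolding mem
      using a star_algebra_scaleR[OF M a(1)] subspace_scale[OF N]
      by (intro bexI[of _ "r *\<^sub>R a"]) (auto simp: blinfun.scaleR_left)
  qed
qed

text \<open>The projection \<open>f\<close> belongs to \<open>M\<close> and fixes
  \<open>\<xi>\<close>, so \<open>f (a \<xi>)\<close> is the value at \<open>\<xi>\<close> of the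
  self-adjoint element \<open>f a f\<close> of \<open>M\<close>.\<close>

lemma corner_vectors_compress:
  assumes M: "von_neumann_algebra M" and a: "a \<in> M" "adj a = a"
  shows "orth_proj (orbit (commutant M) \<xi>) (a \<xi>) \<in> corner_vectors M \<xi>"
proof -
  define f where "f = orth_proj (orbit (commutant M) \<xi>)"
  have sM: "star_algebra M" "star_algebra (commutant M)"
    using M von_neumann_algebra_commutant von_neumann_algebra_star by blast+
  note S = closed_orbit subspace_orbit[OF sM(2)]
  have fM: "f \<in> M"
    using orth_proj_orbit_commutant[OF sM(2), of \<xi>] M unfolding f_def von_neumann_algebra_def by simp
  then have fb: "f \<in> bounded_ops" using star_algebraD(1)[OF sM(1)] by blast
  have fsym: "inner (f x) y = inner x (f y)" for x y
    unfolding f_def by (rule orth_proj_sym[OF S])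
  have f\<xi>: "f \<xi> = \<xi>" unfolding f_def by (rule orth_proj_fixes[OF S orbit_base[OF sM(2)]])
  have ab: "a \<in> bounded_ops" using a star_algebraD(1)[OF sM(1)] by blast
  let ?c = "f o\<^sub>L a o\<^sub>L f"
  have c: "?c \<in> M" by (intro star_algebraD(5)[OF sM(1)] fM a)
  moreover have "adj ?c = ?c"
    by (rule adj_unique) (use inner_adj[OF ab] a(2) fb ab in \<open>auto simp: fsym bounded_ops_closed\<close>)
  moreover have "?c \<xi> \<in> orbit M \<xi>" by (rule orbitI[OF c])
  moreover have "?c \<xi> \<in> orbit (commutant M) \<xi>" using orth_proj_in[OF S] by (simp add: f_def)
  moreover have "f (a \<xi>) = ?c \<xi>" by (simp add: f\<xi>)
  ultimately show ?thesis unfolding corner_vectors_def f_def[symmetric] by blast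
qed

text \<open>As \<open>f \<eta> = \<eta>\<close>, pairing with \<open>\<eta>\<close> does not
  distinguish \<open>a \<xi>\<close> from its compression, which is a corner vector. Orthogonality
  relations thus pass from the corner to all self-adjoint elements.\<close>

lemma perp_corner_vectors:
  assumes M: "von_neumann_algebra M" and \<eta>: "\<eta> \<in> orbit (commutant M) \<xi>"
    and a: "a \<in> M" "adj a = a"
  shows "(\<And>k. k \<in> corner_vectors M \<xi> \<Longrightarrow> inner \<eta> k = 0) \<Longrightarrow> inner \<eta> (a \<xi>) = 0"
    and "(\<And>k. k \<in> corner_vectors M \<xi> \<Longrightarrow> inner \<eta> (\<i> *\<^sub>C k) = 0) \<Longrightarrow> inner \<eta> (\<i> *\<^sub>C a \<xi>) = 0"
proof -
  let ?f = "orth_proj (orbit (commutant M) \<xi>)"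
  have sM: "star_algebra (commutant M)"
    using M von_neumann_algebra_commutant von_neumann_algebra_star by blast
  note S = closed_orbit subspace_orbit[OF sM, of \<xi>]
  have f\<eta>: "?f \<eta> = \<eta>" by (rule orth_proj_fixes[OF S \<eta>])
  have fb: "?f \<in> bounded_ops" using orth_proj_orbit_commutant[OF sM] commutant_bounded_ops by blast
  have move: "inner \<eta> x = inner \<eta> (?f x)" for x
    using orth_proj_sym[OF S, of \<eta> x] f\<eta> by simp
  note mem = corner_vectors_compress[OF M a, of \<xi>]
  show "inner \<eta> (a \<xi>) = 0" if "\<And>k. k \<in> corner_vectors M \<xi> \<Longrightarrow> inner \<eta> k = 0"
    using that[OF mem] move by simp
  show "inner \<eta> (\<i> *\<^sub>C a \<xi>) = 0" if "\<And>k. k \<in> corner_vectors M \<xi> \<Longrightarrow> inner \<eta> (\<i> *\<^sub>C k) = 0"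
    using that[OF mem] move[of "\<i> *\<^sub>C a \<xi>"] by (simp add: bounded_opsD[OF fb])
qed

lemma corner_vectors_total:
  assumes M: "von_neumann_algebra M" and \<eta>: "\<eta> \<in> orbit M \<xi> \<inter> orbit (commutant M) \<xi>"
    and perp: "\<And>k. k \<in> corner_vectors M \<xi> \<Longrightarrow> inner \<eta> k = 0"
      "\<And>k. k \<in> corner_vectors M \<xi> \<Longrightarrow> inner \<eta> (\<i> *\<^sub>C k) = 0"
  shows "\<eta> = 0"
proof -
  have sM: "star_algebra M" by (rule von_neumann_algebra_star[OF M])
  have "inner \<eta> \<eta> = 0"
  proof (rule inner_closure_eq_0)
    show "\<eta> \<in> closure ((\<lambda>a. blinfun_apply a \<xi>) ` M)" using \<eta> by (simp add: orbit_def)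
    fix s assume "s \<in> (\<lambda>a. blinfun_apply a \<xi>) ` M"
    then obtain a where a: "a \<in> M" "s = a \<xi>" by blast
    obtain A B where AB: "A \<in> M" "B \<in> M" "adj A = A" "adj B = B" "a = A + (scalar_op \<i> o\<^sub>L B)"
      using star_algebra_decompose[OF sM a(1)] .
    have "inner \<eta> (A \<xi>) = 0" "inner \<eta> (\<i> *\<^sub>C B \<xi>) = 0"
      using perp_corner_vectors[OF M _ AB(1,3)] perp_corner_vectors[OF M _ AB(2,4)] \<eta> perp by blast+
    then show "inner \<eta> s = 0" by (simp add: a(2) AB(5) blinfun.add_left inner_add_right)
  qed
  then show ?thesis by simp
qed

text \<open>The joint density clause is \<open>self_adjoint_orbits_dense\<close>, moved to the
  corner by \<open>perp_corner_vectors\<close>; the clauses for the commutant arise by exchanging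
  the roles of \<open>M\<close> and its commutant.\<close>

lemma standard_pair_corner:
  assumes M: "von_neumann_algebra M"
  shows "standard_pair (orbit M \<xi> \<inter> orbit (commutant M) \<xi>)
    (closure (corner_vectors M \<xi>)) (closure (corner_vectors (commutant M) \<xi>))"
proof -
  let ?M' = "commutant M"
  let ?N = "orbit M \<xi> \<inter> orbit ?M' \<xi>"
  let ?K = "corner_vectors M \<xi>" and ?L = "corner_vectors ?M' \<xi>"
  have M': "von_neumann_algebra ?M'" by (rule von_neumann_algebra_commutant[OF M])
  have MM: "commutant ?M' = M" using M by (simp add: von_neumann_algebra_def)
  have s: "star_algebra M" "star_algebra ?M'" using M M' von_neumann_algebra_star by blast+
  have N: "closed ?N" "subspace ?N"
    by (auto intro: closed_orbit subspace_inter subspace_orbit s)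
  have KN: "?K \<subseteq> ?N" "?L \<subseteq> ?N" unfolding corner_vectors_def MM by blast+
  have sub: "k \<in> closure S" if "k \<in> S" for k and S :: "'a set" using that by (rule subsetD[OF closure_subset])
  have sympl: "inner k (\<i> *\<^sub>C l) = 0" if "k \<in> closure ?K" "l \<in> closure ?L" for k l
  proof -
    have gen: "inner (\<i> *\<^sub>C l) k = 0" if kl: "k \<in> ?K" "l \<in> ?L" for k l
    proof -
      obtain a b where a: "a \<in> M" "adj a = a" "k = a \<xi>" and b: "b \<in> ?M'" "adj b = b" "l = b \<xi>"
        using kl unfolding corner_vectors_def by blast
      have bo: "a \<in> bounded_ops" "b \<in> bounded_ops" using a b s star_algebraD(1) by blast+
      have sa: "inner (a x) y = inner x (a y)" "inner (b x) y = inner x (b y)" for x y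
        using inner_adj[OF bo(1)] inner_adj[OF bo(2)] a b by auto
      have "inner k (\<i> *\<^sub>C l) = inner \<xi> (\<i> *\<^sub>C a (b \<xi>))" by (simp add: a b sa bounded_opsD[OF bo(1)])
      also have "\<dots> = inner (b \<xi>) (\<i> *\<^sub>C a \<xi>)"
        using commutantD[OF b(1) a(1)] by (simp add: sa bounded_opsD[OF bo(2)])
      also have "\<dots> = - inner k (\<i> *\<^sub>C l)" by (simp add: a b inner_ii_left inner_commute[of "a \<xi>"])
      finally show ?thesis by (simp add: inner_commute)
    qed
    have "inner k (\<i> *\<^sub>C l) = 0" if "k \<in> closure ?K" "l \<in> ?L" for k l
      using inner_closure_eq_0[OF that(1) gen[OF _ that(2)]] by (simp add: inner_commute)
    then have "inner (\<i> *\<^sub>C k) l = 0" if "l \<in> ?L" for l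
      using \<open>k \<in> closure ?K\<close> that by (simp add: inner_ii_left)
    then have "inner (\<i> *\<^sub>C k) l = 0" using inner_closure_eq_0[OF \<open>l \<in> closure ?L\<close>] by blast
    then show ?thesis by (simp add: inner_ii_left)
  qed
  show ?thesis
    unfolding standard_pair_def
  proof (intro conjI ballI impI)
    show "\<i> *\<^sub>C n \<in> ?N" if "n \<in> ?N" for n
      using that orbit_ii[OF s(1)] orbit_ii[OF s(2)] by blast
    show "closure ?K \<subseteq> ?N" "closure ?L \<subseteq> ?N" by (rule closure_minimal[OF KN(1) N(1)], rule closure_minimal[OF KN(2) N(1)])
  next
    fix \<eta> assume \<eta>: "\<eta> \<in> ?N" "\<forall>k\<in>closure ?K. inner \<eta> k = 0" "\<forall>l\<in>closure ?L. inner \<eta> (\<i> *\<^sub>C l) = 0"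
    show "\<eta> = 0"
    proof (rule self_adjoint_orbits_dense[OF s(1)])
      show "\<eta> \<in> orbit M \<xi>" using \<eta> by blast
      show "inner \<eta> (a \<xi>) = 0" if "a \<in> M" "adj a = a" for a
        using perp_corner_vectors(1)[OF M _ that] \<eta> sub by blast
      show "inner \<eta> (\<i> *\<^sub>C b \<xi>) = 0" if "b \<in> ?M'" "adj b = b" for b
        using perp_corner_vectors(2)[OF M' _ that, unfolded MM] \<eta> sub by blast
    qed
  next
    fix \<eta> assume "\<eta> \<in> ?N" "\<forall>k\<in>closure ?K. inner \<eta> k = 0 \<and> inner \<eta> (\<i> *\<^sub>C k) = 0"
    then show "\<eta> = 0" using corner_vectors_total[OF M] sub by blast
  next
    fix \<eta> assume "\<eta> \<in> ?N" "\<forall>l\<in>closure ?L. inner \<eta> l = 0 \<and> inner \<eta> (\<i> *\<^sub>C l) = 0"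
    then show "\<eta> = 0" using corner_vectors_total[OF M', unfolded MM] sub by blast
  next
    show "subspace (closure ?K)" "subspace (closure ?L)"
      by (intro subspace_closure subspace_corner_vectors s)+
  qed (use N sympl in auto)
qed


text \<open>The vector \<open>\<zeta>\<close> is regarded as the conjugate-linear operator \<open>Z\<close> with
  \<open>\<langle>Z x, y\<rangle> = \<langle>\<zeta>, x \<otimes> y\<rangle>\<close>.  The hypotheses give \<open>Z K\<^sub>1 \<subseteq> \<i>L\<^sub>2\<close> and \<open>Z\<^sup>* L\<^sub>2 \<subseteq> K\<^sub>1\<close>, so that
  \<open>C = Z\<^sup>* Z\<close> maps \<open>K\<^sub>1\<close> into \<open>\<i>K\<^sub>1\<close>.  As \<open>C\<close> is the positive square root of \<open>C\<^sup>2\<close>, which preserves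
  \<open>K\<^sub>1\<close>, it also maps \<open>K\<^sub>1\<close> into \<open>K\<^sub>1\<close>, and \<open>K\<^sub>1 \<inter> \<i>K\<^sub>1 = 0\<close>.\<close>

lemma standard_pairs_tensor_dense:
  fixes t :: "'a::complex_hilbert_space \<Rightarrow> 'b::complex_hilbert_space \<Rightarrow> 'c::complex_hilbert_space"
  assumes t: "hilbert_tensor t" and p1: "standard_pair N1 K1 L1" and p2: "standard_pair N2 K2 L2"
    and \<zeta>: "\<zeta> \<in> closure (span {t x y | x y. x \<in> N1 \<and> y \<in> N2})"
    and K: "\<And>k1 k2. k1 \<in> K1 \<Longrightarrow> k2 \<in> K2 \<Longrightarrow> inner \<zeta> (t k1 k2) = 0"
    and L: "\<And>l1 l2. l1 \<in> L1 \<Longrightarrow> l2 \<in> L2 \<Longrightarrow> inner \<zeta> (\<i> *\<^sub>C t l1 l2) = 0"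
  shows "\<zeta> = 0"
proof -
  have "bounded_bilinear (\<lambda>x y. inner \<zeta> (t x y))"
  proof
    show "\<exists>C. \<forall>x y. norm (inner \<zeta> (t x y)) \<le> norm x * norm y * C"
      using Cauchy_Schwarz_ineq2[of \<zeta>]
      by (intro exI[of _ "norm \<zeta>"]) (metis norm_tensor[OF t] mult.commute real_norm_def)
  qed (auto simp: tensor_add_left[OF t] tensor_add_right[OF t] inner_add_right
      bounded_bilinear.scaleR_left[OF bounded_bilinear_tensor[OF t]]
      bounded_bilinear.scaleR_right[OF bounded_bilinear_tensor[OF t]])
  then obtain Z :: "'a \<Rightarrow>\<^sub>L 'b" where Z: "\<And>x y. inner (Z x) y = inner \<zeta> (t x y)"
    using bounded_bilinear_representation by blast
  obtain Z' :: "'b \<Rightarrow>\<^sub>L 'a" where Z': "\<And>x y. inner (Z x) y = inner x (Z' y)"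
    using ex_real_adjoint by blast
  have Z'': "inner (Z' y) x = inner \<zeta> (t x y)" for x y using Z Z' by (metis inner_commute)
  have Z'ii: "Z' (\<i> *\<^sub>C y) = - (\<i> *\<^sub>C Z' y)" for y
  proof -
    have "inner (Z' (\<i> *\<^sub>C y)) x = inner (- (\<i> *\<^sub>C Z' y)) x" for x
      by (simp add: Z'' inner_ii_left tensor_scaleC_left[OF t] tensor_scaleC_right[OF t])
    then show ?thesis using vector_eq_rdot by blast
  qed
  \<comment> \<open>A tensor with one leg orthogonal to \<open>N1\<close> or \<open>N2\<close> is
    orthogonal to \<open>\<zeta>\<close>. Hence \<open>Z\<close> takes its values in
    \<open>N2\<close> and its adjoint in \<open>N1\<close>.\<close>
  have perp: "inner \<zeta> (t x y) = 0"
    if "(\<forall>n\<in>N1. cinner x n = 0) \<or> (\<forall>n\<in>N2. cinner y n = 0)" for x y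
  proof -
    have "{t u v | u v. u \<in> N1 \<and> v \<in> N2} \<subseteq> {z. inner (t x y) z = 0}"
      using that by (auto simp: inner_eq_Re_cinner cinner_tensor[OF t])
    then have "span {t u v | u v. u \<in> N1 \<and> v \<in> N2} \<subseteq> {z. inner (t x y) z = 0}"
      by (rule span_minimal) (auto simp: subspace_def inner_add_right)
    then have "inner (t x y) \<zeta> = 0" using inner_closure_eq_0[OF \<zeta>] by blast
    then show ?thesis by (simp add: inner_commute)
  qed
  have cinner0: "cinner y n = 0" if "\<And>s. s \<in> N \<Longrightarrow> inner y s = 0" "n \<in> N" "\<i> *\<^sub>C n \<in> N" for n y N
    using that(1)[OF that(2)] that(1)[OF that(3)]
    by (simp add: cinner_eq_Complex complex_eq_iff)
  have ZN: "Z x \<in> N2" for x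
  proof (rule in_closed_subspace_if_perp[OF standard_pairD(1,2)[OF p2]])
    fix y assume "\<And>s. s \<in> N2 \<Longrightarrow> inner y s = 0"
    then have "cinner y n = 0" if "n \<in> N2" for n
      using cinner0[of N2 y n] that standard_pairD(3)[OF p2 that] by blast
    then show "inner (Z x) y = 0" unfolding Z by (intro perp) blast
  qed
  have Z'N: "Z' y \<in> N1" for y
  proof (rule in_closed_subspace_if_perp[OF standard_pairD(1,2)[OF p1]])
    fix x assume "\<And>s. s \<in> N1 \<Longrightarrow> inner x s = 0"
    then have "cinner x n = 0" if "n \<in> N1" for n
      using cinner0[of N1 x n] that standard_pairD(3)[OF p1 that] by blast
    then show "inner (Z' y) x = 0" unfolding Z'' by (intro perp) blast
  qed
  have Z'L: "Z' l \<in> K1" if l: "l \<in> L2" for l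
  proof (rule standard_pair_perp_iL[OF p1 Z'N])
    show "inner (Z' l) (\<i> *\<^sub>C l1) = 0" if "l1 \<in> L1" for l1
      using L[OF that l] by (simp add: Z'' tensor_scaleC_left[OF t])
  qed
  define C where "C = Z' o\<^sub>L Z"
  have Csym: "inner (C x) y = inner x (C y)" and Cpos: "inner (C x) x = (norm (Z x))\<^sup>2" for x y
    using Z' by (simp_all add: C_def power2_norm_eq_inner) (metis inner_commute)+
  have C: "sym_pos C" unfolding sym_pos_def using Csym Cpos by simp
  have CK: "\<exists>k'\<in>K1. C k = \<i> *\<^sub>C k'" if k: "k \<in> K1" for k
  proof -
    obtain l where l: "l \<in> L2" "Z k = \<i> *\<^sub>C l"
      using standard_pair_perp_K[OF p2 ZN[of k]] K[OF k] by (auto simp: Z)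
    have "- Z' l \<in> K1" using Z'L[OF l(1)] standard_pairD(5)[OF p1] by (simp add: subspace_neg)
    moreover have "C k = \<i> *\<^sub>C (- Z' l)" by (simp add: C_def l Z'ii)
    ultimately show ?thesis by blast
  qed
  have Cii: "C (\<i> *\<^sub>C x) = \<i> *\<^sub>C C x" for x
  proof -
    have "Z (\<i> *\<^sub>C x) = - (\<i> *\<^sub>C Z x)" for x
    proof -
      have "inner (Z (\<i> *\<^sub>C x)) y = inner (- (\<i> *\<^sub>C Z x)) y" for y
        by (simp add: Z inner_ii_left tensor_scaleC_left[OF t] tensor_scaleC_right[OF t])
      then show ?thesis using vector_eq_rdot by blast
    qed
    then show ?thesis by (simp add: C_def blinfun.minus_right Z'ii)
  qed
  have CCK: "C (C k) \<in> K1" if k: "k \<in> K1" for k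
  proof -
    obtain k' where k': "k' \<in> K1" "C k = \<i> *\<^sub>C k'" using CK[OF k] by blast
    obtain k'' where "k'' \<in> K1" "C k' = \<i> *\<^sub>C k''" using CK[OF k'(1)] by blast
    then show ?thesis using k' standard_pairD(5)[OF p1] by (simp add: Cii subspace_neg)
  qed
  have CK0: "C k = 0" if k: "k \<in> K1" for k
  proof -
    have "C k \<in> K1"
      by (rule sym_pos_invariant_if_square_invariant[OF C standard_pairD(4,5)[OF p1] CCK k])
    then show ?thesis using CK[OF k] standard_pair_totally_real[OF p1] by blast
  qed
  \<comment> \<open>\<open>C\<close> is symmetric and complex linear, so its vanishing on
    \<open>K1\<close> makes its range orthogonal to \<open>K1\<close> and \<open>\<i>K1\<close>. The
    range lies in \<open>N1\<close>, where only 0 has this property.\<close>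
  have Z0: "Z n = 0" if n: "n \<in> N1" for n
  proof -
    have "C n = 0"
    proof (rule standard_pairD(12)[OF p1])
      show "C n \<in> N1" by (simp add: C_def Z'N)
      show "inner (C n) k = 0" "inner (C n) (\<i> *\<^sub>C k) = 0" if "k \<in> K1" for k
        using CK0[OF that] by (simp_all add: Csym Cii)
    qed
    then show ?thesis using Cpos[of n] by simp
  qed
  have "inner \<zeta> \<zeta> = 0"
  proof (rule inner_closure_eq_0[OF \<zeta>])
    fix s assume "s \<in> span {t x y | x y. x \<in> N1 \<and> y \<in> N2}"
    moreover have "span {t x y | x y. x \<in> N1 \<and> y \<in> N2} \<subseteq> {z. inner \<zeta> z = 0}"
      using Z0 by (intro span_minimal) (auto simp: subspace_def inner_add_right Z[symmetric])
    ultimately show "inner \<zeta> s = 0" by blast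
  qed
  then show ?thesis by simp
qed

text \<open>The product \<open>S A\<close> is self-adjoint, so
  \<open>\<langle>S \<xi>, A \<xi>\<rangle>\<close> is real.\<close>

lemma self_adjoint_commuting_inner_ii:
  fixes S A :: "'a::complex_hilbert_space \<Rightarrow>\<^sub>L 'a"
  assumes "\<And>x y. inner (S x) y = inner x (S y)" "\<And>x y. inner (A x) y = inner x (A y)"
    and "A \<in> bounded_ops" "S \<in> bounded_ops" "\<And>x. S (A x) = A (S x)"
  shows "inner (S \<xi>) (\<i> *\<^sub>C A \<xi>) = 0"
proof -
  have "inner (S \<xi>) (\<i> *\<^sub>C A \<xi>) = inner (A (S \<xi>)) (\<i> *\<^sub>C \<xi>)"
    by (simp add: assms(2) bounded_opsD[OF assms(3)])
  also have "\<dots> = inner (A \<xi>) (\<i> *\<^sub>C S \<xi>)"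
    by (simp add: assms(5)[symmetric] assms(1) bounded_opsD[OF assms(4)])
  also have "\<dots> = - inner (S \<xi>) (\<i> *\<^sub>C A \<xi>)" by (simp add: inner_commute[of "A \<xi>"] inner_ii_left)
  finally show ?thesis by simp
qed

lemma tensor_closure_perp:
  assumes t: "hilbert_tensor t" and x: "x \<in> closure A" and y: "y \<in> closure B"
    and *: "\<And>x y. x \<in> A \<Longrightarrow> y \<in> B \<Longrightarrow> inner w (t x y) = 0"
  shows "inner w (t x y) = 0"
proof -
  note tb = bounded_bilinear_tensor[OF t]
  have left: "inner w (t x y) = 0" if "y \<in> B" for y
  proof -
    have "closed {x. inner w (t x y) = 0}"
      by (intro closed_Collect_eq continuous_intros
          bounded_linear.continuous_on[OF bounded_bilinear.bounded_linear_left[OF tb]])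
    then have "closure A \<subseteq> {x. inner w (t x y) = 0}" using *[OF _ that] by (intro closure_minimal) auto
    then show ?thesis using x by blast
  qed
  have "closed {y. inner w (t x y) = 0}"
    by (intro closed_Collect_eq continuous_intros
        bounded_linear.continuous_on[OF bounded_bilinear.bounded_linear_right[OF tb]])
  then have "closure B \<subseteq> {y. inner w (t x y) = 0}" using left by (intro closure_minimal) auto
  then show ?thesis using y by blast
qed

text \<open>The compression \<open>u\<close> of \<open>S \<xi>\<close> lands in the closed real span
  of \<open>L1 \<otimes> L2\<close>, while the compression \<open>v\<close> of
  \<open>T \<xi>\<close> is orthogonal to \<open>\<i>\<close> times that span. The density lemma for
  pairs is what locates \<open>u\<close>; for \<open>v\<close> orthogonality is enough.\<close>

lemma commuting_tensor_commutants_real: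
  fixes t :: "'a::complex_hilbert_space \<Rightarrow> 'b::complex_hilbert_space \<Rightarrow> 'c::complex_hilbert_space"
    and S T :: "'c \<Rightarrow>\<^sub>L 'c"
  assumes t: "hilbert_tensor t" and M1: "von_neumann_algebra M1" and M2: "von_neumann_algebra M2"
    and S: "S \<in> commutant (elem_tensors t M1 M2)" "adj S = S"
    and T: "T \<in> commutant (elem_tensors t (commutant M1) (commutant M2))" "adj T = T"
  shows "inner (S (t \<xi>1 \<xi>2)) (\<i> *\<^sub>C T (t \<xi>1 \<xi>2)) = 0"
proof -
  let ?\<xi> = "t \<xi>1 \<xi>2"
  have M': "von_neumann_algebra (commutant M1)" "von_neumann_algebra (commutant M2)"
    using M1 M2 by (auto intro: von_neumann_algebra_commutant)
  have s: "star_algebra M1" "star_algebra M2" "star_algebra (commutant M1)" "star_algebra (commutant M2)"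
    using M1 M2 M' by (auto intro: von_neumann_algebra_star)
  have MM: "commutant (commutant M1) = M1" "commutant (commutant M2) = M2"
    using M1 M2 by (auto simp: von_neumann_algebra_def)
  have bo: "S \<in> bounded_ops" "T \<in> bounded_ops" using S T commutant_bounded_ops by blast+
  have sym: "inner (S x) y = inner x (S y)" "inner (T x) y = inner x (T y)" for x y
    using inner_adj[OF bo(1)] inner_adj[OF bo(2)] S T by auto
  define E1 E2 F1 F2 where E: "E1 = orbit M1 \<xi>1" "E2 = orbit M2 \<xi>2"
    "F1 = orbit (commutant M1) \<xi>1" "F2 = orbit (commutant M2) \<xi>2"
  define N1 N2 where N: "N1 = E1 \<inter> F1" "N2 = E2 \<inter> F2"
  define K1 L1 K2 L2 where KL: "K1 = corner_vectors M1 \<xi>1" "L1 = corner_vectors (commutant M1) \<xi>1"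
    "K2 = corner_vectors M2 \<xi>2" "L2 = corner_vectors (commutant M2) \<xi>2"
  have p1: "standard_pair N1 (closure K1) (closure L1)" and p2: "standard_pair N2 (closure K2) (closure L2)"
    unfolding N E KL by (rule standard_pair_corner[OF M1], rule standard_pair_corner[OF M2])
  have cs: "closed E1" "subspace E1" "closed E2" "subspace E2" "closed F1" "subspace F1" "closed F2" "subspace F2"
    unfolding E using s by (auto intro: closed_orbit subspace_orbit)
  let ?e1 = "orth_proj E1" and ?e2 = "orth_proj E2" and ?f1 = "orth_proj F1" and ?f2 = "orth_proj F2"
  have ef: "?e1 \<in> commutant M1" "?e2 \<in> commutant M2" "?f1 \<in> M1" "?f2 \<in> M2"
    using orth_proj_orbit_commutant[OF s(1)] orth_proj_orbit_commutant[OF s(2)]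
      orth_proj_orbit_commutant[OF s(3)] orth_proj_orbit_commutant[OF s(4)]
    unfolding E MM by auto
  have efb: "?e1 \<in> bounded_ops" "?e2 \<in> bounded_ops" "?f1 \<in> bounded_ops" "?f2 \<in> bounded_ops"
    using ef s star_algebraD(1) by blast+
  have adj_ef: "adj ?e1 = ?e1" "adj ?e2 = ?e2" "adj ?f1 = ?f1" "adj ?f2 = ?f2"
    using efb cs by (auto intro!: adj_unique orth_proj_sym)
  have comm1: "?e1 (?f1 x) = ?f1 (?e1 x)" for x using commutantD[OF ef(1,3)] .
  have comm2: "?e2 (?f2 x) = ?f2 (?e2 x)" for x using commutantD[OF ef(2,4)] .
  define e f where "e = op_tensor t ?e1 ?e2" and "f = op_tensor t ?f1 ?f2"
  have et: "e (t x y) = t (?e1 x) (?e2 y)" and ft: "f (t x y) = t (?f1 x) (?f2 y)" for x y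
    unfolding e_def f_def by (simp_all add: op_tensor_apply[OF t] efb)
  have efsym: "inner (e x) y = inner x (e y)" "inner (f x) y = inner x (f y)" for x y
    unfolding e_def f_def
    using inner_adj[OF op_tensor_bounded_ops[OF t efb(1,2)]] inner_adj[OF op_tensor_bounded_ops[OF t efb(3,4)]]
    by (simp_all add: adj_op_tensor[OF t] efb adj_ef)
  have "e o\<^sub>L f = f o\<^sub>L e"
    by (rule tensor_blinfun_eqI[OF t]) (simp add: et ft comm1 comm2)
  then have efcomm: "e (f x) = f (e x)" for x by (metis blinfun_apply_blinfun_compose)
  have "f o\<^sub>L f = f" "e o\<^sub>L e = e"
    by (rule tensor_blinfun_eqI[OF t], simp add: et ft orth_proj_idem cs)+
  then have idem: "f (f x) = f x" "e (e x) = e x" for x by (metis blinfun_apply_blinfun_compose)+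
  have Sf: "S (f x) = f (S x)" for x
    by (rule commutantD[OF S(1)]) (use ef in \<open>auto simp: elem_tensors_def f_def\<close>)
  have Te: "T (e x) = e (T x)" for x
    by (rule commutantD[OF T(1)]) (use ef in \<open>auto simp: elem_tensors_def e_def\<close>)
  have "\<xi>1 \<in> E1" "\<xi>1 \<in> F1" "\<xi>2 \<in> E2" "\<xi>2 \<in> F2" unfolding E using s orbit_base by auto
  then have ef\<xi>: "e ?\<xi> = ?\<xi>" "f ?\<xi> = ?\<xi>" by (simp_all add: et ft orth_proj_fixes cs)
  define p where "p x = e (f x)" for x
  have psym: "inner (p x) y = inner x (p y)" for x y
    unfolding p_def using efsym efcomm by metis
  have pp: "p (p x) = p x" for x unfolding p_def by (metis efcomm idem)
  have pii: "p (\<i> *\<^sub>C x) = \<i> *\<^sub>C p x" for x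
    unfolding p_def e_def f_def using op_tensor_bounded_ops[OF t] efb by (simp add: bounded_opsD)
  have fS: "f (S ?\<xi>) = S ?\<xi>" using Sf[of ?\<xi>] ef\<xi> by simp
  have eT: "e (T ?\<xi>) = T ?\<xi>" using Te[of ?\<xi>] ef\<xi> by simp
  have eii: "e (\<i> *\<^sub>C x) = \<i> *\<^sub>C e x" for x
    unfolding e_def by (rule bounded_opsD[OF op_tensor_bounded_ops[OF t efb(1,2)]])
  \<comment> \<open>\<open>S\<close> commutes with \<open>f\<close>, an elementary tensor over
    \<open>M1\<close> and \<open>M2\<close>; \<open>T\<close> commutes with \<open>e\<close>, one
    over the commutants. Both projections fix the vector, so \<open>f\<close> fixes its image under
    \<open>S\<close> and \<open>e\<close> its image under \<open>T\<close>, and compressing the two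
    images by \<open>p = e f\<close> keeps their inner product.\<close>
  have reduce: "inner (S ?\<xi>) (\<i> *\<^sub>C T ?\<xi>) = inner (p (S ?\<xi>)) (\<i> *\<^sub>C p (T ?\<xi>))"
  proof -
    have "inner (p (S ?\<xi>)) (\<i> *\<^sub>C p (T ?\<xi>)) = inner (p (S ?\<xi>)) (\<i> *\<^sub>C T ?\<xi>)"
      by (metis pii pp psym)
    also have "\<dots> = inner (e (S ?\<xi>)) (\<i> *\<^sub>C T ?\<xi>)" by (simp add: p_def fS)
    also have "\<dots> = inner (S ?\<xi>) (\<i> *\<^sub>C T ?\<xi>)" by (simp add: efsym eii eT)
    finally show ?thesis by simp
  qed
  define NN where "NN = closure (span {t x y | x y. x \<in> N1 \<and> y \<in> N2})"
  have NN: "closed NN" "subspace NN" by (auto simp: NN_def intro: subspace_closure subspace_span)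
  have tNN: "t x y \<in> NN" if "x \<in> N1" "y \<in> N2" for x y
    unfolding NN_def by (rule subsetD[OF closure_subset], rule span_base) (use that in blast)
  have pNN: "p z \<in> NN" for z
  proof -
    have "z \<in> {z. p z \<in> NN}"
    proof (rule tensor_induct[OF t])
      show "closed {z. p z \<in> NN}"
        using closed_vimage[OF NN(1), of p] unfolding p_def by (simp add: vimage_def continuous_intros)
      show "subspace {z. p z \<in> NN}"
        using NN(2) by (auto simp: p_def subspace_def blinfun.bilinear_simps)
      show "t x y \<in> {z. p z \<in> NN}" for x y
      proof -
        have "?e1 (?f1 x) \<in> N1" unfolding N
          using orth_proj_in[OF cs(1,2), of "?f1 x"] orth_proj_in[OF cs(5,6), of "?e1 x"] comm1[of x] by simp
        moreover have "?e2 (?f2 y) \<in> N2" unfolding N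
          using orth_proj_in[OF cs(3,4), of "?f2 y"] orth_proj_in[OF cs(7,8), of "?e2 y"] comm2[of y] by simp
        ultimately show ?thesis using tNN by (simp add: p_def et ft)
      qed
    qed
    then show ?thesis by simp
  qed
  have pN: "p (t x y) = t x y" if "x \<in> N1" "y \<in> N2" for x y
    using that unfolding N by (simp add: p_def et ft orth_proj_fixes cs)
  have KN: "K1 \<subseteq> N1" "K2 \<subseteq> N2" "L1 \<subseteq> N1" "L2 \<subseteq> N2"
    using standard_pairD(6,9)[OF p1] standard_pairD(6,9)[OF p2] closure_subset by blast+
  have elem: "inner (p (R ?\<xi>)) (\<i> *\<^sub>C t k1 k2) = 0"
    if R: "R \<in> commutant (elem_tensors t P1 P2)" "\<And>x y. inner (R x) y = inner x (R y)" "R \<in> bounded_ops"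
      and P: "star_algebra P1" "star_algebra P2"
      and k: "k1 \<in> corner_vectors P1 \<xi>1" "k2 \<in> corner_vectors P2 \<xi>2" "k1 \<in> N1" "k2 \<in> N2"
    for R k1 k2 P1 P2
  proof -
    obtain a1 a2 where a: "a1 \<in> P1" "adj a1 = a1" "k1 = a1 \<xi>1" "a2 \<in> P2" "adj a2 = a2" "k2 = a2 \<xi>2"
      using k(1,2) unfolding corner_vectors_def by blast
    have ab: "a1 \<in> bounded_ops" "a2 \<in> bounded_ops" using a P star_algebraD(1) by blast+
    let ?A = "op_tensor t a1 a2"
    have A: "?A \<in> bounded_ops" by (rule op_tensor_bounded_ops[OF t ab])
    have "inner (p (R ?\<xi>)) (\<i> *\<^sub>C t k1 k2) = inner (R ?\<xi>) (\<i> *\<^sub>C t k1 k2)"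
      using pN[OF k(3,4)] by (simp add: psym pii)
    also have "\<dots> = inner (R ?\<xi>) (\<i> *\<^sub>C ?A ?\<xi>)" by (simp add: op_tensor_apply[OF t ab] a)
    also have "\<dots> = 0"
    proof (rule self_adjoint_commuting_inner_ii[OF R(2) _ A R(3)])
      show "inner (?A x) y = inner x (?A y)" for x y
        using inner_adj[OF A, of x y] adj_op_tensor[OF t ab] a by simp
      show "R (?A x) = ?A (R x)" for x
        by (rule commutantD[OF R(1)]) (use a in \<open>auto simp: elem_tensors_def\<close>)
    qed
    finally show ?thesis .
  qed
  define u v where "u = p (S ?\<xi>)" and "v = p (T ?\<xi>)"
  have uK: "inner u (\<i> *\<^sub>C t k1 k2) = 0" if "k1 \<in> closure K1" "k2 \<in> closure K2" for k1 k2
  proof -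
    have "inner (\<i> *\<^sub>C u) (t k1 k2) = 0"
    proof (rule tensor_closure_perp[OF t that])
      fix x y assume xy: "x \<in> K1" "y \<in> K2"
      then have "inner u (\<i> *\<^sub>C t x y) = 0"
        unfolding u_def using KN by (intro elem[OF S(1) sym(1) bo(1) s(1,2)]) (auto simp: KL)
      then show "inner (\<i> *\<^sub>C u) (t x y) = 0" by (simp add: inner_ii_left)
    qed
    then show ?thesis by (simp add: inner_ii_left)
  qed
  have vL: "inner (\<i> *\<^sub>C v) (t l1 l2) = 0" if "l1 \<in> closure L1" "l2 \<in> closure L2" for l1 l2
  proof (rule tensor_closure_perp[OF t that])
    fix x y assume xy: "x \<in> L1" "y \<in> L2"
    then have "inner v (\<i> *\<^sub>C t x y) = 0"
      unfolding v_def using KN by (intro elem[OF T(1) sym(2) bo(2) s(3,4)]) (auto simp: KL)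
    then show "inner (\<i> *\<^sub>C v) (t x y) = 0" by (simp add: inner_ii_left)
  qed
  define D where "D = {t x y | x y. x \<in> closure L1 \<and> y \<in> closure L2}"
  define LL where "LL = closure (span D)"
  have LL: "closed LL" "subspace LL" by (auto simp: LL_def intro: subspace_closure subspace_span)
  have tLL: "t x y \<in> LL" if "x \<in> closure L1" "y \<in> closure L2" for x y
    unfolding LL_def by (rule subsetD[OF closure_subset], rule span_base) (use that in \<open>auto simp: D_def\<close>)
  have LLperp: "inner w z = 0"
    if w: "\<And>x y. x \<in> closure L1 \<Longrightarrow> y \<in> closure L2 \<Longrightarrow> inner w (t x y) = 0" and z: "z \<in> LL" for w z
  proof (rule inner_closure_eq_0[OF z[unfolded LL_def]])
    fix s assume "s \<in> span D"
    moreover have "span D \<subseteq> {z. inner w z = 0}"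
      using w by (intro span_minimal) (auto simp: subspace_def inner_add_right D_def)
    ultimately show "inner w s = 0" by blast
  qed
  have LLNN: "LL \<subseteq> NN"
  proof -
    have "D \<subseteq> NN" using tNN standard_pairD(9)[OF p1] standard_pairD(9)[OF p2] by (auto simp: D_def)
    then show ?thesis unfolding LL_def using NN by (intro closure_minimal span_minimal)
  qed
  have NNii: "\<i> *\<^sub>C z \<in> NN" if "z \<in> NN" for z
  proof -
    have "span {t x y | x y. x \<in> N1 \<and> y \<in> N2} \<subseteq> {z. \<i> *\<^sub>C z \<in> NN}"
    proof (rule span_minimal)
      show "subspace {z. \<i> *\<^sub>C z \<in> NN}"
        using NN(2) by (auto simp: subspace_def scaleC_add_right scaleC_scaleR_commute)
      show "{t x y | x y. x \<in> N1 \<and> y \<in> N2} \<subseteq> {z. \<i> *\<^sub>C z \<in> NN}"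
        using tNN standard_pairD(3)[OF p1] by (auto simp: tensor_scaleC_left[OF t, symmetric])
    qed
    then have "scalar_op \<i> z \<in> NN"
      using that NN(1) unfolding NN_def by (intro blinfun_closure_mapsto[OF that[unfolded NN_def]]) auto
    then show ?thesis by simp
  qed
  \<comment> \<open>The error \<open>u - u0\<close> is to vanish. After multiplication by
    \<open>\<i>\<close> it is orthogonal to \<open>K1 \<otimes> K2\<close>, since \<open>u\<close>
    and the span of \<open>L1 \<otimes> L2\<close> are both orthogonal to
    \<open>\<i>(K1 \<otimes> K2)\<close>, and to \<open>\<i>(L1 \<otimes> L2)\<close> by the choice
    of \<open>u0\<close>.\<close>
  define u0 where "u0 = orth_proj LL u"
  have u0: "u0 \<in> LL" unfolding u0_def by (rule orth_proj_in[OF LL])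
  have "\<i> *\<^sub>C (u - u0) = 0"
  proof (rule standard_pairs_tensor_dense[OF t p1 p2])
    show "\<i> *\<^sub>C (u - u0) \<in> closure (span {t x y | x y. x \<in> N1 \<and> y \<in> N2})"
      unfolding NN_def[symmetric] u_def
      by (intro NNii subspace_diff[OF NN(2)] pNN) (use u0 LLNN in blast)
  next
    fix k1 k2 assume k: "k1 \<in> closure K1" "k2 \<in> closure K2"
    have "inner (\<i> *\<^sub>C t k1 k2) u0 = 0"
    proof (rule LLperp[OF _ u0])
      fix l1 l2 assume l: "l1 \<in> closure L1" "l2 \<in> closure L2"
      have "Im (cinner k1 l1) = 0" "Im (cinner k2 l2) = 0"
        using standard_pairD(10)[OF p1 k(1) l(1)] standard_pairD(10)[OF p2 k(2) l(2)]
        by (simp_all add: inner_ii_right)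
      then show "inner (\<i> *\<^sub>C t k1 k2) (t l1 l2) = 0"
        by (simp add: inner_ii_left inner_tensor_ii[OF t])
    qed
    then show "inner (\<i> *\<^sub>C (u - u0)) (t k1 k2) = 0"
      using uK[OF k] by (simp add: inner_ii_left inner_diff_left inner_commute[of u0])
  next
    fix l1 l2 assume "l1 \<in> closure L1" "l2 \<in> closure L2"
    then show "inner (\<i> *\<^sub>C (u - u0)) (\<i> *\<^sub>C t l1 l2) = 0"
      unfolding inner_ii_ii u0_def by (intro orth_proj_perp[OF LL] tLL)
  qed
  then have "\<i> *\<^sub>C \<i> *\<^sub>C (u - u0) = 0" by simp
  then have "u \<in> LL" using u0 by simp
  from LLperp[OF vL this] have "inner u (\<i> *\<^sub>C v) = 0" by (simp add: inner_commute)
  then show ?thesis by (simp add: reduce u_def v_def)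
qed

text \<open>Elementary tensors do not form a linear space, so polarization is applied twice: in the
  first leg with the second held fixed, then in the second.\<close>

lemma tensor_operator_eq_0_if_diagonal_0:
  fixes t :: "'a::complex_hilbert_space \<Rightarrow> 'b::complex_hilbert_space \<Rightarrow> 'c::complex_hilbert_space"
    and D :: "'c \<Rightarrow>\<^sub>L 'c"
  assumes t: "hilbert_tensor t" and D: "D \<in> bounded_ops"
    and diag: "\<And>x y. cinner (D (t x y)) (t x y) = 0"
  shows "D = 0"
proof (rule tensor_blinfun_eqI[OF t])
  fix x y
  note sesqui = tensor_add_left[OF t] tensor_add_right[OF t] tensor_scaleC_left[OF t]
    tensor_scaleC_right[OF t] blinfun.add_right bounded_opsD[OF D] cinner_add_left cinner_add_right
    cinner_scaleC_left cinner_scaleC_right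
  have 1: "cinner (D (t x y)) (t x' y) = 0" for x x' y
    by (rule cinner_polarization[where f = "\<lambda>x x'. cinner (D (t x y)) (t x' y)"])
      (simp_all only: sesqui diag)
  have "cinner (D (t x y)) (t x' y') = 0" for x' y'
    by (rule cinner_polarization[where f = "\<lambda>y y'. cinner (D (t x y)) (t x' y')"])
      (simp_all only: sesqui 1)
  then have "inner (D (t x y)) (t x' y') = 0" for x' y' by (simp add: inner_eq_Re_cinner)
  then show "D (t x y) = blinfun_apply 0 (t x y)" using tensor_perp_eq_0[OF t] by simp
qed

text \<open>With \<open>X\<close> and \<open>Y\<close> the elementary tensors over the algebras and
  over their commutants, the claim reads \<open>X' = Y''\<close>. From
  \<open>Y \<subseteq> X'\<close> follows \<open>Y'' \<subseteq> X''' = X'\<close>. The other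
  inclusion says that \<open>X'\<close> and \<open>Y'\<close> commute, which is checked on
  self-adjoint elements.\<close>

theorem commutant_vn_tensor:
  fixes t :: "'a::complex_hilbert_space \<Rightarrow> 'b::complex_hilbert_space \<Rightarrow> 'c::complex_hilbert_space"
  assumes t: "hilbert_tensor t" and M1: "von_neumann_algebra M1" and M2: "von_neumann_algebra M2"
  shows "commutant (vn_tensor t M1 M2) = vn_tensor t (commutant M1) (commutant M2)"
proof -
  let ?X = "elem_tensors t M1 M2" and ?Y = "elem_tensors t (commutant M1) (commutant M2)"
  have s: "star_algebra M1" "star_algebra M2" "star_algebra (commutant M1)" "star_algebra (commutant M2)"
    using M1 M2 by (auto intro: von_neumann_algebra_star von_neumann_algebra_commutant)
  have b: "M1 \<subseteq> bounded_ops" "M2 \<subseteq> bounded_ops" using s by (auto simp: star_algebra_def)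
  have X: "?X \<subseteq> bounded_ops" and Y: "?Y \<subseteq> bounded_ops"
    by (intro elem_tensors_bounded_ops[OF t] b commutant_bounded_ops)+
  have sX: "star_algebra (commutant ?X)" and sY: "star_algebra (commutant ?Y)"
    using s by (auto intro: star_algebra_commutant_elem_tensors[OF t])
  have YX: "?Y \<subseteq> commutant ?X"
  proof
    fix T assume "T \<in> ?Y"
    then obtain a' b' where T: "a' \<in> commutant M1" "b' \<in> commutant M2" "T = op_tensor t a' b'"
      unfolding elem_tensors_def by blast
    have bo': "a' \<in> bounded_ops" "b' \<in> bounded_ops" using T commutant_bounded_ops by blast+
    show "T \<in> commutant ?X"
    proof (rule commutantI)
      show "T \<in> bounded_ops" unfolding T by (rule op_tensor_bounded_ops[OF t bo'])
      fix S z assume "S \<in> ?X"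
      then obtain c d where S: "c \<in> M1" "d \<in> M2" "S = op_tensor t c d" unfolding elem_tensors_def by blast
      have bo: "c \<in> bounded_ops" "d \<in> bounded_ops" using S b by blast+
      have "T o\<^sub>L S = S o\<^sub>L T"
        by (rule tensor_blinfun_eqI[OF t])
          (simp add: T S op_tensor_apply[OF t] bo bo' commutantD[OF T(1) S(1)] commutantD[OF T(2) S(2)])
      then show "T (S z) = S (T z)" by (metis blinfun_apply_blinfun_compose)
    qed
  qed
  have sa: "S (T z) = T (S z)"
    if S: "S \<in> commutant ?X" "adj S = S" and T: "T \<in> commutant ?Y" "adj T = T" for S T z
  proof -
    have bo: "S \<in> bounded_ops" "T \<in> bounded_ops" using S T commutant_bounded_ops by blast+
    define D where "D = (S o\<^sub>L T) - (T o\<^sub>L S)"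
    have D: "D \<in> bounded_ops"
      by (simp add: D_def bounded_ops_iff blinfun.diff_left bounded_opsD[OF bo(1)] bounded_opsD[OF bo(2)] scaleC_diff_right)
    have "D = 0"
    proof (rule tensor_operator_eq_0_if_diagonal_0[OF t D])
      fix x y
      let ?\<xi> = "t x y"
      have "cinner (D ?\<xi>) ?\<xi> = cinner (T ?\<xi>) (S ?\<xi>) - cinner (S ?\<xi>) (T ?\<xi>)"
        by (simp add: D_def blinfun.diff_left cinner_diff_left cinner_self_adjoint[OF bo(1) S(2)]
            cinner_self_adjoint[OF bo(2) T(2)])
      also have "\<dots> = 0"
        using commuting_tensor_commutants_real[OF t M1 M2 S T, of x y] cinner_commute[of "T ?\<xi>" "S ?\<xi>"]
        by (simp add: complex_eq_iff inner_ii_right)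
      finally show "cinner (D ?\<xi>) ?\<xi> = 0" .
    qed
    then have "D z = 0" by simp
    then show ?thesis by (simp add: D_def blinfun.diff_left)
  qed
  have "commutant ?X \<subseteq> commutant (commutant ?Y)"
  proof
    fix S assume S: "S \<in> commutant ?X"
    show "S \<in> commutant (commutant ?Y)"
    proof (rule commutantI)
      show "S \<in> bounded_ops" using S commutant_bounded_ops by blast
      fix T z assume T: "T \<in> commutant ?Y"
      obtain A B where A: "A \<in> commutant ?X" "B \<in> commutant ?X" "adj A = A" "adj B = B"
          "S = A + (scalar_op \<i> o\<^sub>L B)"
        using star_algebra_decompose[OF sX S] .
      obtain C E where C: "C \<in> commutant ?Y" "E \<in> commutant ?Y" "adj C = C" "adj E = E"
          "T = C + (scalar_op \<i> o\<^sub>L E)"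
        using star_algebra_decompose[OF sY T] .
      have bo: "A \<in> bounded_ops" "B \<in> bounded_ops" "C \<in> bounded_ops" "E \<in> bounded_ops"
        using A C commutant_bounded_ops by blast+
      note com = sa[OF A(1,3) C(1,3)] sa[OF A(1,3) C(2,4)] sa[OF A(2,4) C(1,3)] sa[OF A(2,4) C(2,4)]
      show "S (T z) = T (S z)"
        by (simp add: A(5) C(5) blinfun.add_left blinfun.add_right com bounded_opsD[OF bo(1)]
            bounded_opsD[OF bo(2)] bounded_opsD[OF bo(3)] bounded_opsD[OF bo(4)] scaleC_add_right add_ac)
    qed
  qed
  moreover have "commutant (commutant ?Y) \<subseteq> commutant ?X"
    using commutant_antimono[OF commutant_antimono[OF commutant_antimono[OF YX]]] commutant_triple[OF X]
      commutant_antimono[OF commutant_antimono[OF YX]]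
    by auto
  ultimately show ?thesis by (simp add: vn_tensor_elem_tensors commutant_triple[OF X] commutant_triple[OF Y])
qed


section \<open>Automorphisms\<close>

lemma star_automorphismD:
  assumes "star_automorphism P \<theta>"
  shows "bij_betw \<theta> P P" "x \<in> P \<Longrightarrow> \<theta> x \<in> P" "inj_on \<theta> P"
    "x \<in> P \<Longrightarrow> y \<in> P \<Longrightarrow> \<theta> (x + y) = \<theta> x + \<theta> y"
    "x \<in> P \<Longrightarrow> \<theta> (scalar_op c o\<^sub>L x) = scalar_op c o\<^sub>L \<theta> x"
    "x \<in> P \<Longrightarrow> y \<in> P \<Longrightarrow> \<theta> (x o\<^sub>L y) = \<theta> x o\<^sub>L \<theta> y"
    "x \<in> P \<Longrightarrow> \<theta> (adj x) = adj (\<theta> x)"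
  using assms unfolding star_automorphism_def by (auto simp: bij_betw_def)

text \<open>Normality uses that the order is preserved in both directions.\<close>

lemma star_automorphism_inv_into:
  assumes P: "star_algebra P" and \<theta>: "star_automorphism P \<theta>"
  shows "star_automorphism P (inv_into P \<theta>)"
proof -
  note D = star_automorphismD[OF \<theta>]
  let ?i = "inv_into P \<theta>"
  have i: "?i x \<in> P" "\<theta> (?i x) = x" if "x \<in> P" for x
    using that D(1) by (auto simp: bij_betw_def inv_into_into f_inv_into_f)
  have eq: "?i x = y" if "y \<in> P" "\<theta> y = x" for x y
    using that D(3) by (auto intro: inv_into_f_eq)
  show ?thesis
    unfolding star_automorphism_def
  proof (intro conjI ballI allI)
    show "bij_betw ?i P P" by (rule bij_betw_inv_into[OF D(1)])
  next
    fix x y assume xy: "x \<in> P" "y \<in> P"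
    show "?i (x + y) = ?i x + ?i y" "?i (x o\<^sub>L y) = ?i x o\<^sub>L ?i y"
      by (rule eq; simp add: D(4,6) i star_algebraD(4,5)[OF P] xy)+
  next
    fix c x assume x: "x \<in> P"
    show "?i (scalar_op c o\<^sub>L x) = scalar_op c o\<^sub>L ?i x"
      by (rule eq) (simp_all add: D(5) i star_algebraD(2,5)[OF P] x)
  next
    fix x assume x: "x \<in> P"
    show "?i (adj x) = adj (?i x)"
      by (rule eq) (simp_all add: D(7) i star_algebraD(3)[OF P] x)
  qed
qed

text \<open>The algebra is presented as a commutant so that the positive root of
  \<open>y - x\<close> is available inside it.\<close>

lemma star_automorphism_op_le:
  assumes \<theta>: "star_automorphism (commutant S) \<theta>" and P: "star_algebra (commutant S)"
    and x: "x \<in> commutant S" and y: "y \<in> commutant S" and le: "op_le x y"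
  shows "op_le (\<theta> x) (\<theta> y)"
proof -
  let ?P = "commutant S"
  note D = star_automorphismD[OF \<theta>]
  note b = star_algebraD(1)[OF P]
  have d: "y - x \<in> ?P" using P y x by (rule star_algebra_diff)
  have "sym_pos (y - x)" using le op_le_iff_sym_pos[OF b[OF x] b[OF y]] by blast
  then obtain s where s: "s \<in> ?P" "sym_pos s" "s o\<^sub>L s = y - x"
    using ex_sqrt_in_commutant[OF d] by blast
  have "adj (\<theta> s) = \<theta> s" using D(7)[OF s(1)] sym_posD_adj[OF s(2) b[OF s(1)]] by simp
  then have sa: "inner (\<theta> s u) v = inner u (\<theta> s v)" for u v
    using inner_adj[OF b[OF D(2)[OF s(1)]]] by simp
  have "\<theta> y = \<theta> (y - x) + \<theta> x" using D(4)[OF d x] by simp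
  then have "\<theta> y - \<theta> x = \<theta> s o\<^sub>L \<theta> s" using D(6)[OF s(1) s(1)] s(3) by simp
  moreover have "sym_pos (\<theta> s o\<^sub>L \<theta> s)"
    unfolding sym_pos_def using sa by (simp, metis inner_ge_zero)
  ultimately show ?thesis using op_le_iff_sym_pos[OF b[OF D(2)[OF x]] b[OF D(2)[OF y]]] by simp
qed

lemma star_automorphism_normal:
  assumes \<theta>: "star_automorphism (commutant S) \<theta>" and P: "star_algebra (commutant S)"
  shows "normal_on (commutant S) \<theta>"
  unfolding normal_on_def
proof (intro allI impI, elim conjE)
  let ?P = "commutant S"
  note D = star_automorphismD[OF \<theta>]
  fix F s assume F: "F \<subseteq> {x \<in> ?P. adj x = x}" and sup: "is_sup_in ?P F s"
  have sP: "s \<in> ?P" and ub: "\<And>f. f \<in> F \<Longrightarrow> op_le f s"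
    and least: "\<And>u. u \<in> ?P \<Longrightarrow> (\<And>f. f \<in> F \<Longrightarrow> op_le f u) \<Longrightarrow> op_le s u"
    using sup unfolding is_sup_in_def by blast+
  note mono = star_automorphism_op_le[OF \<theta> P]
  note inv_mono = star_automorphism_op_le[OF star_automorphism_inv_into[OF P \<theta>] P]
  have inv: "inv_into ?P \<theta> (\<theta> x) = x" if "x \<in> ?P" for x
    using inv_into_f_f[OF D(3) that] .
  show "is_sup_in ?P (\<theta> ` F) (\<theta> s)"
    unfolding is_sup_in_def
  proof (intro conjI ballI impI)
    show "\<theta> s \<in> ?P" by (rule D(2)[OF sP])
    show "op_le g (\<theta> s)" if "g \<in> \<theta> ` F" for g
      using that F ub mono[OF _ sP] by blast
    fix u assume u: "u \<in> ?P" "\<forall>f\<in>\<theta> ` F. op_le f u"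
    \<comment> \<open>An upper bound of the image is pulled back along the inverse automorphism,
      compared with \<open>s\<close>, and pushed forward again.\<close>
    obtain v where v: "v \<in> ?P" "u = \<theta> v" using u(1) D(1) by (auto simp: bij_betw_def)
    have "op_le f v" if f: "f \<in> F" for f
    proof -
      have fP: "f \<in> ?P" using f F by blast
      have "op_le (\<theta> f) (\<theta> v)" using f u(2) v(2) by blast
      from inv_mono[OF D(2)[OF fP] D(2)[OF v(1)] this] show ?thesis by (simp add: inv fP v)
    qed
    then have "op_le s v" by (rule least[OF v(1)])
    then show "op_le (\<theta> s) u" unfolding v(2) by (rule mono[OF sP v(1)])
  qed
qed

section \<open>Restriction of an automorphism to one tensor factor\<close>

lemma id_blinfun_compose_id: "id_blinfun o\<^sub>L id_blinfun = id_blinfun"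
  by (rule blinfun_eqI) simp

lemma adj_id_blinfun: "adj id_blinfun = id_blinfun"
  using adj_scalar_op[of 1] by (simp add: scalar_op_one)

text \<open>With \<open>C\<^sub>2 = M\<^sub>2'\<close>: an element commuting with \<open>1 \<otimes> M\<^sub>2'\<close> commutes with
  \<open>1 \<otimes> (B\<^sub>2 \<union> M\<^sub>2')\<close>, and \<open>B\<^sub>2 \<union> M\<^sub>2'\<close> is irreducible.\<close>

lemma left_leg_characterization:
  fixes t :: "'a::complex_hilbert_space \<Rightarrow> 'b::complex_hilbert_space \<Rightarrow> 'c::complex_hilbert_space"
  assumes t: "hilbert_tensor t" and B1: "star_algebra B1" and B2: "star_algebra B2"
    and irr: "commutant (B2 \<union> C2) \<subseteq> range scalar_op" and C2: "C2 \<subseteq> commutant B2"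
    and y0: "(y0::'b) \<noteq> 0" and z: "z \<in> commutant (elem_tensors t B1 B2)"
  shows "(\<forall>m\<in>C2. z o\<^sub>L op_tensor t id_blinfun m = op_tensor t id_blinfun m o\<^sub>L z)
    \<longleftrightarrow> (\<exists>a\<in>commutant B1. z = op_tensor t a id_blinfun)"
proof
  note id = bounded_ops_closed(1)
  note b1 = star_algebraD(1)[OF B1] and b2 = star_algebraD(1)[OF B2]
  assume comm: "\<forall>m\<in>C2. z o\<^sub>L op_tensor t id_blinfun m = op_tensor t id_blinfun m o\<^sub>L z"
  have zb: "z \<in> bounded_ops" using z commutant_bounded_ops by blast
  have "\<exists>w\<in>bounded_ops. z = op_tensor t w id_blinfun"
  proof (rule commuting_with_irreducible_right_leg[OF t zb _ irr _ y0])
    show "B2 \<union> C2 \<subseteq> bounded_ops" using b2 C2 commutant_bounded_ops by blast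
    fix b w assume "b \<in> B2 \<union> C2"
    then show "z (op_tensor t id_blinfun b w) = op_tensor t id_blinfun b (z w)"
    proof
      assume b: "b \<in> B2"
      show ?thesis
        by (rule commutantD[OF z]) (use b star_algebraD(6)[OF B1] in \<open>auto simp: elem_tensors_def\<close>)
    next
      assume "b \<in> C2"
      then show ?thesis using comm by (metis blinfun_apply_blinfun_compose)
    qed
  qed
  then obtain w where w: "w \<in> bounded_ops" "z = op_tensor t w id_blinfun" by blast
  have "w \<in> commutant B1"
  proof (rule commutantI[OF w(1)])
    fix b x assume b: "b \<in> B1"
    have "op_tensor t b id_blinfun \<in> elem_tensors t B1 B2"
      using b star_algebraD(6)[OF B2] by (auto simp: elem_tensors_def)
    then have "z o\<^sub>L op_tensor t b id_blinfun = op_tensor t b id_blinfun o\<^sub>L z"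
      using z by (simp add: commutant_def)
    then have "op_tensor t (w o\<^sub>L b) id_blinfun = op_tensor t (b o\<^sub>L w) id_blinfun"
      using op_tensor_compose[OF t w(1) id b1[OF b] id] op_tensor_compose[OF t b1[OF b] id w(1) id]
      by (simp add: w(2) id_blinfun_compose_id)
    then have "w o\<^sub>L b = b o\<^sub>L w"
      by (rule op_tensor_id_inject[OF t bounded_ops_closed(3)[OF w(1) b1[OF b]]
          bounded_ops_closed(3)[OF b1[OF b] w(1)] _ y0])
    then show "w (b x) = b (w x)" by (metis blinfun_apply_blinfun_compose)
  qed
  then show "\<exists>a\<in>commutant B1. z = op_tensor t a id_blinfun" using w by blast
next
  assume "\<exists>a\<in>commutant B1. z = op_tensor t a id_blinfun"
  then obtain a where a: "a \<in> commutant B1" "z = op_tensor t a id_blinfun" by blast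
  have ab: "a \<in> bounded_ops" using a commutant_bounded_ops by blast
  show "\<forall>m\<in>C2. z o\<^sub>L op_tensor t id_blinfun m = op_tensor t id_blinfun m o\<^sub>L z"
  proof
    fix m assume "m \<in> C2"
    then have "m \<in> bounded_ops" using C2 commutant_bounded_ops by blast
    then show "z o\<^sub>L op_tensor t id_blinfun m = op_tensor t id_blinfun m o\<^sub>L z"
      by (intro tensor_blinfun_eqI[OF t]) (simp add: a op_tensor_apply[OF t] ab bounded_ops_closed(1))
  qed
qed

text \<open>The nonzero vector \<open>y0\<close> makes \<open>a \<mapsto> a \<otimes> 1\<close>
  injective, so \<open>\<theta>1\<close> is determined by \<open>\<theta>\<close> and inherits its
  algebraic laws.\<close>

lemma ex_leg_automorphism:
  fixes t :: "'a::complex_hilbert_space \<Rightarrow> 'b::complex_hilbert_space \<Rightarrow> 'c::complex_hilbert_space"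
  assumes t: "hilbert_tensor t" and B1: "star_algebra B1" and B2: "star_algebra B2"
    and irr: "commutant (B2 \<union> C2) \<subseteq> range scalar_op"
    and C1: "C1 \<subseteq> commutant B1" and C2: "C2 \<subseteq> commutant B2"
    and \<theta>: "star_automorphism (commutant (elem_tensors t B1 B2)) \<theta>"
    and fix1: "\<And>m. m \<in> C1 \<Longrightarrow> \<theta> (op_tensor t m id_blinfun) = op_tensor t m id_blinfun"
    and fix2: "\<And>m. m \<in> C2 \<Longrightarrow> \<theta> (op_tensor t id_blinfun m) = op_tensor t id_blinfun m"
    and y0: "(y0::'b) \<noteq> 0"
  shows "\<exists>\<theta>1\<in>Aut_fixing C1 (commutant B1). \<forall>a\<in>commutant B1.
    \<theta> (op_tensor t a id_blinfun) = op_tensor t (\<theta>1 a) id_blinfun"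
proof -
  let ?P = "commutant (elem_tensors t B1 B2)" and ?A = "commutant B1"
  define \<iota> where "\<iota> a = op_tensor t a id_blinfun" for a
  note id = bounded_ops_closed(1)
  note D = star_automorphismD[OF \<theta>]
  have A: "star_algebra ?A" by (rule star_algebra_commutant) (use B1 in \<open>auto intro: star_algebraD\<close>)
  note Ab = star_algebraD(1)[OF A]
  have elem_P: "op_tensor t a b \<in> ?P" if "a \<in> ?A" "b \<in> commutant B2" for a b
  proof (rule commutantI)
    have ab: "a \<in> bounded_ops" "b \<in> bounded_ops" using that commutant_bounded_ops by blast+
    show "op_tensor t a b \<in> bounded_ops" by (rule op_tensor_bounded_ops[OF t ab])
    fix s z assume "s \<in> elem_tensors t B1 B2"
    then obtain c d where s: "c \<in> B1" "d \<in> B2" "s = op_tensor t c d" unfolding elem_tensors_def by blast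
    have cd: "c \<in> bounded_ops" "d \<in> bounded_ops" using s B1 B2 star_algebraD(1) by blast+
    have "op_tensor t a b o\<^sub>L s = s o\<^sub>L op_tensor t a b"
      by (rule tensor_blinfun_eqI[OF t])
        (simp add: s op_tensor_apply[OF t] ab cd commutantD[OF that(1) s(1)] commutantD[OF that(2) s(2)])
    then show "op_tensor t a b (s z) = s (op_tensor t a b z)" by (metis blinfun_apply_blinfun_compose)
  qed
  have id2: "id_blinfun \<in> commutant B2" by (rule commutantI) (auto simp: id)
  have \<iota>P: "\<iota> a \<in> ?P" if "a \<in> ?A" for a unfolding \<iota>_def by (rule elem_P[OF that id2])
  have C2P: "op_tensor t id_blinfun m \<in> ?P" if "m \<in> C2" for m
    by (rule elem_P) (use that C2 star_algebraD(6)[OF A] in auto)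
  have inj: "a = a'" if "\<iota> a = \<iota> a'" "a \<in> ?A" "a' \<in> ?A" for a a'
    using op_tensor_id_inject[OF t Ab[OF that(2)] Ab[OF that(3)] _ y0] that(1) by (simp add: \<iota>_def)
  note leg = left_leg_characterization[OF t B1 B2 irr C2 y0]
  have legI: "\<exists>a\<in>?A. z = \<iota> a"
    if "z \<in> ?P" "\<And>m. m \<in> C2 \<Longrightarrow> z o\<^sub>L op_tensor t id_blinfun m = op_tensor t id_blinfun m o\<^sub>L z" for z
    using leg[OF that(1)] that(2) unfolding \<iota>_def by blast
  have legD: "\<iota> a o\<^sub>L op_tensor t id_blinfun m = op_tensor t id_blinfun m o\<^sub>L \<iota> a"
    if "a \<in> ?A" "m \<in> C2" for a m
    using leg[OF \<iota>P[OF that(1)]] that unfolding \<iota>_def by blast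
  have "\<forall>a\<in>?A. \<exists>w. w \<in> ?A \<and> \<theta> (\<iota> a) = \<iota> w"
  proof
    fix a assume a: "a \<in> ?A"
    have "\<theta> (\<iota> a) o\<^sub>L op_tensor t id_blinfun m = op_tensor t id_blinfun m o\<^sub>L \<theta> (\<iota> a)" if m: "m \<in> C2" for m
      using D(6)[OF \<iota>P[OF a] C2P[OF m]] D(6)[OF C2P[OF m] \<iota>P[OF a]] legD[OF a m] fix2[OF m] by simp
    then show "\<exists>w. w \<in> ?A \<and> \<theta> (\<iota> a) = \<iota> w" using legI[OF D(2)[OF \<iota>P[OF a]]] by blast
  qed
  then obtain \<theta>1 where \<theta>1: "\<And>a. a \<in> ?A \<Longrightarrow> \<theta>1 a \<in> ?A" "\<And>a. a \<in> ?A \<Longrightarrow> \<theta> (\<iota> a) = \<iota> (\<theta>1 a)"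
    using bchoice[of ?A "\<lambda>a w. w \<in> ?A \<and> \<theta> (\<iota> a) = \<iota> w"] by blast
  have eqI: "\<theta>1 a = w" if "\<theta> (\<iota> a) = \<iota> w" "a \<in> ?A" "w \<in> ?A" for a w
    using that \<theta>1 by (intro inj) auto
  have \<iota>_add: "\<iota> (a + a') = \<iota> a + \<iota> a'" and \<iota>_scalar: "\<iota> (scalar_op c o\<^sub>L a) = scalar_op c o\<^sub>L \<iota> a"
    and \<iota>_comp: "\<iota> (a o\<^sub>L a') = \<iota> a o\<^sub>L \<iota> a'" and \<iota>_adj: "\<iota> (adj a) = adj (\<iota> a)"
    if "a \<in> ?A" "a' \<in> ?A" for a a' c
    using op_tensor_compose[OF t Ab[OF that(1)] id Ab[OF that(2)] id] Ab[OF that(1)] Ab[OF that(2)]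
    by (simp_all add: \<iota>_def op_tensor_add_left[OF t] op_tensor_scalar_left[OF t] adj_op_tensor[OF t]
        id adj_id_blinfun id_blinfun_compose_id)
  have "star_automorphism ?A \<theta>1"
    unfolding star_automorphism_def
  proof (intro conjI ballI allI)
    show "bij_betw \<theta>1 ?A ?A"
      unfolding bij_betw_def
    proof
      show "inj_on \<theta>1 ?A"
      proof (rule inj_onI)
        fix a a' assume a: "a \<in> ?A" "a' \<in> ?A" "\<theta>1 a = \<theta>1 a'"
        then have "\<theta> (\<iota> a) = \<theta> (\<iota> a')" by (simp add: \<theta>1)
        then have "\<iota> a = \<iota> a'" using inj_onD[OF D(3)] \<iota>P a by blast
        then show "a = a'" using inj a by blast
      qed
      show "\<theta>1 ` ?A = ?A"
      proof (rule subset_antisym)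
        show "?A \<subseteq> \<theta>1 ` ?A"
        proof
          fix w assume w: "w \<in> ?A"
          obtain z where z: "z \<in> ?P" "\<theta> z = \<iota> w" using D(1) \<iota>P[OF w] unfolding bij_betw_def by (metis imageE)
          \<comment> \<open>Surjectivity: the preimage \<open>z\<close> must again be of the form
            \<open>a \<otimes> 1\<close>. Its commutation with \<open>1 \<otimes> C2\<close> may be
            tested after applying the injective \<open>\<theta>\<close>, which fixes
            \<open>1 \<otimes> C2\<close>.\<close>
          have "z o\<^sub>L op_tensor t id_blinfun m = op_tensor t id_blinfun m o\<^sub>L z" if m: "m \<in> C2" for m
          proof (rule inj_onD[OF D(3)])
            show "\<theta> (z o\<^sub>L op_tensor t id_blinfun m) = \<theta> (op_tensor t id_blinfun m o\<^sub>L z)"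
              using D(6)[OF z(1) C2P[OF m]] D(6)[OF C2P[OF m] z(1)] legD[OF w m] fix2[OF m] z(2) by simp
            show "z o\<^sub>L op_tensor t id_blinfun m \<in> ?P" "op_tensor t id_blinfun m o\<^sub>L z \<in> ?P"
              by (intro star_algebraD(5)[OF star_algebra_commutant_elem_tensors[OF t B1 B2]] z C2P m)+
          qed
          then obtain a where a: "a \<in> ?A" "z = \<iota> a" using legI[OF z(1)] by blast
          then have "\<theta>1 a = w" using z w by (intro eqI) auto
          then show "w \<in> \<theta>1 ` ?A" using a by blast
        qed
      qed (use \<theta>1 in blast)
    qed
  next
    fix x y assume x: "x \<in> ?A" and y: "y \<in> ?A"
    show "\<theta>1 (x + y) = \<theta>1 x + \<theta>1 y"
      by (rule eqI) (simp_all add: \<iota>_add x y D(4) \<iota>P \<theta>1 star_algebraD(4)[OF A])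
    show "\<theta>1 (x o\<^sub>L y) = \<theta>1 x o\<^sub>L \<theta>1 y"
      by (rule eqI) (simp_all add: \<iota>_comp x y D(6) \<iota>P \<theta>1 star_algebraD(5)[OF A])
  next
    fix c x assume x: "x \<in> ?A"
    show "\<theta>1 (scalar_op c o\<^sub>L x) = scalar_op c o\<^sub>L \<theta>1 x"
      by (rule eqI) (simp_all add: \<iota>_scalar[OF _ x] x D(5) \<iota>P \<theta>1 star_algebraD(2,5)[OF A])
  next
    fix x assume x: "x \<in> ?A"
    show "\<theta>1 (adj x) = adj (\<theta>1 x)"
      by (rule eqI) (simp_all add: \<iota>_adj[OF _ x] x D(7) \<iota>P \<theta>1 star_algebraD(3)[OF A])
  qed
  moreover have "\<theta>1 n = n" if "n \<in> C1" for n
    using that C1 fix1[OF that] by (intro eqI) (auto simp: \<iota>_def)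
  ultimately have "\<theta>1 \<in> Aut_fixing C1 ?A" by (simp add: Aut_fixing_def)
  then show ?thesis using \<theta>1(2) unfolding \<iota>_def by blast
qed

lemma id_Aut_fixing: "id \<in> Aut_fixing N P"
  by (simp add: Aut_fixing_def star_automorphism_def)

theorem lemma5p1:
  fixes t :: "'a::complex_hilbert_space \<Rightarrow> 'b::complex_hilbert_space \<Rightarrow> 'c::complex_hilbert_space"
    and B1 M1 :: "('a \<Rightarrow>\<^sub>L 'a) set"
    and B2 M2 :: "('b \<Rightarrow>\<^sub>L 'b) set"
    and B M :: "('c \<Rightarrow>\<^sub>L 'c) set"
    and \<theta> :: "('c \<Rightarrow>\<^sub>L 'c) \<Rightarrow> ('c \<Rightarrow>\<^sub>L 'c)"
  assumes "hilbert_tensor t"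
    and "factor B1" and "factor M1" and "irreducible_inclusion B1 M1"
    and "factor B2" and "factor M2" and "irreducible_inclusion B2 M2"
    and "B = vn_tensor t B1 B2" and "M = vn_tensor t M1 M2"
    and "\<theta> \<in> Aut_fixing (commutant M) (commutant B)"
  shows "commutant M = vn_tensor t (commutant M1) (commutant M2)
    \<and> commutant B = vn_tensor t (commutant B1) (commutant B2)
    \<and> (\<exists>\<theta>1 \<in> Aut_fixing (commutant M1) (commutant B1).
        \<exists>\<theta>2 \<in> Aut_fixing (commutant M2) (commutant B2).
          is_tensor_automorphism t (commutant B1) (commutant B2) \<theta>1 \<theta>2 \<theta>)"
proof -
  note t = assms(1)
  have vN: "von_neumann_algebra B1" "von_neumann_algebra M1" "von_neumann_algebra B2" "von_neumann_algebra M2"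
    using assms(2,3,5,6) by (auto simp: factor_def)
  have s: "star_algebra B1" "star_algebra M1" "star_algebra B2" "star_algebra M2"
    using vN by (auto intro: von_neumann_algebra_star)
  have cM: "commutant M = vn_tensor t (commutant M1) (commutant M2)"
    and cB: "commutant B = vn_tensor t (commutant B1) (commutant B2)"
    unfolding assms(8,9) by (rule commutant_vn_tensor[OF t vN(2,4)], rule commutant_vn_tensor[OF t vN(1,3)])
  have sub: "B1 \<subseteq> M1" "B2 \<subseteq> M2" and irr: "commutant B1 \<inter> M1 = range scalar_op" "commutant B2 \<inter> M2 = range scalar_op"
    using assms(4,7) by (auto simp: irreducible_inclusion_def)
  let ?P = "commutant (elem_tensors t B1 B2)"
  have "elem_tensors t B1 B2 \<subseteq> bounded_ops"
    using s by (intro elem_tensors_bounded_ops[OF t]) (auto simp: star_algebra_def)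
  then have P: "commutant B = ?P" unfolding assms(8) vn_tensor_elem_tensors by (rule commutant_triple)
  have sP: "star_algebra ?P" by (rule star_algebra_commutant_elem_tensors[OF t s(1,3)])
  have \<theta>: "star_automorphism ?P \<theta>" and fixM: "\<And>n. n \<in> commutant M \<Longrightarrow> \<theta> n = n"
    using assms(10) by (auto simp: Aut_fixing_def P)
  have norm\<theta>: "normal_on ?P \<theta>" by (rule star_automorphism_normal[OF \<theta> sP])
  have C: "commutant M1 \<subseteq> commutant B1" "commutant M2 \<subseteq> commutant B2"
    by (rule commutant_antimono[OF sub(1)], rule commutant_antimono[OF sub(2)])
  have "\<exists>\<theta>1 \<in> Aut_fixing (commutant M1) (commutant B1). \<exists>\<theta>2 \<in> Aut_fixing (commutant M2) (commutant B2).
    \<forall>a\<in>commutant B1. \<forall>b\<in>commutant B2. \<theta> (op_tensor t a b) = op_tensor t (\<theta>1 a) (\<theta>2 b)"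
  \<comment> \<open>Each leg is embedded injectively only if the other space is nonzero.\<close>
  proof (cases "(\<exists>x::'a. x \<noteq> 0) \<and> (\<exists>y::'b. y \<noteq> 0)")
    case True
    then obtain x0 :: 'a and y0 :: 'b where nz: "x0 \<noteq> 0" "y0 \<noteq> 0" by blast
    note id = bounded_ops_closed(1)
    have "id_blinfun \<in> commutant M1" "id_blinfun \<in> commutant M2" by (auto intro!: commutantI simp: id)
    then have el: "op_tensor t m id_blinfun \<in> elem_tensors t (commutant M1) (commutant M2)"
        "op_tensor t id_blinfun n \<in> elem_tensors t (commutant M1) (commutant M2)"
      if "m \<in> commutant M1" "n \<in> commutant M2" for m n
      using that by (auto simp: elem_tensors_def)
    have inM: "elem_tensors t (commutant M1) (commutant M2) \<subseteq> commutant M"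
      unfolding cM vn_tensor_elem_tensors
      by (intro subset_bicommutant elem_tensors_bounded_ops[OF t] commutant_bounded_ops)
    have fix1: "\<theta> (op_tensor t m id_blinfun) = op_tensor t m id_blinfun" if "m \<in> commutant M1" for m
      using fixM inM that \<open>id_blinfun \<in> commutant M2\<close> by (auto simp: elem_tensors_def)
    have fix2: "\<theta> (op_tensor t id_blinfun m) = op_tensor t id_blinfun m" if "m \<in> commutant M2" for m
      using fixM inM that \<open>id_blinfun \<in> commutant M1\<close> by (auto simp: elem_tensors_def)
    \<comment> \<open>The commutant of the union is
      \<open>B1' \<inter> M1'' = B1' \<inter> M1\<close>, and likewise for the second
      factor.\<close>
    have irr': "commutant (B1 \<union> commutant M1) \<subseteq> range scalar_op" "commutant (B2 \<union> commutant M2) \<subseteq> range scalar_op"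
      using irr vN(2,4) by (simp_all add: commutant_Un von_neumann_algebra_def)
    obtain \<theta>1 where \<theta>1: "\<theta>1 \<in> Aut_fixing (commutant M1) (commutant B1)"
      "\<And>a. a \<in> commutant B1 \<Longrightarrow> \<theta> (op_tensor t a id_blinfun) = op_tensor t (\<theta>1 a) id_blinfun"
      using ex_leg_automorphism[OF t s(1,3) irr'(2) C \<theta> fix1 fix2 nz(2)] by blast
    obtain \<theta>2 where \<theta>2: "\<theta>2 \<in> Aut_fixing (commutant M2) (commutant B2)"
      "\<And>b. b \<in> commutant B2 \<Longrightarrow> \<theta> (op_tensor t id_blinfun b) = op_tensor t id_blinfun (\<theta>2 b)"
      \<comment> \<open>The second leg is the first leg of the tensor product with its factors
        exchanged.\<close>
      using ex_leg_automorphism[OF hilbert_tensor_swap[OF t] s(3,1) irr'(1) C(2,1), of \<theta>,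
          unfolded elem_tensors_swap[of t] op_tensor_swap[of t], OF \<theta> fix2 fix1 nz(1)] by blast
    have "\<theta> (op_tensor t a b) = op_tensor t (\<theta>1 a) (\<theta>2 b)"
      if a: "a \<in> commutant B1" and b: "b \<in> commutant B2" for a b
    proof -
      have bo: "a \<in> bounded_ops" "b \<in> bounded_ops" using a b commutant_bounded_ops by blast+
      have "\<theta>1 a \<in> commutant B1" "\<theta>2 b \<in> commutant B2"
        using \<theta>1(1) \<theta>2(1) a b star_automorphismD(2) unfolding Aut_fixing_def by blast+
      then have bo': "\<theta>1 a \<in> bounded_ops" "\<theta>2 b \<in> bounded_ops" using commutant_bounded_ops by blast+
      have split: "op_tensor t u v = op_tensor t u id_blinfun o\<^sub>L op_tensor t id_blinfun v"
        if "u \<in> bounded_ops" "v \<in> bounded_ops" for u v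
        by (rule op_tensor_eqI[OF t]) (simp add: op_tensor_apply[OF t] that id)
      have "elem_tensors t (commutant B1) (commutant B2) \<subseteq> ?P"
        unfolding P[symmetric] cB vn_tensor_elem_tensors
        by (intro subset_bicommutant elem_tensors_bounded_ops[OF t] commutant_bounded_ops)
      moreover have "id_blinfun \<in> commutant B1" "id_blinfun \<in> commutant B2" by (auto intro!: commutantI simp: id)
      ultimately have "op_tensor t a id_blinfun \<in> ?P" "op_tensor t id_blinfun b \<in> ?P"
        using a b by (auto simp: elem_tensors_def)
      then show ?thesis
        using star_automorphismD(6)[OF \<theta>] \<theta>1(2)[OF a] \<theta>2(2)[OF b] by (simp add: split[OF bo] split[OF bo'])
    qed
    then show ?thesis using \<theta>1(1) \<theta>2(1) by blast
  next
    case False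
    \<comment> \<open>If one factor is zero, all elementary tensors vanish and any two operators on
      the tensor product agree, so identity maps serve as \<open>\<theta>1\<close> and
      \<open>\<theta>2\<close>.\<close>
    have "norm (t x y) = 0" for x y using False unfolding norm_tensor[OF t] by auto
    then have "T = T'" for T T' :: "'c \<Rightarrow>\<^sub>L 'c"
      by (intro tensor_blinfun_eqI[OF t]) (simp only: norm_eq_zero blinfun.zero_right)
    then show ?thesis by (intro bexI[of _ id] ballI id_Aut_fixing)
  qed
  then show ?thesis
    using cM cB \<theta> norm\<theta> unfolding is_tensor_automorphism_def cB[symmetric] P by blast
qed

end
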